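(* Let $X$ be a closed subset of $\mathbb{R}^n$, let $p\in\mathbb{N}$, and suppose $X\subset M$, where $M$ is a $\mathcal{C}^p$ submanifold of $\mathbb{R}^n$ and $X$ is the closure of its interior in $M$ (interior and closure taken relative to $M$). Then a function $f:X\to\mathbb{R}$ is the restriction of a $\mathcal{C}^p$ function on $\mathbb{R}^n$ if and only if $\nabla^pf:\tau^p(X)\to\mathbb{R}$.
   Context: Notation. Multiindex notation $\alpha\in\mathbb{N}^n$, $|\alpha|$, $\alpha!$, $x^\alpha$. $\mathcal{P}_p$ is the space of real polynomials on $\mathbb{R}^n$ of degree $\le p$, $\mathcal{P}_p^*$ its dual, $r=\dim\mathcal{P}_p$. For $\xi\in\mathcal{P}_p^*$, $b\in\mathbb{R}^n$, $|\alpha|\le p$: $\xi_\alpha(b):=\xi(\tfrac1{\alpha!}(x-b)^\alpha)$; $\delta_a(P)=P(a)$. A bundle over $X$ with fibres in a vector space $W$ is a subset $E\subset X\times W$ whose fibres $E_a$ are linear subspaces. For a bundle $E\subset X\times\mathcal{P}_p^*$: $\Delta E=\{(a,b,\xi+\eta):a,b\in X,\xi\in E_a,\eta\in E_b,|a-b|^{p-|\alpha|}|\eta_\alpha(b)|\le1\ \forall|\alpha|\le p\}$, $E'=\{(a,\xi):(a,a,\xi)\in\overline{\Delta E}\}$ (closure in $X\times X\times\mathcal{P}_p^*$), $\rho(E)=\{(a,\xi):\xi\in\operatorname{Span}E'_a\}$. With $E_0=\{(a,\lambda\delta_a)\}$, $\rho^i(E_0)$ is constant for $i\ge2r$ and $\tau^p(X):=\rho^{2r}(E_0)$.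 For $f:X\to\mathbb{R}$ and bundles $\Phi\subset X\times(\mathcal{P}_p^*\times\mathbb{R})$: $\Delta\Phi=\{(a,b,\xi+\eta,\lambda+\mu):(\xi,\lambda)\in\Phi_a,(\eta,\mu)\in\Phi_b,|a-b|^{p-|\alpha|}|\eta_\alpha(b)|\le1\ \forall|\alpha|\le p\}$, $\Phi'=\{(a,\xi,\lambda):(a,a,\xi,\lambda)\in\overline{\Delta\Phi}\}$, $\rho(\Phi)$ the fibrewise linear span of $\Phi'$. With $\Phi_0=\{(a,\lambda\delta_a,\lambda f(a))\}$, $\nabla^pf:=\rho^{2(r+1)}(\Phi_0)$ (stable from then on); $\nabla^pf\subset\tau^p(X)\times\mathbb{R}$. "$\nabla^pf:\tau^p(X)\to\mathbb{R}$" means that for each $a\in X$, $\xi\in\tau^p_a(X)$ there is exactly one $\lambda$ with $(a,\xi,\lambda)\in\nabla^pf$. *)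

theory Defs
  imports "HOL-Analysis.Analysis"
begin

text \<open>Multi-indices on R^n are functions 'n => nat (the index type 'n is finite,
  CARD('n) = n). An element xi of the dual space of P_p is represented by its values
  on the monomial basis: xi beta = xi(x^beta), for mdeg beta <= p. A polynomial of
  degree <= p is represented by its coefficient function in the monomial basis.
  The topology on the dual space is the product topology on functions.\<close>

definition mdeg :: "('n::finite \<Rightarrow> nat) \<Rightarrow> nat" where
  "mdeg \<alpha> = (\<Sum>i\<in>UNIV. \<alpha> i)"

definition mindex :: "nat \<Rightarrow> ('n::finite \<Rightarrow> nat) set" where
  "mindex p = {\<alpha>. mdeg \<alpha> \<le> p}"

definition mfact :: "('n::finite \<Rightarrow> nat) \<Rightarrow> real" where
  "mfact \<alpha> = (\<Prod>i\<in>UNIV. fact (\<alpha> i))"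

text \<open>Coefficients (in the monomial basis) of the polynomial (x - b)^alpha / alpha!.\<close>
definition shifted_mono :: "real^'n::finite \<Rightarrow> ('n \<Rightarrow> nat) \<Rightarrow> ('n \<Rightarrow> nat) \<Rightarrow> real" where
  "shifted_mono b \<alpha> \<beta> =
     (if (\<forall>i. \<beta> i \<le> \<alpha> i)
      then (\<Prod>i\<in>UNIV. real (\<alpha> i choose \<beta> i) * (- (b$i)) ^ (\<alpha> i - \<beta> i)) / mfact \<alpha>
      else 0)"

definition dual_app :: "nat \<Rightarrow> (('n::finite \<Rightarrow> nat) \<Rightarrow> real) \<Rightarrow> (('n \<Rightarrow> nat) \<Rightarrow> real) \<Rightarrow> real" where
  "dual_app p \<xi> c = (\<Sum>\<beta>\<in>mindex p. c \<beta> * \<xi> \<beta>)"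

definition dual_comp :: "nat \<Rightarrow> (('n::finite \<Rightarrow> nat) \<Rightarrow> real) \<Rightarrow> ('n \<Rightarrow> nat) \<Rightarrow> real^'n \<Rightarrow> real" where
  "dual_comp p \<xi> \<alpha> b = dual_app p \<xi> (shifted_mono b \<alpha>)"

definition pdelta :: "nat \<Rightarrow> real^'n::finite \<Rightarrow> ('n \<Rightarrow> nat) \<Rightarrow> real" where
  "pdelta p a = (\<lambda>\<beta>. if mdeg \<beta> \<le> p then (\<Prod>i\<in>UNIV. (a$i) ^ (\<beta> i)) else 0)"

definition fibre :: "('a \<times> 'w) set \<Rightarrow> 'a \<Rightarrow> 'w set" where
  "fibre E a = {\<xi>. (a, \<xi>) \<in> E}"

definition lspan :: "(('n \<Rightarrow> nat) \<Rightarrow> real) set \<Rightarrow> (('n \<Rightarrow> nat) \<Rightarrow> real) set" where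
  "lspan S = {\<xi>. \<exists>T c. finite T \<and> T \<subseteq> S \<and> \<xi> = (\<lambda>\<beta>. \<Sum>v\<in>T. c v * v \<beta>)}"

definition lspan2 :: "((('n \<Rightarrow> nat) \<Rightarrow> real) \<times> real) set \<Rightarrow> ((('n \<Rightarrow> nat) \<Rightarrow> real) \<times> real) set" where
  "lspan2 S = {(\<xi>, l). \<exists>T c. finite T \<and> T \<subseteq> S \<and>
        \<xi> = (\<lambda>\<beta>. \<Sum>v\<in>T. c v * fst v \<beta>) \<and> l = (\<Sum>v\<in>T. c v * snd v)}"

definition DeltaE :: "nat \<Rightarrow> (real^'n::finite) set \<Rightarrow> ((real^'n) \<times> (('n \<Rightarrow> nat) \<Rightarrow> real)) set
    \<Rightarrow> ((real^'n) \<times> (real^'n) \<times> (('n \<Rightarrow> nat) \<Rightarrow> real)) set" where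
  "DeltaE p X E = {(a, b, \<lambda>\<beta>. \<xi> \<beta> + \<eta> \<beta>) | a b \<xi> \<eta>.
      a \<in> X \<and> b \<in> X \<and> \<xi> \<in> fibre E a \<and> \<eta> \<in> fibre E b \<and>
      (\<forall>\<alpha>. mdeg \<alpha> \<le> p \<longrightarrow> dist a b ^ (p - mdeg \<alpha>) * \<bar>dual_comp p \<eta> \<alpha> b\<bar> \<le> 1)}"

text \<open>Closure in X x X x P_p^*, i.e. the ambient closure intersected with X x X x P_p^*.\<close>
definition primeE :: "nat \<Rightarrow> (real^'n::finite) set \<Rightarrow> ((real^'n) \<times> (('n \<Rightarrow> nat) \<Rightarrow> real)) set
    \<Rightarrow> ((real^'n) \<times> (('n \<Rightarrow> nat) \<Rightarrow> real)) set" where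
  "primeE p X E = {(a, \<xi>). a \<in> X \<and> (a, a, \<xi>) \<in> closure (DeltaE p X E)}"

definition rhoE :: "nat \<Rightarrow> (real^'n::finite) set \<Rightarrow> ((real^'n) \<times> (('n \<Rightarrow> nat) \<Rightarrow> real)) set
    \<Rightarrow> ((real^'n) \<times> (('n \<Rightarrow> nat) \<Rightarrow> real)) set" where
  "rhoE p X E = {(a, \<xi>). a \<in> X \<and> \<xi> \<in> lspan (fibre (primeE p X E) a)}"

definition E0 :: "nat \<Rightarrow> (real^'n::finite) set \<Rightarrow> ((real^'n) \<times> (('n \<Rightarrow> nat) \<Rightarrow> real)) set" where
  "E0 p X = {(a, \<lambda>\<beta>. c * pdelta p a \<beta>) | a c. a \<in> X}"

text \<open>r = dim P_p = card (mindex p).\<close>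
definition tau :: "nat \<Rightarrow> (real^'n::finite) set \<Rightarrow> ((real^'n) \<times> (('n \<Rightarrow> nat) \<Rightarrow> real)) set" where
  "tau p X = (rhoE p X ^^ (2 * card (mindex p :: ('n \<Rightarrow> nat) set))) (E0 p X)"

definition DeltaF :: "nat \<Rightarrow> (real^'n::finite) set \<Rightarrow> ((real^'n) \<times> (('n \<Rightarrow> nat) \<Rightarrow> real) \<times> real) set
    \<Rightarrow> ((real^'n) \<times> (real^'n) \<times> (('n \<Rightarrow> nat) \<Rightarrow> real) \<times> real) set" where
  "DeltaF p X \<Phi> = {(a, b, \<lambda>\<beta>. \<xi> \<beta> + \<eta> \<beta>, l + m) | a b \<xi> \<eta> l m.
      a \<in> X \<and> b \<in> X \<and> (\<xi>, l) \<in> fibre \<Phi> a \<and> (\<eta>, m) \<in> fibre \<Phi> b \<and>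
      (\<forall>\<alpha>. mdeg \<alpha> \<le> p \<longrightarrow> dist a b ^ (p - mdeg \<alpha>) * \<bar>dual_comp p \<eta> \<alpha> b\<bar> \<le> 1)}"

definition primeF :: "nat \<Rightarrow> (real^'n::finite) set \<Rightarrow> ((real^'n) \<times> (('n \<Rightarrow> nat) \<Rightarrow> real) \<times> real) set
    \<Rightarrow> ((real^'n) \<times> (('n \<Rightarrow> nat) \<Rightarrow> real) \<times> real) set" where
  "primeF p X \<Phi> = {(a, \<xi>, l). a \<in> X \<and> (a, a, \<xi>, l) \<in> closure (DeltaF p X \<Phi>)}"

definition rhoF :: "nat \<Rightarrow> (real^'n::finite) set \<Rightarrow> ((real^'n) \<times> (('n \<Rightarrow> nat) \<Rightarrow> real) \<times> real) set
    \<Rightarrow> ((real^'n) \<times> (('n \<Rightarrow> nat) \<Rightarrow> real) \<times> real) set" where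
  "rhoF p X \<Phi> = {(a, v). a \<in> X \<and> v \<in> lspan2 (fibre (primeF p X \<Phi>) a)}"

definition Phi0 :: "nat \<Rightarrow> (real^'n::finite) set \<Rightarrow> (real^'n \<Rightarrow> real)
    \<Rightarrow> ((real^'n) \<times> (('n \<Rightarrow> nat) \<Rightarrow> real) \<times> real) set" where
  "Phi0 p X f = {(a, \<lambda>\<beta>. c * pdelta p a \<beta>, c * f a) | a c. a \<in> X}"

definition nabla :: "nat \<Rightarrow> (real^'n::finite) set \<Rightarrow> (real^'n \<Rightarrow> real)
    \<Rightarrow> ((real^'n) \<times> (('n \<Rightarrow> nat) \<Rightarrow> real) \<times> real) set" where
  "nabla p X f = (rhoF p X ^^ (2 * (card (mindex p :: ('n \<Rightarrow> nat) set) + 1))) (Phi0 p X f)"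

definition Cp_on :: "nat \<Rightarrow> (real^'n::finite) set \<Rightarrow> (real^'n \<Rightarrow> real) \<Rightarrow> bool" where
  "Cp_on p U F \<longleftrightarrow> (\<exists>D :: ('n \<Rightarrow> nat) \<Rightarrow> real^'n \<Rightarrow> real.
      (\<forall>x\<in>U. D (\<lambda>_. 0) x = F x) \<and>
      (\<forall>\<alpha>. mdeg \<alpha> \<le> p \<longrightarrow> continuous_on U (D \<alpha>)) \<and>
      (\<forall>\<alpha> i. mdeg \<alpha> < p \<longrightarrow> (\<forall>x\<in>U.
          ((\<lambda>t. D \<alpha> (x + t *\<^sub>R axis i 1)) has_real_derivative D (\<alpha>(i := Suc (\<alpha> i))) x) (at 0))))"

definition Cp_map_on :: "nat \<Rightarrow> (real^'n::finite) set \<Rightarrow> (real^'n \<Rightarrow> real^'n) \<Rightarrow> bool" where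
  "Cp_map_on p U \<phi> \<longleftrightarrow> (\<forall>j. Cp_on p U (\<lambda>x. \<phi> x $ j))"

definition Cp_diffeo :: "nat \<Rightarrow> (real^'n::finite) set \<Rightarrow> (real^'n) set \<Rightarrow> (real^'n \<Rightarrow> real^'n) \<Rightarrow> bool" where
  "Cp_diffeo p U V \<phi> \<longleftrightarrow> open U \<and> open V \<and> \<phi> ` U = V \<and> Cp_map_on p U \<phi> \<and>
      (\<exists>\<psi>. Cp_map_on p V \<psi> \<and> (\<forall>x\<in>U. \<psi> (\<phi> x) = x))"

definition Cp_submanifold :: "nat \<Rightarrow> (real^'n::finite) set \<Rightarrow> bool" where
  "Cp_submanifold p M \<longleftrightarrow> (\<exists>d. \<forall>m\<in>M. \<exists>U V \<phi> L.
      m \<in> U \<and> Cp_diffeo p U V \<phi> \<and> subspace L \<and> dim L = d \<and> \<phi> ` (M \<inter> U) = V \<inter> L)"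

end

theory Submission
  imports Defs
begin

text \<open>
  If \<open>f\<close> is the restriction of a \<open>C\<^sup>p\<close> function \<open>F\<close>, Taylor's theorem shows by induction that
  \<open>\<rho>\<^sup>i(\<Phi>\<^sub>0)\<close> is the graph over \<open>\<rho>\<^sup>i(E\<^sub>0)\<close> of the map sending a functional \<open>\<xi>\<close> over \<open>a\<close> to its value on
  the Taylor polynomial of \<open>F\<close> at \<open>a\<close>; the iterates increase, so no stabilisation is needed.

  Conversely only uniqueness of the value over the zero functional in \<open>\<rho>\<^bsup>p+2\<^esup>(\<Phi>\<^sub>0)\<close> is needed.
  Compose a chart inverse with a linear projection onto the model subspace: this gives a \<open>C\<^sup>p\<close> map
  \<open>h\<close> from an open subset of \<open>\<real>\<^sup>n\<close> into \<open>M\<close> such that \<open>h\<^sup>-\<^sup>1(X)\<close> is the closure of its interior. The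
  functionals \<open>P \<mapsto> \<partial>\<^sup>\<beta>(P \<circ> h)(y)\<close> are limits of difference quotients at interior points
  and limits of these elsewhere, so they acquire values after \<open>p + 1\<close> steps. One more step shows
  that these values satisfy Whitney's conditions, and Whitney's extension theorem (by a dyadic grid
  partition of unity) extends \<open>f \<circ> h\<close>. Local extensions are then patched together.
\<close>

subsection \<open>Partial derivatives and functions of class \<open>C\<^sup>k\<close>\<close>

definition has_partial :: "'n \<Rightarrow> (real^'n::finite \<Rightarrow> real) \<Rightarrow> real \<Rightarrow> real^'n \<Rightarrow> bool" where
  "has_partial i F d x \<longleftrightarrow> ((\<lambda>t. F (x + t *\<^sub>R axis i 1)) has_real_derivative d) (at 0)"

definition partial :: "'n \<Rightarrow> (real^'n::finite \<Rightarrow> real) \<Rightarrow> real^'n \<Rightarrow> real" where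
  "partial i F x = deriv (\<lambda>t. F (x + t *\<^sub>R axis i 1)) 0"

lemma has_partial_imp_partial: "has_partial i F d x \<Longrightarrow> partial i F x = d"
  unfolding has_partial_def partial_def by (rule DERIV_imp_deriv)

lemma has_partial_unique: "has_partial i F d x \<Longrightarrow> has_partial i F e x \<Longrightarrow> d = e"
  using has_partial_imp_partial by metis

lemma has_partial_imp_DERIV:
  assumes "has_partial i F d (x + s *\<^sub>R axis i 1)"
  shows "((\<lambda>t. F (x + t *\<^sub>R axis i 1)) has_real_derivative d) (at s)"
proof -
  have "((\<lambda>t. F (x + (t + s) *\<^sub>R axis i 1)) has_real_derivative d) (at 0)"
    using assms unfolding has_partial_def by (simp add: algebra_simps scaleR_add_left)
  then have "((\<lambda>t. F (x + t *\<^sub>R axis i 1)) has_real_derivative d) (at (0 + s))"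
    by (subst DERIV_shift) simp
  then show ?thesis by simp
qed

lemma has_partial_translate:
  "has_partial i F d (x + w) \<Longrightarrow> has_partial i (\<lambda>y. F (y + w)) d x"
  unfolding has_partial_def by (simp add: algebra_simps)

lemma eventually_eq_on_line:
  fixes x v :: "'a::real_normed_vector"
  assumes "open U" "x \<in> U" "\<And>y. y \<in> U \<Longrightarrow> F y = G y"
  shows "\<forall>\<^sub>F t in nhds 0. F (x + t *\<^sub>R v) = G (x + t *\<^sub>R v)"
proof -
  have "((\<lambda>t. x + t *\<^sub>R v) \<longlongrightarrow> x + 0 *\<^sub>R v) (nhds 0)"
    by (intro tendsto_intros filterlim_ident)
  then have "\<forall>\<^sub>F t in nhds 0. x + t *\<^sub>R v \<in> U"
    using topological_tendstoD[OF _ assms(1)] assms(2) by simp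
  then show ?thesis by eventually_elim (rule assms(3))
qed

lemma has_partial_cong:
  assumes "open U" "x \<in> U" "\<And>y. y \<in> U \<Longrightarrow> F y = G y" "has_partial i F d x"
  shows "has_partial i G d x"
  using assms(4) eventually_eq_on_line[OF assms(1-3)] unfolding has_partial_def
  by (subst (asm) DERIV_cong_ev[OF refl _ refl]) auto

lemma partial_cong:
  assumes "open U" "x \<in> U" "\<And>y. y \<in> U \<Longrightarrow> F y = G y"
  shows "partial i F x = partial i G x"
  unfolding partial_def by (rule deriv_cong_ev[OF eventually_eq_on_line[OF assms] refl])

lemma has_partial_const: "has_partial i (\<lambda>x. c) 0 x"
  unfolding has_partial_def by simp

lemma has_partial_add:
  "has_partial i F d x \<Longrightarrow> has_partial i G e x \<Longrightarrow> has_partial i (\<lambda>x. F x + G x) (d + e) x"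
  unfolding has_partial_def by (rule DERIV_add)

lemma has_partial_diff:
  "has_partial i F d x \<Longrightarrow> has_partial i G e x \<Longrightarrow> has_partial i (\<lambda>x. F x - G x) (d - e) x"
  unfolding has_partial_def by (rule DERIV_diff)

lemma has_partial_mult:
  assumes "has_partial i F d x" "has_partial i G e x"
  shows "has_partial i (\<lambda>x. F x * G x) (d * G x + F x * e) x"
  using DERIV_mult[OF assms[unfolded has_partial_def]] unfolding has_partial_def
  by (simp add: algebra_simps)

lemma has_partial_cmult: "has_partial i F d x \<Longrightarrow> has_partial i (\<lambda>x. c * F x) (c * d) x"
  unfolding has_partial_def by (rule DERIV_cmult)

lemma has_partial_sum:
  "(\<And>q. q \<in> Q \<Longrightarrow> has_partial i (F q) (d q) x) \<Longrightarrow>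
    has_partial i (\<lambda>x. \<Sum>q\<in>Q. F q x) (\<Sum>q\<in>Q. d q) x"
  unfolding has_partial_def by (rule DERIV_sum)

lemma partial_add:
  "has_partial i F (partial i F x) x \<Longrightarrow> has_partial i G (partial i G x) x \<Longrightarrow>
    partial i (\<lambda>x. F x + G x) x = partial i F x + partial i G x"
  by (intro has_partial_imp_partial has_partial_add)

lemma partial_mult:
  "has_partial i F (partial i F x) x \<Longrightarrow> has_partial i G (partial i G x) x \<Longrightarrow>
    partial i (\<lambda>x. F x * G x) x = partial i F x * G x + F x * partial i G x"
  by (intro has_partial_imp_partial has_partial_mult)

lemma partial_cmult:
  "has_partial i F (partial i F x) x \<Longrightarrow> partial i (\<lambda>x. c * F x) x = c * partial i F x"
  by (intro has_partial_imp_partial has_partial_cmult)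

lemma partial_const [simp]: "partial i (\<lambda>x. c) = (\<lambda>x. 0)"
  by (intro ext has_partial_imp_partial has_partial_const)

lemma has_derivative_imp_has_partial:
  assumes "(F has_derivative F') (at x)"
  shows "has_partial i F (F' (axis i 1)) x"
proof -
  interpret bounded_linear F' using assms by (rule has_derivative_bounded_linear)
  have "((\<lambda>t. x + t *\<^sub>R axis i 1) has_derivative (\<lambda>t. t *\<^sub>R axis i (1::real))) (at (0::real))"
    by (auto intro!: derivative_eq_intros)
  moreover have "(F has_derivative F') (at (x + 0 *\<^sub>R axis i 1))" using assms by simp
  ultimately have "((\<lambda>t. F (x + t *\<^sub>R axis i 1)) has_derivative (\<lambda>t. F' (t *\<^sub>R axis i 1))) (at 0)"
    using has_derivative_compose by blast
  then show ?thesis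
    unfolding has_partial_def has_field_derivative_def by (simp add: scaleR mult_commute_abs)
qed

lemma has_partial_compose:
  fixes \<phi> :: "real^'m::finite \<Rightarrow> real^'n::finite"
  assumes "(F has_derivative F') (at (\<phi> x))" "\<And>j. has_partial i (\<lambda>x. \<phi> x $ j) (d j) x"
  shows "has_partial i (\<lambda>x. F (\<phi> x)) (F' (\<chi> j. d j)) x"
proof -
  interpret bounded_linear F' using assms(1) by (rule has_derivative_bounded_linear)
  have "((\<lambda>t. \<phi> (x + t *\<^sub>R axis i 1)) has_derivative (\<lambda>t. t *\<^sub>R (\<chi> j. d j))) (at 0)"
  proof (subst has_derivative_componentwise_within, rule ballI)
    fix b :: "real^'n" assume "b \<in> Basis"
    then obtain j where "b = axis j 1" by (auto simp: Basis_vec_def)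
    then show "((\<lambda>t. \<phi> (x + t *\<^sub>R axis i 1) \<bullet> b) has_derivative (\<lambda>t. (t *\<^sub>R (\<chi> j. d j)) \<bullet> b)) (at 0)"
      using assms(2)[of j] unfolding has_partial_def has_field_derivative_def
      by (simp add: inner_axis mult.commute[of _ "d _"] fun_eq_iff)
  qed
  moreover have "(F has_derivative F') (at (\<phi> (x + 0 *\<^sub>R axis i 1)))" using assms(1) by simp
  ultimately have "((\<lambda>t. F (\<phi> (x + t *\<^sub>R axis i 1))) has_derivative (\<lambda>t. F' (t *\<^sub>R (\<chi> j. d j)))) (at 0)"
    using has_derivative_compose by blast
  then show ?thesis
    unfolding has_partial_def has_field_derivative_def by (simp add: scaleR mult_commute_abs)
qed

lemma has_partial_mvt:
  assumes "\<And>t. \<bar>t\<bar> \<le> \<bar>s\<bar> \<Longrightarrow> has_partial i F (F' (x + t *\<^sub>R axis i 1)) (x + t *\<^sub>R axis i 1)"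
  obtains u where "\<bar>u\<bar> \<le> \<bar>s\<bar>" "F (x + s *\<^sub>R axis i 1) - F x = s * F' (x + u *\<^sub>R axis i 1)"
proof -
  have deriv: "((\<lambda>t. F (x + t *\<^sub>R axis i 1)) has_real_derivative F' (x + t *\<^sub>R axis i 1)) (at t)"
    if "\<bar>t\<bar> \<le> \<bar>s\<bar>" for t
    by (rule has_partial_imp_DERIV[OF assms[OF that]])
  consider "s = 0" | "s > 0" | "s < 0" by linarith
  then show thesis
  proof cases
    case 1
    then show thesis by (auto intro: that[of 0])
  next
    case 2
    then obtain u where "0 < u" "u < s"
      "F (x + s *\<^sub>R axis i 1) - F (x + 0 *\<^sub>R axis i 1) = (s - 0) * F' (x + u *\<^sub>R axis i 1)"
      using MVT2[of 0 s "\<lambda>t. F (x + t *\<^sub>R axis i 1)" "\<lambda>t. F' (x + t *\<^sub>R axis i 1)"] deriv by auto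
    then show thesis by (intro that[of u]) auto
  next
    case 3
    then obtain u where "s < u" "u < 0"
      "F (x + 0 *\<^sub>R axis i 1) - F (x + s *\<^sub>R axis i 1) = (0 - s) * F' (x + u *\<^sub>R axis i 1)"
      using MVT2[of s 0 "\<lambda>t. F (x + t *\<^sub>R axis i 1)" "\<lambda>t. F' (x + t *\<^sub>R axis i 1)"] deriv by auto
    then show thesis by (intro that[of u]) (auto simp: algebra_simps)
  qed
qed

text \<open>Move along the coordinates one at a time.\<close>

lemma partial_increment_bound:
  fixes F :: "real^'n::finite \<Rightarrow> real"
  assumes "\<And>i y. y \<in> ball x r \<Longrightarrow> has_partial i F (D i y) y"
    and near: "\<And>i y. y \<in> ball x r \<Longrightarrow> \<bar>D i y - D i x\<bar> \<le> e"
    and "norm h < r" "finite I"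
  shows "\<bar>F (x + (\<Sum>i\<in>I. h$i *\<^sub>R axis i 1)) - F x - (\<Sum>i\<in>I. h$i * D i x)\<bar> \<le> e * (\<Sum>i\<in>I. \<bar>h$i\<bar>)"
  using \<open>finite I\<close>
proof (induction I rule: finite_induct)
  case (insert j I)
  define v where "v = (\<Sum>i\<in>I. h$i *\<^sub>R axis i (1::real))"
  have v: "v $ k = (if k \<in> I then h$k else 0)" for k
    using \<open>finite I\<close> by (simp add: v_def axis_def if_distrib cong: if_cong)
  have in_ball: "x + v + t *\<^sub>R axis j 1 \<in> ball x r" if "\<bar>t\<bar> \<le> \<bar>h$j\<bar>" for t
  proof -
    have "norm (v + t *\<^sub>R axis j 1) \<le> norm h"
      by (rule norm_le_componentwise_cart) (use that insert.hyps(2) in \<open>auto simp: v axis_def\<close>)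
    then have "dist (x + (v + t *\<^sub>R axis j 1)) x < r" using \<open>norm h < r\<close> by (simp add: dist_norm)
    then show ?thesis by (simp add: dist_commute add.assoc)
  qed
  obtain u where u: "\<bar>u\<bar> \<le> \<bar>h$j\<bar>"
    "F (x + v + h$j *\<^sub>R axis j 1) - F (x + v) = h$j * D j (x + v + u *\<^sub>R axis j 1)"
    using has_partial_mvt[of "h$j" j F "D j" "x + v"] assms(1) in_ball by blast
  have "\<bar>F (x + v + h$j *\<^sub>R axis j 1) - F (x + v) - h$j * D j x\<bar> =
      \<bar>h$j\<bar> * \<bar>D j (x + v + u *\<^sub>R axis j 1) - D j x\<bar>"
    unfolding u(2) by (simp add: abs_mult[symmetric] right_diff_distrib)
  also have "\<dots> \<le> \<bar>h$j\<bar> * e" by (intro mult_left_mono near in_ball u) auto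
  finally have "\<bar>F (x + v + h$j *\<^sub>R axis j 1) - F (x + v) - h$j * D j x\<bar> \<le> e * \<bar>h$j\<bar>"
    by (simp add: mult.commute)
  then have "\<bar>F (x + v + h$j *\<^sub>R axis j 1) - F x - (h$j * D j x + (\<Sum>i\<in>I. h$i * D i x))\<bar> \<le>
      e * \<bar>h$j\<bar> + e * (\<Sum>i\<in>I. \<bar>h$i\<bar>)"
    using insert.IH unfolding v_def[symmetric] by linarith
  then show ?case using insert.hyps by (simp add: v_def algebra_simps)
qed auto

lemma has_derivative_of_partials:
  fixes F :: "real^'n::finite \<Rightarrow> real"
  assumes "open U" "x \<in> U" "\<And>i y. y \<in> U \<Longrightarrow> has_partial i F (D i y) y"
    "\<And>i. continuous_on U (D i)"
  shows "(F has_derivative (\<lambda>h. \<Sum>i\<in>UNIV. h$i * D i x)) (at x)"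
  unfolding has_derivative_at_alt
proof (intro conjI allI impI)
  show "bounded_linear (\<lambda>h::real^'n. \<Sum>i\<in>UNIV. h$i * D i x)"
    by (intro bounded_linear_sum bounded_linear_mult_const bounded_linear_vec_nth)
  fix e :: real assume "e > 0"
  define \<epsilon> where "\<epsilon> = e / CARD('n)"
  have "\<epsilon> > 0" using \<open>e > 0\<close> by (simp add: \<epsilon>_def)
  have "\<forall>\<^sub>F y in nhds x. \<forall>i\<in>UNIV. dist (D i y) (D i x) < \<epsilon>"
  proof (intro eventually_ball_finite finite ballI)
    fix i
    have "isCont (D i) x" using assms by (simp add: continuous_on_eq_continuous_at)
    then show "\<forall>\<^sub>F y in nhds x. dist (D i y) (D i x) < \<epsilon>"
      using \<open>\<epsilon> > 0\<close> unfolding isCont_def tendsto_at_iff_tendsto_nhds by (auto dest: tendstoD)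
  qed
  moreover have "\<forall>\<^sub>F y in nhds x. y \<in> U" using assms(1,2) eventually_nhds by blast
  ultimately have "\<forall>\<^sub>F y in nhds x. y \<in> U \<and> (\<forall>i. \<bar>D i y - D i x\<bar> \<le> \<epsilon>)"
    by eventually_elim (auto simp: dist_real_def less_imp_le)
  then obtain r where r: "r > 0" "\<And>y. y \<in> ball x r \<Longrightarrow> y \<in> U \<and> (\<forall>i. \<bar>D i y - D i x\<bar> \<le> \<epsilon>)"
    unfolding eventually_nhds_metric by (auto simp: dist_commute)
  show "\<exists>d>0. \<forall>y. norm (y - x) < d \<longrightarrow>
      norm (F y - F x - (\<Sum>i\<in>UNIV. (y - x)$i * D i x)) \<le> e * norm (y - x)"
  proof (intro exI[of _ r] conjI allI impI r(1))
    fix y assume "norm (y - x) < r"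
    moreover have "x + (\<Sum>i\<in>UNIV. (y - x)$i *\<^sub>R axis i 1) = y"
      using basis_expansion[of "y - x"] by (simp add: scalar_mult_eq_scaleR)
    ultimately have "\<bar>F y - F x - (\<Sum>i\<in>UNIV. (y - x)$i * D i x)\<bar> \<le> \<epsilon> * (\<Sum>i\<in>UNIV. \<bar>(y - x)$i\<bar>)"
      using partial_increment_bound[of x r F D \<epsilon> "y - x" UNIV] r assms(3) by simp
    also have "\<dots> \<le> \<epsilon> * (\<Sum>i\<in>(UNIV::'n set). norm (y - x))"
      using \<open>\<epsilon> > 0\<close> by (intro mult_left_mono sum_mono component_le_norm_cart) auto
    also have "\<dots> = e * norm (y - x)" by (simp add: \<epsilon>_def)
    finally show "norm (F y - F x - (\<Sum>i\<in>UNIV. (y - x)$i * D i x)) \<le> e * norm (y - x)" by simp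
  qed
qed

fun Ck_on :: "nat \<Rightarrow> (real^'n::finite) set \<Rightarrow> (real^'n \<Rightarrow> real) \<Rightarrow> bool" where
  "Ck_on 0 U F \<longleftrightarrow> continuous_on U F"
| "Ck_on (Suc k) U F \<longleftrightarrow> continuous_on U F \<and>
     (\<forall>i. (\<forall>x\<in>U. has_partial i F (partial i F x) x) \<and> Ck_on k U (partial i F))"

lemma Ck_on_imp_continuous_on: "Ck_on k U F \<Longrightarrow> continuous_on U F"
  by (cases k) auto

lemma Ck_on_cong:
  assumes "open U" "\<And>y. y \<in> U \<Longrightarrow> F y = G y" "Ck_on k U F"
  shows "Ck_on k U G"
  using assms(2,3)
proof (induction k arbitrary: F G)
  case 0
  then show ?case using continuous_on_cong[of U U F G] by auto
next
  case (Suc k)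
  have partial: "partial i F x = partial i G x" if "x \<in> U" for i x
    using partial_cong[OF assms(1) that Suc.prems(1)] by simp
  have "Ck_on k U (partial i G)" for i using Suc.IH[OF partial] Suc.prems(2) by auto
  moreover have "has_partial i G (partial i G x) x" if "x \<in> U" for i x
    using has_partial_cong[OF assms(1) that Suc.prems(1)] Suc.prems(2) that partial by auto
  moreover have "continuous_on U G"
    using Suc.prems continuous_on_cong[of U U F G] by auto
  ultimately show ?case by simp
qed

lemma Ck_on_SucI:
  assumes "open U" "continuous_on U F" "\<And>i x. x \<in> U \<Longrightarrow> has_partial i F (D i x) x"
    "\<And>i. Ck_on k U (D i)"
  shows "Ck_on (Suc k) U F"
proof -
  have partial: "D i x = partial i F x" if "x \<in> U" for i x
    using assms(3)[OF that] has_partial_imp_partial by metis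
  have "Ck_on k U (partial i F)" for i using Ck_on_cong[OF assms(1) partial assms(4)] .
  then show ?thesis using assms(2,3) partial by auto
qed

lemma Ck_on_SucD: "Ck_on (Suc k) U F \<Longrightarrow> Ck_on k U F"
  by (induction k arbitrary: F) auto

lemma Ck_on_subset: "Ck_on k U F \<Longrightarrow> V \<subseteq> U \<Longrightarrow> Ck_on k V F"
  by (induction k arbitrary: F) (auto intro: continuous_on_subset)

lemma continuous_on_locally:
  fixes F :: "'a::t2_space \<Rightarrow> 'b::topological_space"
  assumes "\<And>x. x \<in> U \<Longrightarrow> \<exists>V. open V \<and> x \<in> V \<and> continuous_on V F"
  shows "continuous_on U F"
  unfolding continuous_on_eq_continuous_within
proof
  fix x assume "x \<in> U"
  then obtain V where "open V" "x \<in> V" "continuous_on V F" using assms by blast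
  then show "continuous (at x within U) F"
    by (simp add: continuous_on_eq_continuous_at continuous_at_imp_continuous_at_within)
qed

lemma Ck_on_locally:
  assumes "\<And>x. x \<in> U \<Longrightarrow> \<exists>V. open V \<and> x \<in> V \<and> Ck_on k V F"
  shows "Ck_on k U F"
  using assms
proof (induction k arbitrary: F)
  case 0
  then show ?case using continuous_on_locally[of U F] by simp
next
  case (Suc k)
  have "continuous_on U F"
    by (rule continuous_on_locally) (use Suc.prems in fastforce)
  moreover have "Ck_on k U (partial i F)" for i
    by (rule Suc.IH) (use Suc.prems in fastforce)
  moreover have "has_partial i F (partial i F x) x" if "x \<in> U" for i x
    using Suc.prems[OF that] by auto
  ultimately show ?case by simp
qed

lemma Ck_on_const: "Ck_on k U (\<lambda>x. c)"
  by (induction k arbitrary: c) (auto intro: has_partial_const)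

lemma Ck_on_add:
  assumes "open U" "Ck_on k U F" "Ck_on k U G"
  shows "Ck_on k U (\<lambda>x. F x + G x)"
  using assms(2,3)
proof (induction k arbitrary: F G)
  case 0
  then show ?case by (auto intro: continuous_intros)
next
  case (Suc k)
  show ?case
    by (rule Ck_on_SucI[OF assms(1), where D = "\<lambda>i x. partial i F x + partial i G x"])
      (use Suc in \<open>auto intro: continuous_intros has_partial_add\<close>)
qed

lemma Ck_on_mult:
  assumes "open U" "Ck_on k U F" "Ck_on k U G"
  shows "Ck_on k U (\<lambda>x. F x * G x)"
  using assms(2,3)
proof (induction k arbitrary: F G)
  case 0
  then show ?case by (auto intro: continuous_intros)
next
  case (Suc k)
  have "Ck_on k U F" and "Ck_on k U G" using Suc.prems Ck_on_SucD by blast+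
  then show ?case
    by (intro Ck_on_SucI[OF assms(1), where D = "\<lambda>i x. partial i F x * G x + F x * partial i G x"])
      (use Suc in \<open>auto intro: continuous_intros has_partial_mult Ck_on_add[OF assms(1)]\<close>)
qed

lemma Ck_on_cmult: "open U \<Longrightarrow> Ck_on k U F \<Longrightarrow> Ck_on k U (\<lambda>x. c * F x)"
  using Ck_on_mult[OF _ Ck_on_const] .

lemma Ck_on_diff: "open U \<Longrightarrow> Ck_on k U F \<Longrightarrow> Ck_on k U G \<Longrightarrow> Ck_on k U (\<lambda>x. F x - G x)"
  using Ck_on_add[of U k F "\<lambda>x. (-1) * G x"] Ck_on_cmult[of U k G "-1"] by simp

lemma Ck_on_sum:
  assumes "open U" "\<And>q. q \<in> Q \<Longrightarrow> Ck_on k U (F q)"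
  shows "Ck_on k U (\<lambda>x. \<Sum>q\<in>Q. F q x)"
  using assms(2)
  by (induction Q rule: infinite_finite_induct) (auto intro: Ck_on_add[OF assms(1)] Ck_on_const)

lemma Ck_on_prod:
  assumes "open U" "\<And>q. q \<in> Q \<Longrightarrow> Ck_on k U (F q)"
  shows "Ck_on k U (\<lambda>x. \<Prod>q\<in>Q. F q x)"
  using assms(2)
  by (induction Q rule: infinite_finite_induct) (auto intro: Ck_on_mult[OF assms(1)] Ck_on_const)

lemma Ck_on_power: "open U \<Longrightarrow> Ck_on k U F \<Longrightarrow> Ck_on k U (\<lambda>x. F x ^ m)"
  by (induction m) (auto intro: Ck_on_const Ck_on_mult)

lemma Ck_on_bounded_linear:
  assumes "bounded_linear h"
  shows "Ck_on k UNIV h"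
proof (cases k)
  case 0
  then show ?thesis using assms by (simp add: linear_continuous_on)
next
  case (Suc l)
  have "Ck_on (Suc l) UNIV h"
    by (rule Ck_on_SucI[where D = "\<lambda>i x. h (axis i 1)"])
      (use assms in \<open>auto simp: linear_continuous_on bounded_linear_imp_has_derivative
        intro: Ck_on_const has_derivative_imp_has_partial\<close>)
  then show ?thesis using Suc by simp
qed

lemma Ck_on_has_derivative:
  assumes "open U" "x \<in> U" "Ck_on (Suc k) U F"
  shows "(F has_derivative (\<lambda>h. \<Sum>i\<in>UNIV. h$i * partial i F x)) (at x)"
  by (rule has_derivative_of_partials[OF assms(1,2)]) (use assms(3) Ck_on_imp_continuous_on in auto)

lemma continuous_on_vec_components:
  assumes "\<And>j. continuous_on U (\<lambda>x. \<phi> x $ j)"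
  shows "continuous_on U \<phi>"
  using continuous_on_vec_lambda[of U "\<lambda>j x. \<phi> x $ j"] assms by simp

lemma Ck_on_compose:
  fixes \<phi> :: "real^'m::finite \<Rightarrow> real^'n::finite"
  assumes "open U" "open V" "\<phi> ` U \<subseteq> V" "Ck_on k V F" "\<And>j. Ck_on k U (\<lambda>x. \<phi> x $ j)"
  shows "Ck_on k U (\<lambda>x. F (\<phi> x))"
  using assms(4,5)
proof (induction k arbitrary: F)
  case 0
  have "continuous_on U \<phi>"
    by (rule continuous_on_vec_components) (use 0 in auto)
  then show ?case using 0 assms(3) continuous_on_compose2[of V F U \<phi>] by simp
next
  case (Suc k)
  have "continuous_on V F" using Suc.prems(1) Ck_on_imp_continuous_on by blast
  moreover have "continuous_on U \<phi>"
    by (rule continuous_on_vec_components) (use Suc.prems(2) Ck_on_imp_continuous_on in blast)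
  ultimately have cont: "continuous_on U (\<lambda>x. F (\<phi> x))"
    using continuous_on_compose2 assms(3) by blast
  show ?case
  proof (rule Ck_on_SucI[OF assms(1) cont])
    show "has_partial i (\<lambda>x. F (\<phi> x)) (\<Sum>j\<in>UNIV. partial i (\<lambda>x. \<phi> x $ j) x * partial j F (\<phi> x)) x"
      if "x \<in> U" for i x
    proof -
      have "\<phi> x \<in> V" using that assms(3) by blast
      then have "(F has_derivative (\<lambda>h. \<Sum>j\<in>UNIV. h$j * partial j F (\<phi> x))) (at (\<phi> x))"
        by (rule Ck_on_has_derivative[OF assms(2) _ Suc.prems(1)])
      moreover have "has_partial i (\<lambda>x. \<phi> x $ j) (partial i (\<lambda>x. \<phi> x $ j) x) x" for j
        using Suc.prems(2) that by simp
      ultimately show ?thesis using has_partial_compose by fastforce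
    qed
    show "Ck_on k U (\<lambda>x. \<Sum>j\<in>UNIV. partial i (\<lambda>x. \<phi> x $ j) x * partial j F (\<phi> x))" for i
    proof (intro Ck_on_sum Ck_on_mult assms(1))
      show "Ck_on k U (\<lambda>x. partial j F (\<phi> x))" for j
        by (rule Suc.IH) (use Suc.prems(1) Ck_on_SucD[OF Suc.prems(2)] in auto)
      show "Ck_on k U (partial i (\<lambda>x. \<phi> x $ j))" for j using Suc.prems(2)[of j] by simp
    qed
  qed
qed

text \<open>Both mixed partial derivatives occur as intermediate values of the same second difference.\<close>

lemma second_difference_mvt:
  fixes F :: "real^'n::finite \<Rightarrow> real"
  assumes "\<And>y. y \<in> ball x r \<Longrightarrow> has_partial i F (F' y) y"
    "\<And>y. y \<in> ball x r \<Longrightarrow> has_partial j F' (F'' y) y" "0 < s" "2 * s < r"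
  obtains z where "z \<in> ball x r" "F (x + s *\<^sub>R axis i 1 + s *\<^sub>R axis j 1) - F (x + s *\<^sub>R axis i 1)
      - F (x + s *\<^sub>R axis j 1) + F x = s * s * F'' z"
proof -
  have in_ball: "x + u *\<^sub>R axis i 1 + v *\<^sub>R axis j 1 \<in> ball x r" if "\<bar>u\<bar> \<le> s" "\<bar>v\<bar> \<le> s" for u v
  proof -
    have "norm (u *\<^sub>R axis i (1::real) + v *\<^sub>R axis j 1) \<le> \<bar>u\<bar> + \<bar>v\<bar>"
      by (rule order_trans[OF norm_triangle_ineq]) simp
    then have "dist (x + (u *\<^sub>R axis i 1 + v *\<^sub>R axis j 1)) x < r"
      using that assms(4) by (simp add: dist_norm)
    then show ?thesis by (simp add: dist_commute add.assoc)
  qed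
  define G where "G y = F (y + s *\<^sub>R axis j 1) - F y" for y
  have "has_partial i G (F' (y + s *\<^sub>R axis j 1) - F' y) y"
    if "y \<in> ball x r" "y + s *\<^sub>R axis j 1 \<in> ball x r" for y
    unfolding G_def by (intro has_partial_diff has_partial_translate assms(1) that)
  then obtain u where u: "\<bar>u\<bar> \<le> s" "G (x + s *\<^sub>R axis i 1) - G x =
      s * (F' (x + u *\<^sub>R axis i 1 + s *\<^sub>R axis j 1) - F' (x + u *\<^sub>R axis i 1))"
    using has_partial_mvt[of s i G "\<lambda>y. F' (y + s *\<^sub>R axis j 1) - F' y" x]
      in_ball[of _ 0] in_ball[of _ s] assms(3) by auto
  obtain v where v: "\<bar>v\<bar> \<le> s" "F' (x + u *\<^sub>R axis i 1 + s *\<^sub>R axis j 1) - F' (x + u *\<^sub>R axis i 1) =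
      s * F'' (x + u *\<^sub>R axis i 1 + v *\<^sub>R axis j 1)"
    using has_partial_mvt[of s j F' F'' "x + u *\<^sub>R axis i 1"] assms(2,3) in_ball[OF u(1)] by auto
  show thesis
    by (rule that[OF in_ball[OF u(1) v(1)]]) (use u(2) v(2) in \<open>simp add: G_def algebra_simps\<close>)
qed

lemma partial_commute:
  fixes F :: "real^'n::finite \<Rightarrow> real"
  assumes "open U" "x \<in> U" "Ck_on (Suc (Suc k)) U F"
  shows "partial i (partial j F) x = partial j (partial i F) x"
proof (rule ccontr)
  define e where "e = dist (partial i (partial j F) x) (partial j (partial i F) x) / 2"
  assume "partial i (partial j F) x \<noteq> partial j (partial i F) x"
  then have "e > 0" by (simp add: e_def)
  have near: "\<forall>\<^sub>F y in nhds x. dist (partial a (partial b F) y) (partial a (partial b F) x) < e"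
    for a b
  proof -
    have "isCont (partial a (partial b F)) x"
      using assms Ck_on_imp_continuous_on[of k U "partial a (partial b F)"]
      by (auto simp: continuous_on_eq_continuous_at)
    then show ?thesis
      using \<open>e > 0\<close> unfolding isCont_def tendsto_at_iff_tendsto_nhds by (auto dest: tendstoD)
  qed
  have "\<forall>\<^sub>F y in nhds x. y \<in> U" using assms eventually_nhds by blast
  then have "\<forall>\<^sub>F y in nhds x. y \<in> U \<and> dist (partial i (partial j F) y) (partial i (partial j F) x) < e \<and>
      dist (partial j (partial i F) y) (partial j (partial i F) x) < e"
    using near[of i j] near[of j i] by eventually_elim auto
  then obtain r where r: "r > 0" "\<And>y. y \<in> ball x r \<Longrightarrow> y \<in> U"
    "\<And>y. y \<in> ball x r \<Longrightarrow> dist (partial i (partial j F) y) (partial i (partial j F) x) < e"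
    "\<And>y. y \<in> ball x r \<Longrightarrow> dist (partial j (partial i F) y) (partial j (partial i F) x) < e"
    unfolding eventually_nhds_metric by (auto simp: dist_commute)
  define s where "s = r / 3"
  have s: "0 < s" "2 * s < r" using r(1) by (auto simp: s_def)
  have partials: "has_partial a F (partial a F y) y"
    "has_partial b (partial a F) (partial b (partial a F) y) y" if "y \<in> ball x r" for a b y
    using r(2)[OF that] assms(3) by auto
  obtain z where z: "z \<in> ball x r" "F (x + s *\<^sub>R axis i 1 + s *\<^sub>R axis j 1) - F (x + s *\<^sub>R axis i 1)
      - F (x + s *\<^sub>R axis j 1) + F x = s * s * partial j (partial i F) z"
    using second_difference_mvt[OF partials(1) partials(2) s] .
  obtain w where w: "w \<in> ball x r" "F (x + s *\<^sub>R axis j 1 + s *\<^sub>R axis i 1) - F (x + s *\<^sub>R axis j 1)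
      - F (x + s *\<^sub>R axis i 1) + F x = s * s * partial i (partial j F) w"
    using second_difference_mvt[OF partials(1) partials(2) s] .
  have "s * s * partial j (partial i F) z = s * s * partial i (partial j F) w"
    using z(2) w(2) by (simp add: algebra_simps)
  then have "partial j (partial i F) z = partial i (partial j F) w" using s by simp
  then have "dist (partial i (partial j F) x) (partial j (partial i F) x) < e + e"
    using dist_triangle3[of "partial i (partial j F) x" "partial j (partial i F) x"
        "partial i (partial j F) w"] r(3)[OF w(1)] r(4)[OF z(1)] by simp
  then show False by (simp add: e_def)
qed

subsection \<open>Families of derivatives\<close>

definition minc :: "'n \<Rightarrow> ('n \<Rightarrow> nat) \<Rightarrow> 'n \<Rightarrow> nat" where
  "minc i \<alpha> = \<alpha>(i := Suc (\<alpha> i))"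

lemma minc_commute: "minc i (minc j \<alpha>) = minc j (minc i \<alpha>)"
  by (auto simp: minc_def fun_eq_iff)

lemma minc_decrement: "\<alpha> i \<noteq> 0 \<Longrightarrow> minc i (\<alpha>(i := \<alpha> i - 1)) = \<alpha>"
  by (auto simp: minc_def)

lemma mdeg_zero [simp]: "mdeg (\<lambda>_. 0) = 0"
  by (simp add: mdeg_def)

lemma mdeg_eq_0_iff [simp]: "mdeg \<alpha> = 0 \<longleftrightarrow> \<alpha> = (\<lambda>_. 0)"
  by (auto simp: mdeg_def)

lemma mdeg_minc [simp]: "mdeg (minc i \<alpha>) = Suc (mdeg \<alpha>)"
proof -
  have "mdeg (minc i \<alpha>) = (\<Sum>k\<in>UNIV. \<alpha> k + (if k = i then 1 else 0))"
    unfolding mdeg_def by (rule sum.cong) (auto simp: minc_def)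
  then show ?thesis by (simp add: sum.distrib mdeg_def)
qed

lemma mdeg_add: "mdeg (\<lambda>i. \<alpha> i + \<beta> i) = mdeg \<alpha> + mdeg \<beta>"
  by (simp add: mdeg_def sum.distrib)

lemma mdeg_single: "mdeg ((\<lambda>_. 0)(i := k)) = k"
  by (simp add: mdeg_def)

lemma mdeg_SucE:
  assumes "mdeg \<alpha> = Suc k"
  obtains \<beta> i where "\<alpha> = minc i \<beta>" "mdeg \<beta> = k"
proof -
  have "\<alpha> \<noteq> (\<lambda>_. 0)" using assms by auto
  then obtain i where "\<alpha> i \<noteq> 0" by auto
  then have "\<alpha> = minc i (\<alpha>(i := \<alpha> i - 1))" by (rule minc_decrement[symmetric])
  then show thesis using that assms mdeg_minc by (metis Suc_inject)
qed

lemma multi_index_induct [case_names zero minc]: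
  fixes \<alpha> :: "'n::finite \<Rightarrow> nat"
  assumes "P (\<lambda>_. 0)" "\<And>i \<alpha>. P \<alpha> \<Longrightarrow> P (minc i \<alpha>)"
  shows "P \<alpha>"
proof (induction "mdeg \<alpha>" arbitrary: \<alpha>)
  case 0
  then show ?case using assms(1) by simp
next
  case (Suc k)
  then show ?case using assms(2) by (metis mdeg_SucE)
qed

lemma multi_index_cases [case_names zero minc]:
  fixes \<alpha> :: "'n::finite \<Rightarrow> nat"
  obtains "\<alpha> = (\<lambda>_. 0)" | i \<beta> where "\<alpha> = minc i \<beta>"
  by (cases "mdeg \<alpha>") (auto elim: mdeg_SucE)

definition derivative_family ::
    "nat \<Rightarrow> (real^'n::finite) set \<Rightarrow> (('n \<Rightarrow> nat) \<Rightarrow> real^'n \<Rightarrow> real) \<Rightarrow> bool" where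
  "derivative_family p U D \<longleftrightarrow> (\<forall>\<alpha>. mdeg \<alpha> \<le> p \<longrightarrow> continuous_on U (D \<alpha>)) \<and>
     (\<forall>\<alpha> i. mdeg \<alpha> < p \<longrightarrow> (\<forall>x\<in>U. has_partial i (D \<alpha>) (D (minc i \<alpha>) x) x))"

lemma Cp_on_iff_derivative_family:
  "Cp_on p U F \<longleftrightarrow> (\<exists>D. (\<forall>x\<in>U. D (\<lambda>_. 0) x = F x) \<and> derivative_family p U D)"
  unfolding Cp_on_def derivative_family_def has_partial_def minc_def ..

lemma derivative_familyI:
  "(\<And>\<alpha>. mdeg \<alpha> \<le> p \<Longrightarrow> continuous_on U (D \<alpha>)) \<Longrightarrow>
    (\<And>\<alpha> i x. mdeg \<alpha> < p \<Longrightarrow> x \<in> U \<Longrightarrow> has_partial i (D \<alpha>) (D (minc i \<alpha>) x) x) \<Longrightarrow>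
    derivative_family p U D"
  unfolding derivative_family_def by blast

lemma derivative_family_continuous_on:
  "derivative_family p U D \<Longrightarrow> mdeg \<alpha> \<le> p \<Longrightarrow> continuous_on U (D \<alpha>)"
  unfolding derivative_family_def by blast

lemma derivative_family_has_partial:
  "derivative_family p U D \<Longrightarrow> mdeg \<alpha> < p \<Longrightarrow> x \<in> U \<Longrightarrow> has_partial i (D \<alpha>) (D (minc i \<alpha>) x) x"
  unfolding derivative_family_def by blast

lemma derivative_family_partial:
  "derivative_family p U D \<Longrightarrow> mdeg \<alpha> < p \<Longrightarrow> x \<in> U \<Longrightarrow> partial i (D \<alpha>) x = D (minc i \<alpha>) x"
  by (intro has_partial_imp_partial derivative_family_has_partial)

lemma derivative_family_isCont:
  "derivative_family p U D \<Longrightarrow> mdeg \<alpha> \<le> p \<Longrightarrow> open U \<Longrightarrow> x \<in> U \<Longrightarrow> isCont (D \<alpha>) x"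
  using derivative_family_continuous_on continuous_on_eq_continuous_at by blast

lemma derivative_family_subset: "derivative_family p U D \<Longrightarrow> V \<subseteq> U \<Longrightarrow> derivative_family p V D"
  unfolding derivative_family_def by (meson continuous_on_subset subsetD)

lemma derivative_family_cong:
  assumes "open U" "\<And>\<alpha> x. mdeg \<alpha> \<le> p \<Longrightarrow> x \<in> U \<Longrightarrow> D \<alpha> x = E \<alpha> x" "derivative_family p U D"
  shows "derivative_family p U E"
proof (rule derivative_familyI)
  show "continuous_on U (E \<alpha>)" if "mdeg \<alpha> \<le> p" for \<alpha>
    using derivative_family_continuous_on[OF assms(3) that] assms(2)[OF that]
      continuous_on_cong[of U U "D \<alpha>" "E \<alpha>"] by auto
  show "has_partial i (E \<alpha>) (E (minc i \<alpha>) x) x" if "mdeg \<alpha> < p" "x \<in> U" for \<alpha> i x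
    using has_partial_cong[OF assms(1) that(2) _ derivative_family_has_partial[OF assms(3) that]]
      assms(2) that by simp
qed

lemma derivative_family_diff:
  "derivative_family p U D \<Longrightarrow> derivative_family p U E \<Longrightarrow> derivative_family p U (\<lambda>\<alpha> x. D \<alpha> x - E \<alpha> x)"
  unfolding derivative_family_def by (auto intro: continuous_intros has_partial_diff)

lemma derivative_family_shift:
  assumes "derivative_family (Suc p) U D"
  shows "derivative_family p U (\<lambda>\<alpha>. D (minc j \<alpha>))"
proof (rule derivative_familyI)
  show "continuous_on U (D (minc j \<alpha>))" if "mdeg \<alpha> \<le> p" for \<alpha>
    using derivative_family_continuous_on[OF assms, of "minc j \<alpha>"] that by simp
  show "has_partial i (D (minc j \<alpha>)) (D (minc j (minc i \<alpha>)) x) x" if "mdeg \<alpha> < p" "x \<in> U" for \<alpha> i x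
    using derivative_family_has_partial[OF assms _ that(2), of "minc j \<alpha>" i] that(1)
    by (simp add: minc_commute[of j])
qed

lemma derivative_family_SucI:
  assumes "continuous_on U (D (\<lambda>_. 0))"
    and "\<And>i x. x \<in> U \<Longrightarrow> has_partial i (D (\<lambda>_. 0)) (D (minc i (\<lambda>_. 0)) x) x"
    and shifted: "\<And>j. derivative_family p U (\<lambda>\<alpha>. D (minc j \<alpha>))"
  shows "derivative_family (Suc p) U D"
proof (rule derivative_familyI)
  show "continuous_on U (D \<alpha>)" if "mdeg \<alpha> \<le> Suc p" for \<alpha>
    using that derivative_family_continuous_on[OF shifted] assms(1)
    by (cases \<alpha> rule: multi_index_cases) auto
  show "has_partial i (D \<alpha>) (D (minc i \<alpha>) x) x" if "mdeg \<alpha> < Suc p" "x \<in> U" for \<alpha> i x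
    using that derivative_family_has_partial[OF shifted] assms(2)
    by (cases \<alpha> rule: multi_index_cases) (auto simp: minc_commute[of i])
qed

lemma derivative_family_imp_Ck_on:
  assumes "open U" "derivative_family p U D"
  shows "mdeg \<alpha> + k \<le> p \<Longrightarrow> Ck_on k U (D \<alpha>)"
proof (induction k arbitrary: \<alpha>)
  case 0
  then show ?case using derivative_family_continuous_on[OF assms(2)] by simp
next
  case (Suc k)
  show ?case
    by (rule Ck_on_SucI[OF assms(1), where D = "\<lambda>i. D (minc i \<alpha>)"])
      (use Suc derivative_family_continuous_on[OF assms(2)]
        derivative_family_has_partial[OF assms(2)] in auto)
qed

lemma derivative_family_unique:
  assumes "open U" "derivative_family p U D" "derivative_family p U E"
    and "\<And>x. x \<in> U \<Longrightarrow> D (\<lambda>_. 0) x = E (\<lambda>_. 0) x"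
  shows "mdeg \<alpha> \<le> p \<Longrightarrow> x \<in> U \<Longrightarrow> D \<alpha> x = E \<alpha> x"
proof (induction \<alpha> arbitrary: x rule: multi_index_induct)
  case zero
  then show ?case using assms(4) by simp
next
  case (minc i \<alpha>)
  then have "mdeg \<alpha> < p" by simp
  then have "has_partial i (E \<alpha>) (D (minc i \<alpha>) x) x" "has_partial i (E \<alpha>) (E (minc i \<alpha>) x) x"
    using has_partial_cong[OF assms(1) minc.prems(2) minc.IH] minc.prems(2)
      derivative_family_has_partial[OF assms(2)] derivative_family_has_partial[OF assms(3)] by auto
  then show ?case by (rule has_partial_unique)
qed

lemma derivative_family_mixed_symmetric:
  assumes "open U" "Ck_on (Suc p) U F" "\<And>i. derivative_family p U (D i)"
    and base: "\<And>i x. x \<in> U \<Longrightarrow> D i (\<lambda>_. 0) x = partial i F x"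
    and "mdeg \<alpha> < p" "x \<in> U"
  shows "D i (minc j \<alpha>) x = D j (minc i \<alpha>) x"
proof -
  obtain q where q: "p = Suc q" using \<open>mdeg \<alpha> < p\<close> by (cases p) auto
  note shift = derivative_family_shift[OF assms(3)[unfolded q]]
  have second: "D i (minc j (\<lambda>_. 0)) y = partial j (partial i F) y" if "y \<in> U" for i j y
    using derivative_family_partial[OF assms(3)[of i], of "\<lambda>_. 0" y j]
      partial_cong[OF assms(1) that, of "D i (\<lambda>_. 0)" "partial i F" j] base that q by simp
  have "D i (minc j (\<lambda>_. 0)) y = D j (minc i (\<lambda>_. 0)) y" if "y \<in> U" for y
    using partial_commute[OF assms(1) that assms(2)[unfolded q]] second[OF that] by simp
  from derivative_family_unique[OF assms(1) shift shift this, of \<alpha> x] assms(5,6) q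
  show ?thesis by simp
qed

lemma derivative_family_of_partials:
  assumes "open U" "Ck_on (Suc p) U F" "\<And>i. derivative_family p U (D i)"
    and base: "\<And>i x. x \<in> U \<Longrightarrow> D i (\<lambda>_. 0) x = partial i F x"
  obtains E where "E (\<lambda>_. 0) = F" "derivative_family (Suc p) U E"
proof -
  define E where "E \<alpha> = (if \<alpha> = (\<lambda>_. 0) then F else
     (let i = (SOME i. \<alpha> i \<noteq> 0) in D i (\<alpha>(i := \<alpha> i - 1))))" for \<alpha> :: "'a \<Rightarrow> nat"
  have E_minc: "E (minc j \<gamma>) x = D j \<gamma> x" if "mdeg \<gamma> \<le> p" "x \<in> U" for \<gamma> j x
  proof -
    define i where "i = (SOME i. minc j \<gamma> i \<noteq> 0)"
    have i: "minc j \<gamma> i \<noteq> 0" unfolding i_def by (rule someI[of _ j]) (simp add: minc_def)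
    then have E_eq: "E (minc j \<gamma>) = D i ((minc j \<gamma>)(i := minc j \<gamma> i - 1))"
      by (auto simp: E_def i_def Let_def)
    show ?thesis
    proof (cases "i = j")
      case True
      then show ?thesis unfolding E_eq by (simp add: minc_def)
    next
      case False
      define \<delta> where "\<delta> = \<gamma>(i := \<gamma> i - 1)"
      have "\<gamma> i \<noteq> 0" using i False by (simp add: minc_def)
      then have \<gamma>: "\<gamma> = minc i \<delta>" unfolding \<delta>_def by (rule minc_decrement[symmetric])
      have "(minc j \<gamma>)(i := minc j \<gamma> i - 1) = minc j \<delta>"
        using False by (auto simp: \<delta>_def minc_def)
      then have "E (minc j \<gamma>) x = D i (minc j \<delta>) x" by (simp only: E_eq)
      also have "\<dots> = D j (minc i \<delta>) x"
        by (rule derivative_family_mixed_symmetric[OF assms(1-3) base])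
          (use that in \<open>simp_all add: \<gamma>\<close>)
      finally show ?thesis by (simp only: \<gamma>)
    qed
  qed
  have "E (\<lambda>_. 0) = F" by (simp add: E_def)
  moreover have "derivative_family (Suc p) U E"
  proof (rule derivative_family_SucI)
    show "continuous_on U (E (\<lambda>_. 0))" using assms(2) \<open>E (\<lambda>_. 0) = F\<close> by simp
    show "has_partial i (E (\<lambda>_. 0)) (E (minc i (\<lambda>_. 0)) x) x" if "x \<in> U" for i x
      using assms(2) \<open>E (\<lambda>_. 0) = F\<close> E_minc[of "\<lambda>_. 0" x i] base[OF that] that by simp
    show "derivative_family p U (\<lambda>\<alpha>. E (minc j \<alpha>))" for j
      by (rule derivative_family_cong[OF assms(1) _ assms(3)[of j]]) (simp add: E_minc)
  qed
  ultimately show thesis by (rule that)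
qed

lemma Ck_on_imp_Cp_on:
  assumes "open U"
  shows "Ck_on p U F \<Longrightarrow> Cp_on p U F"
proof (induction p arbitrary: F)
  case 0
  then show ?case unfolding Cp_on_iff_derivative_family
    by (intro exI[of _ "\<lambda>_. F"]) (auto simp: derivative_family_def)
next
  case (Suc p)
  have "\<exists>D. (\<forall>x\<in>U. D (\<lambda>_. 0) x = partial i F x) \<and> derivative_family p U D" for i
    using Suc by (auto simp: Cp_on_iff_derivative_family)
  then obtain D where "\<And>i x. x \<in> U \<Longrightarrow> D i (\<lambda>_. 0) x = partial i F x"
    "\<And>i. derivative_family p U (D i)" by metis
  then obtain E where "E (\<lambda>_. 0) = F" "derivative_family (Suc p) U E"
    using derivative_family_of_partials[OF assms Suc.prems] by blast
  then show ?case unfolding Cp_on_iff_derivative_family by blast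
qed

lemma Cp_on_iff_Ck_on: "open U \<Longrightarrow> Cp_on p U F \<longleftrightarrow> Ck_on p U F"
proof
  assume "open U" "Cp_on p U F"
  then obtain D where D: "\<forall>x\<in>U. D (\<lambda>_. 0) x = F x" "derivative_family p U D"
    unfolding Cp_on_iff_derivative_family by blast
  then have "Ck_on p U (D (\<lambda>_. 0))" using derivative_family_imp_Ck_on[OF \<open>open U\<close>] by simp
  then show "Ck_on p U F" by (rule Ck_on_cong[OF \<open>open U\<close>, rotated]) (use D in auto)
qed (rule Ck_on_imp_Cp_on)

lemma Ck_on_imp_derivative_family:
  assumes "open U" "Ck_on p U F"
  obtains D where "\<And>x. x \<in> U \<Longrightarrow> D (\<lambda>_. 0) x = F x" "derivative_family p U D"
  using Ck_on_imp_Cp_on[OF assms] unfolding Cp_on_iff_derivative_family by blast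

subsection \<open>Taylor polynomials and Whitney jets\<close>

text \<open>\<open>divided_power \<gamma> x\<close> is \<open>x\<^sup>\<gamma> / \<gamma>!\<close>; \<open>taylor_poly p c a \<beta>\<close> is the \<open>\<beta>\<close>-th derivative of the
  polynomial of degree at most \<open>p\<close> whose derivatives at \<open>a\<close> are the numbers \<open>c\<close>.\<close>

definition divided_power :: "('n::finite \<Rightarrow> nat) \<Rightarrow> real^'n \<Rightarrow> real" where
  "divided_power \<gamma> x = (\<Prod>k\<in>UNIV. (x$k) ^ \<gamma> k / fact (\<gamma> k))"

definition taylor_poly ::
    "nat \<Rightarrow> (('n::finite \<Rightarrow> nat) \<Rightarrow> real) \<Rightarrow> real^'n \<Rightarrow> ('n \<Rightarrow> nat) \<Rightarrow> real^'n \<Rightarrow> real" where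
  "taylor_poly p c a \<beta> x =
     (\<Sum>\<gamma>\<in>mindex (p - mdeg \<beta>). c (\<lambda>i. \<beta> i + \<gamma> i) * divided_power \<gamma> (x - a))"

lemma le_mdeg: "\<alpha> i \<le> mdeg \<alpha>"
  unfolding mdeg_def by (rule member_le_sum) auto

lemma finite_mindex [simp]: "finite (mindex p :: ('n::finite \<Rightarrow> nat) set)"
proof (rule finite_subset)
  show "mindex p \<subseteq> (PiE UNIV (\<lambda>_::'n. {..p}))"
    using le_mdeg order_trans by (fastforce simp: mindex_def)
  show "finite (PiE UNIV (\<lambda>_::'n. {..p}))" by (rule finite_PiE) auto
qed

lemma mem_mindex: "\<alpha> \<in> mindex p \<longleftrightarrow> mdeg \<alpha> \<le> p"
  by (simp add: mindex_def)

lemma mindex_0 [simp]: "mindex 0 = {\<lambda>_. 0}"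
  by (auto simp: mindex_def)

lemma divided_power_zero_index [simp]: "divided_power (\<lambda>_. 0) x = 1"
  by (simp add: divided_power_def)

lemma divided_power_zero: "divided_power \<gamma> 0 = (if \<gamma> = (\<lambda>_. 0) then 1 else 0)"
proof (cases "\<gamma> = (\<lambda>_. 0)")
  case False
  then obtain k where "\<gamma> k \<noteq> 0" by auto
  then have "divided_power \<gamma> 0 = 0" unfolding divided_power_def by (intro prod_zero) auto
  then show ?thesis using False by simp
qed simp

lemma has_partial_divided_power:
  "has_partial i (\<lambda>x. divided_power \<gamma> (x - a))
    (if \<gamma> i = 0 then 0 else divided_power (\<gamma>(i := \<gamma> i - 1)) (x - a)) x"
proof -
  define c where "c = (\<Prod>k\<in>UNIV - {i}. (x$k - a$k) ^ \<gamma> k / fact (\<gamma> k))"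
  define u where "u = x$i - a$i"
  have along_axis: "divided_power \<gamma> (x + t *\<^sub>R axis i 1 - a) = (u + t) ^ \<gamma> i / fact (\<gamma> i) * c" for t
  proof -
    have "(\<Prod>k\<in>UNIV - {i}. ((x + t *\<^sub>R axis i 1 - a)$k) ^ \<gamma> k / fact (\<gamma> k)) = c"
      unfolding c_def by (rule prod.cong) (auto simp: axis_def)
    then show ?thesis
      unfolding divided_power_def by (subst prod.remove[of _ i]) (auto simp: u_def algebra_simps)
  qed
  have update: "divided_power (\<gamma>(i := m)) (x - a) = u ^ m / fact m * c" for m
  proof -
    have "(\<Prod>k\<in>UNIV - {i}. ((x - a)$k) ^ (\<gamma>(i := m)) k / fact ((\<gamma>(i := m)) k)) = c"
      unfolding c_def by (rule prod.cong) auto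
    then show ?thesis
      unfolding divided_power_def by (subst prod.remove[of _ i]) (auto simp: u_def)
  qed
  show ?thesis
  proof (cases "\<gamma> i")
    case 0
    then show ?thesis unfolding has_partial_def along_axis by simp
  next
    case (Suc m)
    have "((\<lambda>t. (u + t) ^ Suc m / fact (Suc m) * c) has_real_derivative
        (real (Suc m) * u ^ m / fact (Suc m) * c)) (at 0)"
      by (auto intro!: derivative_eq_intros simp del: power_Suc fact_Suc)
    moreover have "real (Suc m) * u ^ m / fact (Suc m) * c = u ^ m / fact m * c"
      by (simp add: fact_Suc del: of_nat_Suc)
    ultimately show ?thesis using Suc update[of m] unfolding has_partial_def along_axis by simp
  qed
qed

lemma has_partial_taylor_poly:
  assumes "mdeg \<beta> < p"
  shows "has_partial i (taylor_poly p c a \<beta>) (taylor_poly p c a (minc i \<beta>) x) x"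
proof -
  define m where "m = p - Suc (mdeg \<beta>)"
  have m: "p - mdeg \<beta> = Suc m" "p - mdeg (minc i \<beta>) = m" using assms by (auto simp: m_def)
  let ?d = "\<lambda>\<gamma>. if \<gamma> i = 0 then 0 else divided_power (\<gamma>(i := \<gamma> i - 1)) (x - a)"
  have "(\<Sum>\<gamma>\<in>mindex (p - mdeg \<beta>). c (\<lambda>k. \<beta> k + \<gamma> k) * ?d \<gamma>) =
     (\<Sum>\<gamma>\<in>{\<gamma>\<in>mindex (Suc m). \<gamma> i \<noteq> 0}. c (\<lambda>k. \<beta> k + \<gamma> k) * ?d \<gamma>)"
    unfolding m by (rule sum.mono_neutral_right) auto
  also have "\<dots> = (\<Sum>\<gamma>\<in>mindex m. c (\<lambda>k. minc i \<beta> k + \<gamma> k) * divided_power \<gamma> (x - a))"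
  proof (rule sum.reindex_bij_witness[where i = "minc i" and j = "\<lambda>\<gamma>. \<gamma>(i := \<gamma> i - 1)"])
    fix \<gamma> :: "'a \<Rightarrow> nat" assume \<gamma>: "\<gamma> \<in> {\<gamma>\<in>mindex (Suc m). \<gamma> i \<noteq> 0}"
    then show eq: "minc i (\<gamma>(i := \<gamma> i - 1)) = \<gamma>" by (intro minc_decrement) simp
    have "mdeg \<gamma> = Suc (mdeg (\<gamma>(i := \<gamma> i - 1)))" using mdeg_minc eq by metis
    then show "\<gamma>(i := \<gamma> i - 1) \<in> mindex m" using \<gamma> by (simp add: mem_mindex)
    have "(\<lambda>k. minc i \<beta> k + (\<gamma>(i := \<gamma> i - 1)) k) = (\<lambda>k. \<beta> k + \<gamma> k)"
      using \<gamma> by (auto simp: minc_def fun_eq_iff)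
    then show "c (\<lambda>k. minc i \<beta> k + (\<gamma>(i := \<gamma> i - 1)) k) * divided_power (\<gamma>(i := \<gamma> i - 1)) (x - a) =
         c (\<lambda>k. \<beta> k + \<gamma> k) * ?d \<gamma>"
      using \<gamma> by simp
  next
    fix \<gamma> :: "'a \<Rightarrow> nat" assume "\<gamma> \<in> mindex m"
    then have "minc i \<gamma> \<in> mindex (Suc m)" by (simp add: mem_mindex)
    then show "minc i \<gamma> \<in> {\<gamma>\<in>mindex (Suc m). \<gamma> i \<noteq> 0}" by (simp add: minc_def)
    show "(minc i \<gamma>)(i := minc i \<gamma> i - 1) = \<gamma>" by (simp add: minc_def)
  qed
  also have "\<dots> = taylor_poly p c a (minc i \<beta>) x" unfolding taylor_poly_def m ..
  finally have "(\<Sum>\<gamma>\<in>mindex (p - mdeg \<beta>). c (\<lambda>k. \<beta> k + \<gamma> k) * ?d \<gamma>) =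
    taylor_poly p c a (minc i \<beta>) x" .
  moreover have "has_partial i (taylor_poly p c a \<beta>)
      (\<Sum>\<gamma>\<in>mindex (p - mdeg \<beta>). c (\<lambda>k. \<beta> k + \<gamma> k) * ?d \<gamma>) x"
    unfolding taylor_poly_def by (intro has_partial_sum has_partial_cmult has_partial_divided_power)
  ultimately show ?thesis by simp
qed

lemma taylor_poly_base [simp]: "taylor_poly p c a \<beta> a = c \<beta>"
proof -
  have "taylor_poly p c a \<beta> a = (\<Sum>\<gamma>\<in>{\<lambda>_. 0}. c (\<lambda>i. \<beta> i + \<gamma> i) * divided_power \<gamma> 0)"
    unfolding taylor_poly_def
    by (subst sum.mono_neutral_right[of _ "{\<lambda>_. 0}"]) (auto simp: divided_power_zero mem_mindex)
  then show ?thesis by simp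
qed

lemma taylor_poly_top: "mdeg \<beta> = p \<Longrightarrow> taylor_poly p c a \<beta> x = c \<beta>"
  by (simp add: taylor_poly_def)

lemma continuous_on_divided_power [continuous_intros]:
  "continuous_on S g \<Longrightarrow> continuous_on S (\<lambda>x. divided_power \<gamma> (g x))"
  unfolding divided_power_def by (intro continuous_intros) auto

lemma derivative_family_taylor_poly: "derivative_family p U (taylor_poly p c a)"
proof (intro derivative_familyI has_partial_taylor_poly)
  show "continuous_on U (taylor_poly p c a \<alpha>)" for \<alpha> :: "'a \<Rightarrow> nat"
    unfolding taylor_poly_def by (intro continuous_intros)
qed

lemma derivative_family_increment_bound:
  fixes D :: "('n::finite \<Rightarrow> nat) \<Rightarrow> real^'n \<Rightarrow> real" and B :: real
  assumes "open U" "derivative_family p U D" "mdeg \<beta> < p" "convex S" "S \<subseteq> U" "x \<in> S" "y \<in> S"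
    and bound: "\<And>i z. z \<in> S \<Longrightarrow> \<bar>D (minc i \<beta>) z\<bar> \<le> B"
  shows "\<bar>D \<beta> y - D \<beta> x\<bar> \<le> CARD('n) * B * norm (y - x)"
proof -
  have deriv: "(D \<beta> has_derivative (\<lambda>h. \<Sum>i\<in>UNIV. h$i * D (minc i \<beta>) z)) (at z within S)"
    if "z \<in> S" for z
  proof (rule has_derivative_at_withinI, rule has_derivative_of_partials[OF assms(1)])
    show "z \<in> U" using that assms(5) by blast
    show "has_partial i (D \<beta>) (D (minc i \<beta>) y) y" if "y \<in> U" for i y
      by (rule derivative_family_has_partial[OF assms(2,3) that])
    show "continuous_on U (D (minc i \<beta>))" for i
      by (rule derivative_family_continuous_on[OF assms(2)]) (use assms(3) in simp)
  qed
  have onorm: "onorm (\<lambda>h::real^'n. \<Sum>i\<in>UNIV. h$i * D (minc i \<beta>) z) \<le> CARD('n) * B" if "z \<in> S" for z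
  proof (rule onorm_le)
    fix h :: "real^'n"
    have "norm (\<Sum>i\<in>UNIV. h$i * D (minc i \<beta>) z) \<le> (\<Sum>i\<in>(UNIV::'n set). norm h * B)"
    proof (intro order_trans[OF norm_sum] sum_mono)
      fix i
      show "norm (h$i * D (minc i \<beta>) z) \<le> norm h * B"
        unfolding real_norm_def abs_mult
        using bound[OF that, of i] component_le_norm_cart[of h i] by (intro mult_mono) auto
    qed
    then show "norm (\<Sum>i\<in>UNIV. h$i * D (minc i \<beta>) z) \<le> CARD('n) * B * norm h" by (simp add: mult_ac)
  qed
  show ?thesis using differentiable_bound[OF assms(4) deriv onorm assms(7,6)] by simp
qed

text \<open>Descending induction on \<open>mdeg \<beta>\<close>, integrating the bound on the next order from \<open>a\<close>.\<close>

lemma derivative_family_bound_graded: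
  fixes D :: "('n::finite \<Rightarrow> nat) \<Rightarrow> real^'n \<Rightarrow> real" and e h :: real
  assumes "open U" "derivative_family p U D" "convex S" "S \<subseteq> U" "a \<in> S"
    and dist_le: "\<And>x. x \<in> S \<Longrightarrow> norm (x - a) \<le> h"
    and base: "\<And>\<beta>. mdeg \<beta> \<le> p \<Longrightarrow> \<bar>D \<beta> a\<bar> \<le> e * h ^ (p - mdeg \<beta>)"
    and top: "\<And>\<beta> x. mdeg \<beta> = p \<Longrightarrow> x \<in> S \<Longrightarrow> \<bar>D \<beta> x\<bar> \<le> e"
  shows "mdeg \<beta> \<le> p \<Longrightarrow> x \<in> S \<Longrightarrow> \<bar>D \<beta> x\<bar> \<le> (1 + real CARD('n)) ^ (p - mdeg \<beta>) * (e * h ^ (p - mdeg \<beta>))"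
proof (induction "p - mdeg \<beta>" arbitrary: \<beta> x)
  case 0
  then show ?case using top[of \<beta> x] by simp
next
  case (Suc k)
  define N where "N = real CARD('n)"
  have "h \<ge> 0" using assms(5) dist_le[of a] by simp
  have "e \<ge> 0" using top[OF mdeg_single assms(5)] abs_ge_zero order_trans by blast
  have k: "mdeg \<beta> < p" "p - mdeg \<beta> = Suc k" using Suc.hyps(2) by auto
  have "\<bar>D \<beta> x - D \<beta> a\<bar> \<le> CARD('n) * ((1 + N) ^ k * (e * h ^ k)) * norm (x - a)"
  proof (rule derivative_family_increment_bound[OF assms(1,2) k(1) assms(3,4,5) Suc.prems(2)])
    fix i z assume "z \<in> S"
    have "p - mdeg (minc i \<beta>) = k" "mdeg (minc i \<beta>) \<le> p" using k by auto
    then show "\<bar>D (minc i \<beta>) z\<bar> \<le> (1 + N) ^ k * (e * h ^ k)"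
      using Suc.hyps(1)[of "minc i \<beta>" z] \<open>z \<in> S\<close> unfolding N_def by metis
  qed
  also have "\<dots> \<le> N * ((1 + N) ^ k * (e * h ^ k)) * h"
    using dist_le[OF Suc.prems(2)] \<open>h \<ge> 0\<close> \<open>e \<ge> 0\<close> unfolding N_def by (intro mult_left_mono) auto
  finally have increment: "\<bar>D \<beta> x - D \<beta> a\<bar> \<le> N * (1 + N) ^ k * (e * h ^ Suc k)"
    by (simp add: mult_ac)
  have "(1 + N) ^ k \<ge> 1" by (rule one_le_power) (simp add: N_def)
  then have "1 + N * (1 + N) ^ k \<le> (1 + N) ^ Suc k" by (simp add: algebra_simps)
  then have "(1 + N * (1 + N) ^ k) * (e * h ^ Suc k) \<le> (1 + N) ^ Suc k * (e * h ^ Suc k)"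
    by (rule mult_right_mono) (use \<open>h \<ge> 0\<close> \<open>e \<ge> 0\<close> in auto)
  moreover have "\<bar>D \<beta> a\<bar> \<le> e * h ^ Suc k" using base[of \<beta>] Suc.prems(1) k(2) by simp
  ultimately show ?case
    using increment unfolding k(2) N_def[symmetric] distrib_right mult_1 by linarith
qed

lemma derivative_family_bound:
  fixes D :: "('n::finite \<Rightarrow> nat) \<Rightarrow> real^'n \<Rightarrow> real" and e h :: real
  assumes "open U" "derivative_family p U D" "closed_segment a x \<subseteq> U" "norm (x - a) \<le> h"
    and base: "\<And>\<beta>. mdeg \<beta> \<le> p \<Longrightarrow> \<bar>D \<beta> a\<bar> \<le> e * h ^ (p - mdeg \<beta>)"
    and top: "\<And>\<beta> z. mdeg \<beta> = p \<Longrightarrow> z \<in> closed_segment a x \<Longrightarrow> \<bar>D \<beta> z\<bar> \<le> e"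
    and "mdeg \<beta> \<le> p"
  shows "\<bar>D \<beta> x\<bar> \<le> (1 + real CARD('n)) ^ p * (e * h ^ (p - mdeg \<beta>))"
proof -
  have "\<bar>D \<beta> x\<bar> \<le> (1 + real CARD('n)) ^ (p - mdeg \<beta>) * (e * h ^ (p - mdeg \<beta>))"
  proof (rule derivative_family_bound_graded[OF assms(1,2) _ assms(3) _ _ base top assms(7)])
    show "norm (z - a) \<le> h" if "z \<in> closed_segment a x" for z
      using segment_bound(1)[OF that] assms(4) by simp
  qed auto
  also have "\<dots> \<le> (1 + real CARD('n)) ^ p * (e * h ^ (p - mdeg \<beta>))"
    using base[OF assms(7)] abs_ge_zero[of "D \<beta> a"]
    by (intro mult_right_mono power_increasing) linarith+
  finally show ?thesis .
qed

definition taylor_remainder ::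
    "nat \<Rightarrow> (('n::finite \<Rightarrow> nat) \<Rightarrow> real^'n \<Rightarrow> real) \<Rightarrow> real^'n \<Rightarrow> ('n \<Rightarrow> nat) \<Rightarrow> real^'n \<Rightarrow> real" where
  "taylor_remainder p g x \<beta> y = g \<beta> y - taylor_poly p (\<lambda>\<gamma>. g \<gamma> x) x \<beta> y"

lemma taylor_remainder_self [simp]: "taylor_remainder p g x \<beta> x = 0"
  by (simp add: taylor_remainder_def)

lemma abs_taylor_remainder_le:
  fixes D :: "('n::finite \<Rightarrow> nat) \<Rightarrow> real^'n \<Rightarrow> real" and e :: real
  assumes "open U" "derivative_family p U D" "closed_segment x y \<subseteq> U" "e \<ge> 0"
    and "\<And>\<beta> z. mdeg \<beta> = p \<Longrightarrow> z \<in> closed_segment x y \<Longrightarrow> \<bar>D \<beta> z - D \<beta> x\<bar> \<le> e"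
    and "mdeg \<beta> \<le> p"
  shows "\<bar>taylor_remainder p D x \<beta> y\<bar> \<le> (1 + real CARD('n)) ^ p * (e * dist x y ^ (p - mdeg \<beta>))"
proof (rule derivative_family_bound[OF assms(1) _ assms(3) _ _ _ assms(6)])
  show "derivative_family p U (taylor_remainder p D x)"
    unfolding taylor_remainder_def[abs_def]
    by (intro derivative_family_diff assms(2) derivative_family_taylor_poly)
  show "norm (y - x) \<le> dist x y" by (simp add: dist_norm norm_minus_commute)
  show "\<bar>taylor_remainder p D x \<alpha> x\<bar> \<le> e * dist x y ^ (p - mdeg \<alpha>)" for \<alpha>
    using assms(4) by simp
  show "\<bar>taylor_remainder p D x \<alpha> z\<bar> \<le> e" if "mdeg \<alpha> = p" "z \<in> closed_segment x y" for \<alpha> z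
    using assms(5)[OF that] taylor_poly_top[OF that(1)] by (simp add: taylor_remainder_def)
qed

definition jet_close ::
    "nat \<Rightarrow> (real^'n::finite) set \<Rightarrow> (('n \<Rightarrow> nat) \<Rightarrow> real^'n \<Rightarrow> real) \<Rightarrow> real \<Rightarrow> real \<Rightarrow> bool" where
  "jet_close p K g e d \<longleftrightarrow> (\<forall>x\<in>K. \<forall>y\<in>K. \<forall>\<beta>. dist x y < d \<longrightarrow> mdeg \<beta> \<le> p \<longrightarrow>
     \<bar>taylor_remainder p g x \<beta> y\<bar> \<le> e * dist x y ^ (p - mdeg \<beta>))"

definition whitney_jet ::
    "nat \<Rightarrow> (real^'n::finite) set \<Rightarrow> (('n \<Rightarrow> nat) \<Rightarrow> real^'n \<Rightarrow> real) \<Rightarrow> bool" where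
  "whitney_jet p K g \<longleftrightarrow> (\<forall>e>0. \<exists>d>0. jet_close p K g e d)"

lemma jet_closeD:
  "jet_close p K g e d \<Longrightarrow> x \<in> K \<Longrightarrow> y \<in> K \<Longrightarrow> dist x y < d \<Longrightarrow> mdeg \<beta> \<le> p \<Longrightarrow>
    \<bar>taylor_remainder p g x \<beta> y\<bar> \<le> e * dist x y ^ (p - mdeg \<beta>)"
  unfolding jet_close_def by blast

lemma finite_common_delta:
  fixes \<rho> :: "'b \<Rightarrow> real"
  assumes "finite I" "\<And>i. i \<in> I \<Longrightarrow> \<exists>d>0. \<forall>z. \<rho> z < d \<longrightarrow> P i z"
  shows "\<exists>d>0. \<forall>i\<in>I. \<forall>z. \<rho> z < d \<longrightarrow> P i z"
  using assms
proof (induction I rule: finite_induct)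
  case (insert i I)
  then obtain d e where "d > 0" "\<forall>z. \<rho> z < d \<longrightarrow> P i z" "e > 0" "\<forall>i\<in>I. \<forall>z. \<rho> z < e \<longrightarrow> P i z"
    by (metis insertCI)
  then show ?case by (intro exI[of _ "min d e"]) auto
qed (auto intro: exI[of _ 1])

lemma whitney_jetI:
  assumes "\<And>e \<beta>. e > 0 \<Longrightarrow> mdeg \<beta> \<le> p \<Longrightarrow> \<exists>d>0. \<forall>x\<in>K. \<forall>y\<in>K. dist x y < d \<longrightarrow>
    \<bar>taylor_remainder p g x \<beta> y\<bar> \<le> e * dist x y ^ (p - mdeg \<beta>)"
  shows "whitney_jet p K g"
  unfolding whitney_jet_def
proof (intro allI impI)
  fix e :: real assume e: "e > 0"
  have "\<exists>d>0. \<forall>\<beta>\<in>mindex p. \<forall>z. dist (fst z) (snd z) < d \<longrightarrow> fst z \<in> K \<longrightarrow> snd z \<in> K \<longrightarrow>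
      \<bar>taylor_remainder p g (fst z) \<beta> (snd z)\<bar> \<le> e * dist (fst z) (snd z) ^ (p - mdeg \<beta>)"
    by (rule finite_common_delta[OF finite_mindex])
      (use assms[OF e] in \<open>fastforce simp: mem_mindex\<close>)
  then show "\<exists>d>0. jet_close p K g e d" unfolding jet_close_def by (auto simp: mem_mindex)
qed

lemma whitney_jetI_sequentially:
  assumes "compact K"
    and lim: "\<And>\<beta> x y c. mdeg \<beta> \<le> p \<Longrightarrow> range x \<subseteq> K \<Longrightarrow> range y \<subseteq> K \<Longrightarrow> (\<And>k::nat. x k \<noteq> y k) \<Longrightarrow>
      x \<longlonglongrightarrow> c \<Longrightarrow> y \<longlonglongrightarrow> c \<Longrightarrow> c \<in> K \<Longrightarrow>
      (\<lambda>k. taylor_remainder p g (x k) \<beta> (y k) / dist (x k) (y k) ^ (p - mdeg \<beta>)) \<longlonglongrightarrow> 0"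
  shows "whitney_jet p K g"
proof (rule whitney_jetI, rule ccontr)
  fix e :: real and \<beta> :: "'a \<Rightarrow> nat" assume e: "e > 0" and \<beta>: "mdeg \<beta> \<le> p"
    and contra: "\<not> (\<exists>d>0. \<forall>x\<in>K. \<forall>y\<in>K. dist x y < d \<longrightarrow>
      \<bar>taylor_remainder p g x \<beta> y\<bar> \<le> e * dist x y ^ (p - mdeg \<beta>))"
  let ?bad = "\<lambda>x y. \<not> \<bar>taylor_remainder p g x \<beta> y\<bar> \<le> e * dist x y ^ (p - mdeg \<beta>)"
  have "\<exists>x\<in>K. \<exists>y\<in>K. dist x y < inverse (real (Suc k)) \<and> ?bad x y" for k
    using contra by (metis inverse_positive_iff_positive of_nat_0_less_iff zero_less_Suc)
  then obtain x y
    where xy: "\<And>k. x k \<in> K" "\<And>k. y k \<in> K" "\<And>k. dist (x k) (y k) < inverse (real (Suc k))"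
    "\<And>k. ?bad (x k) (y k)" by metis
  obtain c r where c: "c \<in> K" "strict_mono (r :: nat \<Rightarrow> nat)" "(x \<circ> r) \<longlonglongrightarrow> c"
    using assms(1)[unfolded compact_def] xy(1) by meson
  have "(\<lambda>k. x k - y k) \<longlonglongrightarrow> 0"
    by (rule Lim_null_comparison[OF _ LIMSEQ_inverse_real_of_nat])
      (use xy(3) in \<open>auto simp: dist_norm intro!: always_eventually less_imp_le\<close>)
  from LIMSEQ_subseq_LIMSEQ[OF this c(2)] have "(y \<circ> r) \<longlonglongrightarrow> c"
    using Lim_transform2[OF c(3)] by (simp add: o_def)
  moreover have "x k \<noteq> y k" for k using xy(4)[of k] e by auto
  ultimately have "(\<lambda>k. taylor_remainder p g ((x \<circ> r) k) \<beta> ((y \<circ> r) k) /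
      dist ((x \<circ> r) k) ((y \<circ> r) k) ^ (p - mdeg \<beta>)) \<longlonglongrightarrow> 0"
    using xy(1,2) by (intro lim[OF \<beta> _ _ _ c(3) _ c(1)]) (auto simp: o_def)
  then have "\<forall>\<^sub>F k in sequentially. \<bar>taylor_remainder p g (x (r k)) \<beta> (y (r k)) /
      dist (x (r k)) (y (r k)) ^ (p - mdeg \<beta>)\<bar> < e"
    using e by (auto dest: tendstoD)
  then obtain k where "\<bar>taylor_remainder p g (x (r k)) \<beta> (y (r k)) /
      dist (x (r k)) (y (r k)) ^ (p - mdeg \<beta>)\<bar> < e"
    by (auto simp: eventually_sequentially)
  then show False
    using xy(4)[of "r k"] \<open>\<And>k. x k \<noteq> y k\<close>[of "r k"] by (simp add: abs_divide divide_less_eq)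
qed

lemma whitney_jet_remainder_tendsto:
  assumes "whitney_jet p K g" "mdeg \<beta> \<le> p"
    and "\<forall>\<^sub>F k in F. x k \<in> K \<and> y k \<in> K" "((\<lambda>k. dist (x k) (y k)) \<longlongrightarrow> 0) F"
  shows "((\<lambda>k. taylor_remainder p g (x k) \<beta> (y k) / dist (x k) (y k) ^ (p - mdeg \<beta>)) \<longlongrightarrow> 0) F"
proof (rule tendstoI)
  fix e :: real assume "e > 0"
  then obtain d where d: "d > 0" "jet_close p K g (e / 2) d"
    using assms(1) unfolding whitney_jet_def by (meson half_gt_zero)
  have "\<forall>\<^sub>F k in F. dist (x k) (y k) < d" using order_tendstoD(2)[OF assms(4) d(1)] .
  with assms(3)
  show "\<forall>\<^sub>F k in F. dist (taylor_remainder p g (x k) \<beta> (y k) / dist (x k) (y k) ^ (p - mdeg \<beta>)) 0 < e"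
  proof eventually_elim
    case (elim k)
    then have "\<bar>taylor_remainder p g (x k) \<beta> (y k)\<bar> \<le> e / 2 * dist (x k) (y k) ^ (p - mdeg \<beta>)"
      using jet_closeD[OF d(2)] assms(2) by blast
    then have "\<bar>taylor_remainder p g (x k) \<beta> (y k)\<bar> / dist (x k) (y k) ^ (p - mdeg \<beta>) \<le> e / 2"
      using \<open>e > 0\<close> by (cases "dist (x k) (y k) ^ (p - mdeg \<beta>) = 0") (auto simp: divide_simps)
    then have "\<bar>taylor_remainder p g (x k) \<beta> (y k)\<bar> / dist (x k) (y k) ^ (p - mdeg \<beta>) < e"
      using \<open>e > 0\<close> by linarith
    then show ?case by (simp add: abs_divide)
  qed
qed

lemma derivative_family_imp_whitney_jet:
  fixes D :: "('n::finite \<Rightarrow> nat) \<Rightarrow> real^'n \<Rightarrow> real"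
  assumes "open U" "derivative_family p U D" "compact B" "convex B" "B \<subseteq> U"
  shows "whitney_jet p B D"
  unfolding whitney_jet_def
proof (intro allI impI)
  fix e :: real assume e: "e > 0"
  define N where "N = (1 + real CARD('n)) ^ p"
  have "N > 0" by (simp add: N_def add_pos_nonneg)
  have "\<exists>d>0. \<forall>\<beta>\<in>mindex p. \<forall>z. dist (snd z) (fst z) < d \<longrightarrow> fst z \<in> B \<longrightarrow> snd z \<in> B \<longrightarrow>
      dist (D \<beta> (snd z)) (D \<beta> (fst z)) < e / N"
  proof (rule finite_common_delta[OF finite_mindex])
    fix \<beta> :: "'n \<Rightarrow> nat" assume "\<beta> \<in> mindex p"
    then have "continuous_on B (D \<beta>)"
      using continuous_on_subset[OF derivative_family_continuous_on[OF assms(2)] assms(5)]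
      by (simp add: mem_mindex)
    then have "uniformly_continuous_on B (D \<beta>)" using compact_uniformly_continuous assms(3) by blast
    then show "\<exists>d>0. \<forall>z. dist (snd z) (fst z) < d \<longrightarrow> fst z \<in> B \<longrightarrow> snd z \<in> B \<longrightarrow>
        dist (D \<beta> (snd z)) (D \<beta> (fst z)) < e / N"
      unfolding uniformly_continuous_on_def using e \<open>N > 0\<close> by (metis divide_pos_pos)
  qed
  then obtain d where d: "d > 0" "\<And>\<beta> x y. mdeg \<beta> \<le> p \<Longrightarrow> x \<in> B \<Longrightarrow> y \<in> B \<Longrightarrow> dist y x < d \<Longrightarrow>
      dist (D \<beta> y) (D \<beta> x) < e / N"
    by (auto simp: mem_mindex)
  have "\<bar>taylor_remainder p D x \<beta> y\<bar> \<le> e * dist x y ^ (p - mdeg \<beta>)"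
    if xy: "x \<in> B" "y \<in> B" "dist x y < d" and \<beta>: "mdeg \<beta> \<le> p" for x y \<beta>
  proof -
    have segment: "closed_segment x y \<subseteq> B" using closed_segment_subset[OF xy(1,2) assms(4)] .
    have "\<bar>D \<alpha> z - D \<alpha> x\<bar> \<le> e / N" if "mdeg \<alpha> = p" "z \<in> closed_segment x y" for \<alpha> z
    proof -
      have "dist z x < d"
        using segment_bound(1)[OF that(2)] xy(3) by (simp add: dist_norm norm_minus_commute)
      then show ?thesis using d(2)[of \<alpha> x z] that segment xy(1) by (auto simp: dist_real_def)
    qed
    then have "\<bar>taylor_remainder p D x \<beta> y\<bar> \<le> N * (e / N * dist x y ^ (p - mdeg \<beta>))"
      using abs_taylor_remainder_le[OF assms(1,2), of x y "e / N" \<beta>] segment assms(5) e \<open>N > 0\<close> \<beta>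
      unfolding N_def[symmetric] by auto
    then show ?thesis using \<open>N > 0\<close> by simp
  qed
  then show "\<exists>d>0. jet_close p B D e d" unfolding jet_close_def using d(1) by blast
qed

subsection \<open>Derivative bounds at a scale\<close>

text \<open>That is, \<open>\<bar>\<partial>\<^sup>\<beta>F\<bar> \<le> A / h\<^bsup>\<bar>\<beta>\<bar>\<^esup>\<close> on \<open>S\<close> for \<open>\<bar>\<beta>\<bar> \<le> k\<close>; in this recursive form products need no
  Leibniz formula.\<close>

fun Ck_bounded :: "nat \<Rightarrow> (real^'n::finite) set \<Rightarrow> real \<Rightarrow> real \<Rightarrow> (real^'n \<Rightarrow> real) \<Rightarrow> bool" where
  "Ck_bounded 0 S h A F \<longleftrightarrow> (\<forall>x\<in>S. \<bar>F x\<bar> \<le> A)"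
| "Ck_bounded (Suc k) S h A F \<longleftrightarrow> (\<forall>x\<in>S. \<bar>F x\<bar> \<le> A) \<and> (\<forall>i. Ck_bounded k S h (A / h) (partial i F))"

lemma Ck_bounded_cong:
  assumes "open S" "\<And>x. x \<in> S \<Longrightarrow> F x = G x" "Ck_bounded k S h A F"
  shows "Ck_bounded k S h A G"
  using assms(2,3)
proof (induction k arbitrary: F G A)
  case (Suc k)
  have "partial i F x = partial i G x" if "x \<in> S" for i x
    using partial_cong[OF assms(1) that Suc.prems(1)] by simp
  then have "Ck_bounded k S h (A / h) (partial i G)" for i
    using Suc.IH[of "partial i F" "partial i G" "A / h"] Suc.prems(2) by auto
  then show ?case using Suc.prems by auto
qed auto

lemma Ck_bounded_imp_abs_le: "Ck_bounded k S h A F \<Longrightarrow> x \<in> S \<Longrightarrow> \<bar>F x\<bar> \<le> A"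
  by (cases k) auto

lemma Ck_bounded_mono: "Ck_bounded k S h A F \<Longrightarrow> A \<le> B \<Longrightarrow> h > 0 \<Longrightarrow> Ck_bounded k S h B F"
proof (induction k arbitrary: F A B)
  case (Suc k)
  have "A / h \<le> B / h" using Suc.prems by (simp add: divide_right_mono)
  then show ?case using Suc by fastforce
qed fastforce

lemma Ck_bounded_subset: "Ck_bounded k S h A F \<Longrightarrow> T \<subseteq> S \<Longrightarrow> Ck_bounded k T h A F"
  by (induction k arbitrary: F A) auto

lemma Ck_bounded_SucD: "Ck_bounded (Suc k) S h A F \<Longrightarrow> Ck_bounded k S h A F"
  by (induction k arbitrary: F A) auto

lemma Ck_bounded_const: "\<bar>c\<bar> \<le> A \<Longrightarrow> h > 0 \<Longrightarrow> Ck_bounded k S h A (\<lambda>x. c)"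
  by (induction k arbitrary: c A) auto

lemma Ck_bounded_add:
  assumes "open S" "Ck_on k S F" "Ck_on k S G" "Ck_bounded k S h A F" "Ck_bounded k S h B G"
  shows "Ck_bounded k S h (A + B) (\<lambda>x. F x + G x)"
  using assms(2-)
proof (induction k arbitrary: F G A B)
  case 0
  then show ?case by (auto intro: order_trans[OF abs_triangle_ineq] add_mono)
next
  case (Suc k)
  have "Ck_bounded k S h (A / h + B / h) (\<lambda>x. partial i F x + partial i G x)" for i
    by (rule Suc.IH) (use Suc.prems in auto)
  then have "Ck_bounded k S h (A / h + B / h) (partial i (\<lambda>x. F x + G x))" for i
    by (rule Ck_bounded_cong[OF assms(1), rotated]) (use Suc.prems in \<open>auto simp: partial_add\<close>)
  moreover have "\<bar>F x + G x\<bar> \<le> A + B" if "x \<in> S" for x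
    using Ck_bounded_imp_abs_le[OF Suc.prems(3) that] Ck_bounded_imp_abs_le[OF Suc.prems(4) that]
    by linarith
  ultimately show ?case by (simp add: add_divide_distrib)
qed

lemma Ck_bounded_nonneg: "Ck_bounded k S h A F \<Longrightarrow> S \<noteq> {} \<Longrightarrow> 0 \<le> A"
  using Ck_bounded_imp_abs_le abs_ge_zero order_trans by blast

lemma Ck_bounded_mult:
  assumes "open S" "Ck_on k S F" "Ck_on k S G" "Ck_bounded k S h A F" "Ck_bounded k S h B G"
    "S \<noteq> {}"
  shows "Ck_bounded k S h (2 ^ k * A * B) (\<lambda>x. F x * G x)"
  using assms(2-5)
proof (induction k arbitrary: F G A B)
  case 0
  then show ?case by (auto simp: abs_mult intro!: mult_mono order_trans[OF abs_ge_zero])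
next
  case (Suc k)
  have nonneg: "A \<ge> 0" "B \<ge> 0" using Suc.prems(3,4) assms(6) Ck_bounded_nonneg by blast+
  have smooth: "Ck_on k S F" "Ck_on k S G" "Ck_on k S (partial i F)" "Ck_on k S (partial i G)" for i
    using Suc.prems Ck_on_SucD by auto
  have bounded: "Ck_bounded k S h A F" "Ck_bounded k S h B G"
    using Suc.prems Ck_bounded_SucD by blast+
  have "Ck_bounded k S h (2 ^ k * (A / h) * B) (\<lambda>x. partial i F x * G x)" for i
    by (rule Suc.IH) (use Suc.prems smooth bounded in auto)
  moreover have "Ck_bounded k S h (2 ^ k * A * (B / h)) (\<lambda>x. F x * partial i G x)" for i
    by (rule Suc.IH) (use Suc.prems smooth bounded in auto)
  ultimately have "Ck_bounded k S h (2 ^ k * (A / h) * B + 2 ^ k * A * (B / h))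
      (\<lambda>x. partial i F x * G x + F x * partial i G x)" for i
    by (intro Ck_bounded_add Ck_on_mult assms(1) smooth)
  then have "Ck_bounded k S h (2 ^ k * (A / h) * B + 2 ^ k * A * (B / h)) (partial i (\<lambda>x. F x * G x))" for i
    by (rule Ck_bounded_cong[OF assms(1), rotated]) (use Suc.prems in \<open>auto simp: partial_mult\<close>)
  then have "Ck_bounded k S h (2 ^ Suc k * A * B / h) (partial i (\<lambda>x. F x * G x))" for i
    by (rule back_subst[of "\<lambda>c. Ck_bounded k S h c (partial i (\<lambda>x. F x * G x))"])
      (simp add: field_simps)
  moreover have "\<bar>F x * G x\<bar> \<le> 2 ^ Suc k * A * B" if "x \<in> S" for x
  proof -
    have "\<bar>F x * G x\<bar> \<le> A * B"
      unfolding abs_mult using Ck_bounded_imp_abs_le[OF Suc.prems(3) that]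
        Ck_bounded_imp_abs_le[OF Suc.prems(4) that] nonneg by (intro mult_mono) auto
    also have "\<dots> \<le> 2 ^ Suc k * (A * B)"
      using nonneg mult_right_mono[OF one_le_power[of "2::real" "Suc k"], of "A * B"] by simp
    finally show ?thesis by (simp add: mult.assoc)
  qed
  ultimately show ?case unfolding Ck_bounded.simps by blast
qed

lemma Ck_bounded_cmult:
  assumes "open S" "Ck_on k S F" "Ck_bounded k S h A F"
  shows "Ck_bounded k S h (\<bar>c\<bar> * A) (\<lambda>x. c * F x)"
  using assms(2,3)
proof (induction k arbitrary: F A)
  case 0
  then show ?case by (auto simp: abs_mult intro: mult_left_mono)
next
  case (Suc k)
  have "Ck_bounded k S h (\<bar>c\<bar> * (A / h)) (\<lambda>x. c * partial i F x)" for i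
    by (rule Suc.IH) (use Suc.prems in auto)
  then have "Ck_bounded k S h (\<bar>c\<bar> * (A / h)) (partial i (\<lambda>x. c * F x))" for i
    by (rule Ck_bounded_cong[OF assms(1), rotated]) (use Suc.prems in \<open>auto simp: partial_cmult\<close>)
  moreover have "\<bar>c * F x\<bar> \<le> \<bar>c\<bar> * A" if "x \<in> S" for x
    using Suc.prems(2) that by (auto simp: abs_mult intro: mult_left_mono)
  ultimately show ?case by simp
qed

lemma Ck_bounded_diff:
  assumes "open S" "Ck_on k S F" "Ck_on k S G" "Ck_bounded k S h A F" "Ck_bounded k S h B G"
  shows "Ck_bounded k S h (A + B) (\<lambda>x. F x - G x)"
  using Ck_bounded_add[OF assms(1,2) _ assms(4), of "\<lambda>x. (-1) * G x" B]
    Ck_on_cmult[OF assms(1,3), of "-1"] Ck_bounded_cmult[OF assms(1,3,5), of "-1"] by simp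

lemma Ck_bounded_sum:
  fixes A :: real
  assumes "open S" "h > 0" "finite Q" "\<And>q. q \<in> Q \<Longrightarrow> Ck_on k S (F q)"
    "\<And>q. q \<in> Q \<Longrightarrow> Ck_bounded k S h A (F q)"
  shows "Ck_bounded k S h (card Q * A) (\<lambda>x. \<Sum>q\<in>Q. F q x)"
  using assms(3-)
proof (induction Q rule: finite_induct)
  case empty
  then show ?case using Ck_bounded_const[of 0 0 h] assms(2) by simp
next
  case (insert q Q)
  have "Ck_bounded k S h (A + card Q * A) (\<lambda>x. F q x + (\<Sum>q\<in>Q. F q x))"
    by (intro Ck_bounded_add assms(1) Ck_on_sum insert) (use insert in auto)
  then show ?case using insert by (simp add: algebra_simps)
qed

lemma Ck_bounded_sum_sparse:
  fixes A :: real
  assumes "open S" "h > 0" "finite Q" "A \<ge> 0"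
    and "\<And>q. q \<in> Q \<Longrightarrow> q \<in> R \<Longrightarrow> Ck_on k S (F q) \<and> Ck_bounded k S h A (F q)"
    and "\<And>q x. q \<in> Q \<Longrightarrow> q \<notin> R \<Longrightarrow> x \<in> S \<Longrightarrow> F q x = 0"
    and "finite R" "card R \<le> m"
  shows "Ck_bounded k S h (m * A) (\<lambda>x. \<Sum>q\<in>Q. F q x)"
proof -
  have "Ck_bounded k S h (card (Q \<inter> R) * A) (\<lambda>x. \<Sum>q\<in>Q \<inter> R. F q x)"
    by (rule Ck_bounded_sum) (use assms in auto)
  moreover have "card (Q \<inter> R) \<le> m" using card_mono[of R "Q \<inter> R"] assms by auto
  ultimately have "Ck_bounded k S h (m * A) (\<lambda>x. \<Sum>q\<in>Q \<inter> R. F q x)"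
    using assms(2,4) by (elim Ck_bounded_mono) (auto intro: mult_right_mono)
  then show ?thesis
    by (rule Ck_bounded_cong[OF assms(1), rotated])
      (use assms(3,6) in \<open>auto intro!: sum.mono_neutral_left\<close>)
qed

lemma Ck_bounded_prod:
  assumes "open S" "S \<noteq> {}" "h > 0" "finite Q" "\<And>q. q \<in> Q \<Longrightarrow> Ck_on k S (F q)"
    "\<And>q. q \<in> Q \<Longrightarrow> Ck_bounded k S h A (F q)"
  shows "Ck_bounded k S h ((2 ^ k * A) ^ card Q) (\<lambda>x. \<Prod>q\<in>Q. F q x)"
  using assms(4-)
proof (induction Q rule: finite_induct)
  case empty
  then show ?case using Ck_bounded_const[of 1 1 h] assms(3) by simp
next
  case (insert q Q)
  have "Ck_bounded k S h (2 ^ k * A * (2 ^ k * A) ^ card Q) (\<lambda>x. F q x * (\<Prod>q\<in>Q. F q x))"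
    by (intro Ck_bounded_mult assms(1,2) Ck_on_prod insert) (use insert in auto)
  then show ?case using insert by (simp add: algebra_simps)
qed

lemma Ck_bounded_rescale:
  assumes "h > 0" "h' > 0" "c \<ge> 1" "h' \<le> c * h" "S \<noteq> {}"
  shows "Ck_bounded k S h A F \<Longrightarrow> Ck_bounded k S h' (c ^ k * A) F"
proof (induction k arbitrary: F A)
  case (Suc k)
  have "A \<ge> 0" using Ck_bounded_nonneg[OF Suc.prems assms(5)] .
  have "Ck_bounded k S h' (c ^ k * (A / h)) (partial i F)" for i
    by (rule Suc.IH) (use Suc.prems in auto)
  moreover have "c ^ k * (A / h) \<le> c ^ Suc k * A / h'"
  proof -
    have "1 / h \<le> c / h'" using assms by (simp add: field_simps)
    then have "c ^ k * A * (1 / h) \<le> c ^ k * A * (c / h')"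
      using assms \<open>A \<ge> 0\<close> by (intro mult_left_mono) auto
    then show ?thesis by (simp add: mult_ac)
  qed
  ultimately have "Ck_bounded k S h' (c ^ Suc k * A / h') (partial i F)" for i
    using Ck_bounded_mono assms(2) by blast
  moreover have "\<bar>F x\<bar> \<le> c ^ Suc k * A" if "x \<in> S" for x
    using Ck_bounded_imp_abs_le[OF Suc.prems that]
      mult_right_mono[OF one_le_power[OF assms(3), of "Suc k"] \<open>A \<ge> 0\<close>] by simp
  ultimately show ?case by simp
qed auto

lemma derivative_family_imp_Ck_bounded:
  assumes "open S" "derivative_family p S D"
    "\<And>\<beta> x. mdeg \<beta> \<le> p \<Longrightarrow> x \<in> S \<Longrightarrow> \<bar>D \<beta> x\<bar> \<le> A / h ^ mdeg \<beta>"
  shows "mdeg \<beta> + k \<le> p \<Longrightarrow> Ck_bounded k S h (A / h ^ mdeg \<beta>) (D \<beta>)"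
proof (induction k arbitrary: \<beta>)
  case 0
  then show ?case using assms(3) by auto
next
  case (Suc k)
  have "Ck_bounded k S h (A / h ^ mdeg \<beta> / h) (D (minc i \<beta>))" for i
    using Suc.IH[of "minc i \<beta>"] Suc.prems by (simp add: mult.commute)
  then have "Ck_bounded k S h (A / h ^ mdeg \<beta> / h) (partial i (D \<beta>))" for i
    by (rule Ck_bounded_cong[OF assms(1), rotated])
      (use derivative_family_partial[OF assms(2)] Suc.prems in simp)
  moreover have "\<forall>x\<in>S. \<bar>D \<beta> x\<bar> \<le> A / h ^ mdeg \<beta>" using assms(3) Suc.prems by auto
  ultimately show ?case by simp
qed

lemma derivative_family_Ck_bounded:
  assumes "open S" "derivative_family p S D" "Ck_bounded p S h A (D (\<lambda>_. 0))"
  shows "mdeg \<beta> \<le> p \<Longrightarrow> Ck_bounded (p - mdeg \<beta>) S h (A / h ^ mdeg \<beta>) (D \<beta>)"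
proof (induction \<beta> rule: multi_index_induct)
  case zero
  then show ?case using assms(3) by simp
next
  case (minc i \<beta>)
  have "p - mdeg \<beta> = Suc (p - mdeg (minc i \<beta>))" using minc.prems by simp
  then have "Ck_bounded (p - mdeg (minc i \<beta>)) S h (A / h ^ mdeg \<beta> / h) (partial i (D \<beta>))"
    using minc by simp
  then have "Ck_bounded (p - mdeg (minc i \<beta>)) S h (A / h ^ mdeg \<beta> / h) (D (minc i \<beta>))"
    by (rule Ck_bounded_cong[OF assms(1), rotated])
      (use derivative_family_partial[OF assms(2)] minc.prems in simp)
  then show ?case by (simp add: mult.commute)
qed

subsection \<open>A partition of unity on a grid\<close>

text \<open>Averaging a step over unit intervals gains one derivative.\<close>

primrec smooth_step :: "nat \<Rightarrow> real \<Rightarrow> real" where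
  "smooth_step 0 = (\<lambda>t. max 0 (min 1 t))"
| "smooth_step (Suc m) = (\<lambda>t. integral {t - 1..t} (smooth_step m))"

lemma DERIV_moving_integral:
  fixes f :: "real \<Rightarrow> real"
  assumes "continuous_on UNIV f"
  shows "((\<lambda>t. integral {t - 1..t} f) has_real_derivative f t - f (t - 1)) (at t)"
proof -
  define c where "c = t - 2"
  have cont: "continuous_on S f" for S using continuous_on_subset[OF assms] by simp
  have integrable: "f integrable_on {a..b}" for a b by (intro integrable_continuous_real cont)
  have deriv: "((\<lambda>u. integral {c..u} f) has_real_derivative f u) (at u)"
    if "c < u" "u < t + 1" for u
  proof -
    have "((\<lambda>u. integral {c..u} f) has_real_derivative f u) (at u within {c..t + 1})"
      by (intro integral_has_real_derivative cont) (use that in auto)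
    moreover have "at u within {c..t + 1} = at u" using that by (intro at_within_interior) auto
    ultimately show ?thesis by simp
  qed
  have "((\<lambda>u. integral {c..u - 1} f) has_real_derivative f (t - 1)) (at t)"
    using DERIV_shift[of "\<lambda>u. integral {c..u} f" "f (t - 1)" t "-1"] deriv[of "t - 1"]
    by (simp add: c_def)
  then have "((\<lambda>u. integral {c..u} f - integral {c..u - 1} f) has_real_derivative f t - f (t - 1)) (at t)"
    by (intro DERIV_diff deriv) (auto simp: c_def)
  moreover have "\<forall>\<^sub>F u in nhds t. integral {c..u} f - integral {c..u - 1} f = integral {u - 1..u} f"
  proof -
    have "integral {c..u} f - integral {c..u - 1} f = integral {u - 1..u} f" if "c + 1 < u" for u
      using Henstock_Kurzweil_Integration.integral_combine[of c "u - 1" u f] integrable that by simp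
    then show ?thesis
      using eventually_nhds_in_open[of "{c + 1<..}" t] by (auto simp: c_def elim: eventually_mono)
  qed
  ultimately show ?thesis by (subst DERIV_cong_ev[OF refl _ refl]) (auto simp: eq_commute)
qed

lemma continuous_on_smooth_step: "continuous_on S (smooth_step m)"
proof (induction m arbitrary: S)
  case 0
  show ?case by (auto intro!: continuous_intros)
next
  case (Suc m)
  then have "isCont (smooth_step (Suc m)) t" for t
    using DERIV_isCont[OF DERIV_moving_integral] by simp
  then show ?case by (intro continuous_at_imp_continuous_on) simp
qed

lemma DERIV_smooth_step:
  "(smooth_step (Suc m) has_real_derivative smooth_step m t - smooth_step m (t - 1)) (at t)"
  using DERIV_moving_integral[OF continuous_on_smooth_step] by simp

lemma abs_smooth_step_le: "\<bar>smooth_step m t\<bar> \<le> 1"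
proof (induction m arbitrary: t)
  case (Suc m)
  have "norm (integral {t - 1..t} (smooth_step m)) \<le> 1 * (t - (t - 1))"
    by (rule integral_bound) (use Suc.IH continuous_on_smooth_step in auto)
  then show ?case by simp
qed auto

lemma smooth_step_eq_0: "t \<le> 0 \<Longrightarrow> smooth_step m t = 0"
proof (induction m arbitrary: t)
  case (Suc m)
  have "integral {t - 1..t} (smooth_step m) = integral {t - 1..t} (\<lambda>_. 0)"
    by (intro integral_cong) (use Suc in auto)
  then show ?case by simp
qed auto

lemma smooth_step_eq_1: "1 + real m \<le> t \<Longrightarrow> smooth_step m t = 1"
proof (induction m arbitrary: t)
  case (Suc m)
  have "integral {t - 1..t} (smooth_step m) = integral {t - 1..t} (\<lambda>_. 1)"
    by (intro integral_cong) (use Suc in auto)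
  then show ?case by simp
qed auto

lemma has_partial_coordinate:
  fixes x :: "real^'n::finite"
  assumes "(g has_real_derivative d) (at (x$i / e - c))"
  shows "has_partial j (\<lambda>x. g (x$i / e - c)) (if j = i then d / e else 0) x"
proof -
  have "((\<lambda>t. (x + t *\<^sub>R axis j 1)$i / e - c) has_real_derivative (if j = i then 1 / e else 0)) (at 0)"
    unfolding divide_inverse by (auto intro!: derivative_eq_intros simp: axis_def)
  then have "((\<lambda>t. g ((x + t *\<^sub>R axis j 1)$i / e - c)) has_real_derivative
      d * (if j = i then 1 / e else 0)) (at 0)"
    by (rule DERIV_chain2[rotated]) (use assms in simp)
  then show ?thesis unfolding has_partial_def by (simp split: if_splits)
qed

lemma has_partial_smooth_step_coordinate:
  "has_partial j (\<lambda>x. smooth_step (Suc m) (x$i / e - c))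
    ((if j = i then 1 / e else 0) *
      (smooth_step m (x$i / e - c) - smooth_step m (x$i / e - (c + 1)))) x"
  using has_partial_coordinate[OF DERIV_smooth_step[of m "x$i / e - c"], of j]
  by (cases "j = i") (simp_all add: algebra_simps diff_divide_distrib)

lemma Ck_on_smooth_step_coordinate:
  "Ck_on m UNIV (\<lambda>x::real^'n::finite. smooth_step m (x$i / e - c))"
proof (induction m arbitrary: c)
  case 0
  show ?case by (simp add: divide_inverse) (intro continuous_intros)
next
  case (Suc m)
  have "continuous_on UNIV (\<lambda>x::real^'n. smooth_step (Suc m) (x$i / e - c))"
    unfolding divide_inverse
    by (intro continuous_on_compose2[OF continuous_on_smooth_step[of UNIV]] continuous_intros) auto
  then show ?case
    by (rule Ck_on_SucI[OF open_UNIV _ has_partial_smooth_step_coordinate])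
      (intro Ck_on_cmult Ck_on_diff open_UNIV Suc.IH)
qed

lemma Ck_bounded_smooth_step_coordinate:
  assumes "e > 0"
  shows "Ck_bounded m UNIV e (2 ^ m) (\<lambda>x::real^'n::finite. smooth_step m (x$i / e - c))"
proof (induction m arbitrary: c)
  case 0
  show ?case using abs_smooth_step_le[of 0] by simp
next
  case (Suc m)
  let ?D = "\<lambda>x::real^'n. smooth_step m (x$i / e - c) - smooth_step m (x$i / e - (c + 1))"
  have "Ck_bounded m UNIV e (2 ^ Suc m / e) (partial j (\<lambda>x. smooth_step (Suc m) (x$i / e - c)))"
    for j
  proof -
    let ?a = "if j = i then 1 / e else 0 :: real"
    have "Ck_bounded m UNIV e (\<bar>?a\<bar> * (2 ^ m + 2 ^ m)) (\<lambda>x. ?a * ?D x)"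
      by (intro Ck_bounded_cmult Ck_bounded_diff Ck_on_diff Ck_on_smooth_step_coordinate open_UNIV Suc.IH)
    then have "Ck_bounded m UNIV e (2 ^ Suc m / e) (\<lambda>x. ?a * ?D x)"
      by (rule Ck_bounded_mono) (use assms in auto)
    then show ?thesis
      by (rule Ck_bounded_cong[OF open_UNIV, rotated])
        (rule has_partial_imp_partial[OF has_partial_smooth_step_coordinate, symmetric])
  qed
  moreover have "\<bar>smooth_step (Suc m) t\<bar> \<le> 2 ^ Suc m" for t
    by (rule order_trans[OF abs_smooth_step_le one_le_power]) simp
  ultimately show ?case by (simp only: Ck_bounded.simps) blast
qed

definition bump :: "nat \<Rightarrow> real \<Rightarrow> real" where
  "bump p t = smooth_step p (t + 1) - smooth_step p t"

lemma bump_nonzero: "bump p t \<noteq> 0 \<Longrightarrow> \<bar>t\<bar> \<le> 1 + real p"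
  unfolding bump_def using smooth_step_eq_0[of t] smooth_step_eq_0[of "t + 1"]
    smooth_step_eq_1[of p t] smooth_step_eq_1[of p "t + 1"]
  by (smt (verit) of_nat_0_le_iff)

lemma int_dist_le_eq: "{k::int. \<bar>t - of_int k\<bar> \<le> r} = {\<lceil>t - r\<rceil>..\<lfloor>t + r\<rfloor>}" for t r :: real
  unfolding set_eq_iff mem_Collect_eq atLeastAtMost_iff ceiling_le_iff le_floor_iff by auto

lemma bump_sum: "(\<Sum>k::int | \<bar>t - of_int k\<bar> \<le> 1 + real p. bump p (t - of_int k)) = 1"
proof -
  define a where "a = \<lceil>t - (1 + real p)\<rceil>"
  define b where "b = \<lfloor>t + (1 + real p)\<rfloor>"
  have "(\<Sum>k\<in>{a..a + int n - 1}. bump p (t - k)) =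
      smooth_step p (t - a + 1) - smooth_step p (t - (a + int n) + 1)" for n
  proof (induction n)
    case (Suc n)
    have "{a..a + int (Suc n) - 1} = insert (a + int n) {a..a + int n - 1}" by auto
    then show ?case using Suc by (simp add: bump_def algebra_simps)
  qed simp
  from this[of "nat (b + 1 - a)"]
  have "(\<Sum>k\<in>{a..b}. bump p (t - k)) = smooth_step p (t - a + 1) - smooth_step p (t - b)"
    if "a \<le> b + 1"
    using that by (simp add: of_nat_nat)
  moreover have "a \<le> b + 1" unfolding a_def b_def by linarith
  ultimately have "(\<Sum>k\<in>{a..b}. bump p (t - k)) = smooth_step p (t - a + 1) - smooth_step p (t - b)"
    by simp
  also have "\<dots> = 1"
    using smooth_step_eq_1[of p "t - a + 1"] smooth_step_eq_0[of "t - b" p]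
    unfolding a_def b_def by linarith
  finally show ?thesis unfolding int_dist_le_eq a_def b_def .
qed

definition grid_point :: "real \<Rightarrow> ('n \<Rightarrow> int) \<Rightarrow> real^'n::finite" where
  "grid_point e q = (\<chi> i. e * q i)"

definition grid_bump :: "nat \<Rightarrow> real \<Rightarrow> ('n::finite \<Rightarrow> int) \<Rightarrow> real^'n \<Rightarrow> real" where
  "grid_bump p e q x = (\<Prod>i\<in>UNIV. bump p (x$i / e - q i))"

lemma Ck_on_bump_coordinate: "Ck_on p UNIV (\<lambda>x::real^'n::finite. bump p (x$i / e - c))"
  using Ck_on_diff[OF open_UNIV Ck_on_smooth_step_coordinate[of p i e "c - 1"]
      Ck_on_smooth_step_coordinate[of p i e c]]
  by (simp add: bump_def algebra_simps)

lemma Ck_bounded_bump_coordinate: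
  assumes "e > 0"
  shows "Ck_bounded p UNIV e (2 ^ Suc p) (\<lambda>x::real^'n::finite. bump p (x$i / e - c))"
  using Ck_bounded_diff[OF open_UNIV Ck_on_smooth_step_coordinate[of p i e "c - 1"]
      Ck_on_smooth_step_coordinate[of p i e c] Ck_bounded_smooth_step_coordinate[OF assms]
      Ck_bounded_smooth_step_coordinate[OF assms]]
  by (simp add: bump_def algebra_simps)

lemma Ck_on_grid_bump: "Ck_on p UNIV (grid_bump p e q)"
  unfolding grid_bump_def[abs_def] by (intro Ck_on_prod Ck_on_bump_coordinate open_UNIV)

lemma Ck_bounded_grid_bump:
  assumes "e > 0"
  shows "Ck_bounded p UNIV e ((2 ^ p * 2 ^ Suc p) ^ CARD('n)) (grid_bump p e (q :: 'n::finite \<Rightarrow> int))"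
  unfolding grid_bump_def[abs_def] using assms
  by (intro Ck_bounded_prod Ck_on_bump_coordinate Ck_bounded_bump_coordinate) auto

lemma grid_bump_nonzero_component:
  "grid_bump p e q x \<noteq> 0 \<Longrightarrow> \<bar>x$i / e - q i\<bar> \<le> 1 + real p"
  unfolding grid_bump_def using bump_nonzero by (metis UNIV_I finite prod_zero)

lemma grid_point_component_diff: "e > 0 \<Longrightarrow> \<bar>(x - grid_point e q)$i\<bar> = e * \<bar>x$i / e - q i\<bar>"
  by (simp add: grid_point_def field_simps flip: abs_mult_pos)

lemma dist_grid_point_le:
  fixes q :: "'n::finite \<Rightarrow> int"
  assumes "e > 0" "grid_bump p e q x \<noteq> 0"
  shows "dist x (grid_point e q) \<le> real (CARD('n) * (1 + p)) * e"
proof -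
  have "norm (x - grid_point e q) \<le> (\<Sum>i\<in>UNIV. \<bar>(x - grid_point e q)$i\<bar>)" by (rule norm_le_l1_cart)
  also have "\<dots> \<le> (\<Sum>i\<in>(UNIV::'n set). e * (1 + real p))"
    unfolding grid_point_component_diff[OF assms(1)]
    using grid_bump_nonzero_component[OF assms(2)] assms(1) by (intro sum_mono mult_left_mono) auto
  finally show ?thesis by (simp add: dist_norm algebra_simps)
qed

lemma grid_bump_sum:
  fixes x :: "real^'n::finite"
  assumes "finite Q" "\<And>q. grid_bump p e q x \<noteq> 0 \<Longrightarrow> q \<in> Q"
  shows "(\<Sum>q\<in>Q. grid_bump p e q x) = 1"
proof -
  define I where "I i = {k::int. \<bar>x$i / e - k\<bar> \<le> 1 + real p}" for i
  have finite_box: "finite (PiE UNIV I)"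
    unfolding I_def int_dist_le_eq by (rule finite_PiE) auto
  have box: "q \<in> PiE UNIV I" if "grid_bump p e q x \<noteq> 0" for q
    using grid_bump_nonzero_component[OF that] by (auto simp: I_def)
  have "(\<Sum>q\<in>Q. grid_bump p e q x) = (\<Sum>q\<in>Q \<inter> PiE UNIV I. grid_bump p e q x)"
    by (rule sum.mono_neutral_right) (use assms box in auto)
  also have "\<dots> = (\<Sum>q\<in>PiE UNIV I. grid_bump p e q x)"
    by (rule sum.mono_neutral_left) (use assms finite_box in auto)
  also have "\<dots> = (\<Prod>i\<in>UNIV. \<Sum>k\<in>I i. bump p (x$i / e - k))"
    unfolding grid_bump_def by (rule prod_sum_PiE[symmetric]) (auto simp: I_def int_dist_le_eq)
  also have "\<dots> = 1" unfolding I_def bump_sum by simp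
  finally show ?thesis .
qed

lemma grid_points_near:
  fixes x :: "real^'n::finite"
  assumes "e > 0"
  shows "finite {q. dist x (grid_point e q) \<le> real C * e}" (is "finite ?S")
    and "card {q. dist x (grid_point e q) \<le> real C * e} \<le> (2 * C + 1) ^ CARD('n)"
proof -
  let ?I = "\<lambda>i. {k::int. \<bar>x$i / e - k\<bar> \<le> real C}"
  have subset: "?S \<subseteq> PiE UNIV ?I"
  proof
    fix q assume "q \<in> ?S"
    then have "e * \<bar>x$i / e - q i\<bar> \<le> e * real C" for i
      using component_le_norm_cart[of "x - grid_point e q" i]
        grid_point_component_diff[OF assms, of x q i]
      by (simp add: dist_norm mult.commute)
    then show "q \<in> PiE UNIV ?I" using assms by auto
  qed
  have finite_box: "finite (PiE UNIV ?I)" unfolding int_dist_le_eq by (rule finite_PiE) auto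
  show "finite ?S" using subset finite_box finite_subset by blast
  have "card ?S \<le> card (PiE UNIV ?I)" using subset finite_box card_mono by blast
  also have "\<dots> = (\<Prod>i\<in>UNIV. card (?I i))" by (rule card_PiE) simp
  also have "\<dots> \<le> (\<Prod>i\<in>(UNIV::'n set). 2 * C + 1)"
  proof (rule prod_mono, rule conjI)
    fix i
    have "\<lfloor>x$i / e + real C\<rfloor> + 1 - \<lceil>x$i / e - real C\<rceil> \<le> int (2 * C + 1)" by linarith
    then show "card (?I i) \<le> 2 * C + 1"
      by (simp only: int_dist_le_eq card_atLeastAtMost_int nat_le_iff)
  qed simp
  finally show "card ?S \<le> (2 * C + 1) ^ CARD('n)" by simp
qed

lemma finite_grid_points_near:
  assumes "e > 0"
  shows "finite {q. dist x (grid_point e q) \<le> R}"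
proof -
  obtain C :: nat where "R / e \<le> real C" using real_arch_simple by blast
  then have "R \<le> real C * e" using assms by (simp add: field_simps)
  then have "{q. dist x (grid_point e q) \<le> R} \<subseteq> {q. dist x (grid_point e q) \<le> real C * e}" by auto
  then show ?thesis using grid_points_near(1)[OF assms] finite_subset by blast
qed

subsection \<open>Whitney's extension theorem for compact sets\<close>

lemma isCont_of_approximation:
  fixes H P :: "'a::metric_space \<Rightarrow> real"
  assumes "isCont P x" "H x = P x"
    and approx: "\<And>e. e > 0 \<Longrightarrow> \<exists>\<delta>>0. \<forall>y. dist x y < \<delta> \<longrightarrow> \<bar>H y - P y\<bar> \<le> e"
  shows "isCont H x"
proof -
  have "((\<lambda>y. H y - P y) \<longlongrightarrow> 0) (at x)"
  proof (rule tendstoI)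
    fix e :: real assume "e > 0"
    then obtain \<delta> where \<delta>: "\<delta> > 0" "\<And>y. dist x y < \<delta> \<Longrightarrow> \<bar>H y - P y\<bar> \<le> e / 2"
      using approx[of "e / 2"] by auto
    have "dist (H y - P y) 0 < e" if "dist y x < \<delta>" for y
      using \<delta>(2)[of y] that \<open>e > 0\<close> by (simp add: dist_commute)
    then show "\<forall>\<^sub>F y in at x. dist (H y - P y) 0 < e" unfolding eventually_at using \<delta>(1) by blast
  qed
  from tendsto_add[OF this assms(1)[unfolded isCont_def]] assms(2)
  show ?thesis by (simp add: isCont_def)
qed

lemma has_partial_of_approximation:
  assumes "has_partial i P d x" "H x = P x"
    and approx: "\<And>e. e > 0 \<Longrightarrow> \<exists>\<delta>>0. \<forall>y. dist x y < \<delta> \<longrightarrow> \<bar>H y - P y\<bar> \<le> e * dist x y"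
  shows "has_partial i H d x"
proof -
  have "((\<lambda>y. H y - P y) has_derivative (\<lambda>_. 0)) (at x)"
    unfolding has_derivative_at_alt
    using approx assms(2) by (simp add: bounded_linear_zero dist_norm norm_minus_commute)
  from has_partial_add[OF has_derivative_imp_has_partial[OF this] assms(1)]
  show ?thesis by simp
qed

definition taylor_approximates_at ::
    "nat \<Rightarrow> (('n::finite \<Rightarrow> nat) \<Rightarrow> real^'n \<Rightarrow> real) \<Rightarrow> real^'n \<Rightarrow> ('n \<Rightarrow> nat) \<Rightarrow> bool" where
  "taylor_approximates_at p H x \<beta> \<longleftrightarrow> (\<forall>e>0. \<exists>\<delta>>0. \<forall>y. dist x y < \<delta> \<longrightarrow>
     \<bar>taylor_remainder p H x \<beta> y\<bar> \<le> e * dist x y ^ (p - mdeg \<beta>))"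

lemma isCont_of_taylor_approximates_at:
  assumes "taylor_approximates_at p H x \<beta>" "mdeg \<beta> \<le> p"
  shows "isCont (H \<beta>) x"
proof (rule isCont_of_approximation)
  let ?P = "taylor_poly p (\<lambda>\<gamma>. H \<gamma> x) x \<beta>"
  show "isCont ?P x"
    by (rule derivative_family_isCont[OF derivative_family_taylor_poly assms(2) open_UNIV UNIV_I])
  fix e :: real assume "e > 0"
  then obtain \<delta> where \<delta>: "\<delta> > 0"
    "\<And>y. dist x y < \<delta> \<Longrightarrow> \<bar>H \<beta> y - ?P y\<bar> \<le> e * dist x y ^ (p - mdeg \<beta>)"
    using assms(1) unfolding taylor_approximates_at_def taylor_remainder_def by meson
  have "e * dist x y ^ (p - mdeg \<beta>) \<le> e" if "dist x y < 1" for y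
    using that \<open>e > 0\<close> by (simp add: mult_left_le power_le_one)
  then show "\<exists>\<delta>>0. \<forall>y. dist x y < \<delta> \<longrightarrow> \<bar>H \<beta> y - ?P y\<bar> \<le> e"
    using \<delta> by (intro exI[of _ "min \<delta> 1"]) (auto intro: order_trans)
qed simp

lemma has_partial_of_taylor_approximates_at:
  assumes "taylor_approximates_at p H x \<beta>" "mdeg \<beta> < p"
  shows "has_partial i (H \<beta>) (H (minc i \<beta>) x) x"
proof (rule has_partial_of_approximation)
  let ?P = "taylor_poly p (\<lambda>\<gamma>. H \<gamma> x) x \<beta>"
  show "has_partial i ?P (H (minc i \<beta>) x) x"
    using has_partial_taylor_poly[OF assms(2), of i "\<lambda>\<gamma>. H \<gamma> x" x x] by simp
  fix e :: real assume "e > 0"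
  then obtain \<delta> where \<delta>: "\<delta> > 0"
    "\<And>y. dist x y < \<delta> \<Longrightarrow> \<bar>H \<beta> y - ?P y\<bar> \<le> e * dist x y ^ (p - mdeg \<beta>)"
    using assms(1) unfolding taylor_approximates_at_def taylor_remainder_def by meson
  have "e * dist x y ^ (p - mdeg \<beta>) \<le> e * dist x y" if "dist x y < 1" for y
    using that \<open>e > 0\<close> assms(2) power_decreasing[of 1 "p - mdeg \<beta>" "dist x y"]
    by (simp add: mult_left_mono)
  then show "\<exists>\<delta>>0. \<forall>y. dist x y < \<delta> \<longrightarrow> \<bar>H \<beta> y - ?P y\<bar> \<le> e * dist x y"
    using \<delta> by (intro exI[of _ "min \<delta> 1"]) (auto intro: order_trans)
qed simp

lemma derivative_family_UNIV_of_taylor_approximates_at: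
  assumes "closed K" "derivative_family p (- K) H"
    and "\<And>x \<beta>. x \<in> K \<Longrightarrow> mdeg \<beta> \<le> p \<Longrightarrow> taylor_approximates_at p H x \<beta>"
  shows "derivative_family p UNIV H"
proof (rule derivative_familyI)
  have "isCont (H \<beta>) x" if "mdeg \<beta> \<le> p" for \<beta> x
    using derivative_family_isCont[OF assms(2) that] isCont_of_taylor_approximates_at[OF assms(3) that]
      assms(1) that by (cases "x \<in> K") auto
  then show "continuous_on UNIV (H \<beta>)" if "mdeg \<beta> \<le> p" for \<beta>
    using that by (simp add: continuous_at_imp_continuous_on)
  show "has_partial i (H \<beta>) (H (minc i \<beta>) x) x" if "mdeg \<beta> < p" for \<beta> i x
    using derivative_family_has_partial[OF assms(2) that]
      has_partial_of_taylor_approximates_at[OF assms(3) that] that by (cases "x \<in> K") auto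
qed

locale whitney_field =
  fixes K :: "(real^'n::finite) set" and g :: "('n \<Rightarrow> nat) \<Rightarrow> real^'n \<Rightarrow> real" and p :: nat
  assumes compact_K: "compact K" and K_nonempty: "K \<noteq> {}" and whitney_jet_g: "whitney_jet p K g"
begin

abbreviation taylor :: "real^'n \<Rightarrow> ('n \<Rightarrow> nat) \<Rightarrow> real^'n \<Rightarrow> real" where
  "taylor a \<equiv> taylor_poly p (\<lambda>\<gamma>. g \<gamma> a) a"

abbreviation taylor_fun :: "real^'n \<Rightarrow> real^'n \<Rightarrow> real" where
  "taylor_fun a \<equiv> taylor a (\<lambda>_. 0)"

lemma abs_taylor_diff_le:
  fixes e h \<delta> :: real
  assumes "jet_close p K g e \<delta>" "e > 0" "a \<in> K" "a' \<in> K"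
    and "dist a a' < \<delta>" "dist a a' \<le> h" "dist z a' \<le> h" "mdeg \<beta> \<le> p"
  shows "\<bar>taylor a' \<beta> z - taylor a \<beta> z\<bar> \<le> (1 + real CARD('n)) ^ p * (e * h ^ (p - mdeg \<beta>))"
proof -
  have base: "\<bar>taylor a' \<alpha> a' - taylor a \<alpha> a'\<bar> \<le> e * h ^ (p - mdeg \<alpha>)" if "mdeg \<alpha> \<le> p" for \<alpha>
  proof -
    have "\<bar>taylor a' \<alpha> a' - taylor a \<alpha> a'\<bar> \<le> e * dist a a' ^ (p - mdeg \<alpha>)"
      using jet_closeD[OF assms(1,3,4,5) that] by (simp add: taylor_remainder_def)
    also have "\<dots> \<le> e * h ^ (p - mdeg \<alpha>)"
      using assms(2,6) by (intro mult_left_mono power_mono) auto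
    finally show ?thesis .
  qed
  show ?thesis
  proof (rule derivative_family_bound[OF open_UNIV, where D = "\<lambda>\<alpha> x. taylor a' \<alpha> x - taylor a \<alpha> x"])
    show "derivative_family p UNIV (\<lambda>\<alpha> x. taylor a' \<alpha> x - taylor a \<alpha> x)"
      by (intro derivative_family_diff derivative_family_taylor_poly)
    show "\<bar>taylor a' \<alpha> x - taylor a \<alpha> x\<bar> \<le> e" if "mdeg \<alpha> = p" for \<alpha> x
      using base[of \<alpha>] that by (simp add: taylor_poly_top)
  qed (use base assms(7,8) in \<open>auto simp: dist_norm\<close>)
qed

definition support_radius :: nat where "support_radius = CARD('n) * (1 + p)"

definition nearest :: "real^'n \<Rightarrow> real^'n" where
  "nearest x = (SOME a. a \<in> K \<and> infdist x K = dist x a)"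

lemma nearest: "nearest x \<in> K" "infdist x K = dist x (nearest x)"
proof -
  have "\<exists>a. a \<in> K \<and> infdist x K = dist x a"
    using infdist_attains_inf[of K x] compact_K K_nonempty compact_imp_closed by blast
  from someI_ex[OF this] show "nearest x \<in> K" "infdist x K = dist x (nearest x)"
    unfolding nearest_def by auto
qed

definition grid_near :: "nat \<Rightarrow> real \<Rightarrow> ('n \<Rightarrow> int) set" where
  "grid_near c e = {q. infdist (grid_point e q) K \<le> real c * e}"

definition cutoff :: "real \<Rightarrow> real^'n \<Rightarrow> real" where
  "cutoff e x = (\<Sum>q\<in>grid_near (support_radius + 1) e. grid_bump p e q x)"

definition local_average :: "real \<Rightarrow> real^'n \<Rightarrow> real" where
  "local_average e x = (\<Sum>q\<in>grid_near (7 * support_radius + 3) e.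
     grid_bump p e q x * taylor_fun (nearest (grid_point e q)) x)"

definition scale :: "nat \<Rightarrow> real" where "scale j = (1/2) ^ j"

definition annulus_weight :: "nat \<Rightarrow> real^'n \<Rightarrow> real" where
  "annulus_weight j x = cutoff (scale j) x - cutoff (scale (Suc j)) x"

definition extension :: "real^'n \<Rightarrow> real" where
  "extension x = (\<Sum>j\<in>{j. annulus_weight j x \<noteq> 0}. annulus_weight j x * local_average (scale j) x)"

lemma scale_pos [simp]: "scale j > 0" by (simp add: scale_def)

lemma scale_Suc: "scale (Suc j) = scale j / 2" by (simp add: scale_def)

lemma grid_bump_dist:
  fixes e :: real and x :: "real^'n"
  shows "e > 0 \<Longrightarrow> grid_bump p e q x \<noteq> 0 \<Longrightarrow> dist x (grid_point e q) \<le> real support_radius * e"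
  using dist_grid_point_le[of e p q x] by (simp add: support_radius_def)

lemma finite_grid_near:
  fixes e :: real
  assumes "e > 0"
  shows "finite (grid_near c e)"
proof -
  obtain R where R: "\<And>x. x \<in> K \<Longrightarrow> norm x \<le> R"
    using compact_K compact_imp_bounded bounded_iff by metis
  have "dist 0 (grid_point e q) \<le> R + real c * e" if "q \<in> grid_near c e" for q
    using dist_triangle2[of 0 "grid_point e q" "nearest (grid_point e q)"]
      R[OF nearest(1)] nearest(2)[of "grid_point e q"] that
    by (auto simp: grid_near_def intro: order_trans add_mono)
  then show ?thesis
    using finite_subset[OF _ finite_grid_points_near[OF assms, of 0 "R + real c * e"]] by blast
qed

lemma grid_bump_near_sum:
  fixes e :: real
  assumes "e > 0" "infdist x K \<le> real c * e"
  shows "(\<Sum>q\<in>grid_near (c + support_radius) e. grid_bump p e q x) = 1"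
proof (rule grid_bump_sum[OF finite_grid_near[OF assms(1)]])
  fix q :: "'n \<Rightarrow> int" assume "grid_bump p e q x \<noteq> 0"
  then have "dist x (grid_point e q) \<le> real support_radius * e"
    by (rule grid_bump_dist[OF assms(1)])
  moreover have "infdist (grid_point e q) K \<le> infdist x K + dist (grid_point e q) x"
    by (rule infdist_triangle)
  ultimately show "q \<in> grid_near (c + support_radius) e"
    using assms(2) by (simp add: grid_near_def dist_commute algebra_simps)
qed

lemma cutoff_eq_1: "e > 0 \<Longrightarrow> infdist x K \<le> e \<Longrightarrow> cutoff e x = 1"
  unfolding cutoff_def using grid_bump_near_sum[of e x 1] by (simp add: add.commute)

lemma cutoff_eq_0:
  fixes e :: real
  assumes "e > 0" "infdist x K > real (2 * support_radius + 1) * e"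
  shows "cutoff e x = 0"
  unfolding cutoff_def
proof (rule sum.neutral, rule ballI, rule ccontr)
  fix q assume q: "q \<in> grid_near (support_radius + 1) e" "grid_bump p e q x \<noteq> 0"
  then have "dist x (grid_point e q) \<le> real support_radius * e"
    using grid_bump_dist assms(1) by blast
  moreover have "infdist x K \<le> infdist (grid_point e q) K + dist x (grid_point e q)"
    by (rule infdist_triangle)
  ultimately show False using q(1) assms(2) by (simp add: grid_near_def algebra_simps)
qed

lemma annulus_weight_nonzero:
  assumes "annulus_weight j x \<noteq> 0"
  shows "scale j < 2 * infdist x K" "infdist x K \<le> real (2 * support_radius + 1) * scale j"
proof -
  show "scale j < 2 * infdist x K"
  proof (rule ccontr)
    assume "\<not> ?thesis"
    then have "infdist x K \<le> scale (Suc j)" "infdist x K \<le> scale j"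
      using infdist_nonneg[of x K] scale_Suc[of j] by linarith+
    then show False using assms unfolding annulus_weight_def by (simp add: cutoff_eq_1)
  qed
  show "infdist x K \<le> real (2 * support_radius + 1) * scale j"
  proof (rule ccontr)
    assume far: "\<not> ?thesis"
    have "real (2 * support_radius + 1) * scale (Suc j) \<le> real (2 * support_radius + 1) * scale j"
      using scale_pos[of j] by (intro mult_left_mono) (auto simp: scale_Suc)
    then have "cutoff (scale (Suc j)) x = 0" "cutoff (scale j) x = 0"
      using far by (intro cutoff_eq_0 scale_pos; linarith)+
    then show False using assms unfolding annulus_weight_def by simp
  qed
qed

lemma Ck_on_cutoff: "Ck_on p UNIV (cutoff e)"
  unfolding cutoff_def[abs_def] by (intro Ck_on_sum Ck_on_grid_bump open_UNIV)

lemma Ck_on_annulus_weight: "Ck_on p UNIV (annulus_weight j)"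
  unfolding annulus_weight_def[abs_def] by (intro Ck_on_diff Ck_on_cutoff open_UNIV)

lemma Ck_on_taylor_fun: "Ck_on p UNIV (taylor_fun a)"
  by (rule derivative_family_imp_Ck_on[OF open_UNIV derivative_family_taylor_poly]) simp

lemma Ck_on_local_average: "Ck_on p UNIV (local_average e)"
  unfolding local_average_def[abs_def]
  by (intro Ck_on_sum Ck_on_mult Ck_on_taylor_fun Ck_on_grid_bump open_UNIV)

definition scale_ratio :: nat where "scale_ratio = 4 * support_radius + 2"

lemma scale_ratio_ge_1: "1 \<le> real scale_ratio"
  by (simp add: scale_ratio_def)

definition active_scales :: "real \<Rightarrow> nat set" where
  "active_scales d = {j. d < real scale_ratio * scale j \<and> scale j < 3 * d}"

lemma active_scalesD:
  assumes "j \<in> active_scales d"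
  shows "d < real scale_ratio * scale j" "scale j < 3 * d"
  using assms by (auto simp: active_scales_def)

lemma active_scales_le:
  assumes "j \<in> active_scales d" "i \<in> active_scales d" "i \<le> j"
  shows "j < i + 3 * scale_ratio"
proof -
  have "scale j = scale i * (1/2) ^ (j - i)"
    unfolding scale_def using \<open>i \<le> j\<close> by (simp flip: power_add)
  then have "scale j * 2 ^ (j - i) = scale i" by (simp add: power_divide)
  also have "\<dots> < 3 * d" by (rule active_scalesD(2)[OF assms(2)])
  also have "\<dots> < 3 * (real scale_ratio * scale j)" using active_scalesD(1)[OF assms(1)] by simp
  finally have "scale j * 2 ^ (j - i) < scale j * real (3 * scale_ratio)" by (simp add: mult_ac)
  then have "(2::real) ^ (j - i) < real (3 * scale_ratio)"
    using scale_pos[of j] by (simp del: of_nat_mult)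
  then have "2 ^ (j - i) < 3 * scale_ratio"
    by (metis of_nat_less_iff of_nat_numeral of_nat_power)
  then show ?thesis using less_exp[of "j - i"] by linarith
qed

lemma active_scales_bound: "finite (active_scales d)" "card (active_scales d) \<le> 3 * scale_ratio"
proof -
  define i where "i = (LEAST j. j \<in> active_scales d)"
  have "active_scales d \<subseteq> {i..<i + 3 * scale_ratio}"
  proof
    fix j assume j: "j \<in> active_scales d"
    then have "i \<in> active_scales d" "i \<le> j" unfolding i_def by (auto intro: LeastI Least_le)
    then show "j \<in> {i..<i + 3 * scale_ratio}" using active_scales_le[OF j] by simp
  qed
  then show "finite (active_scales d)" "card (active_scales d) \<le> 3 * scale_ratio"
    using finite_subset card_mono[of "{i..<i + 3 * scale_ratio}" "active_scales d"] by auto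
qed

lemma infdist_half_ball:
  assumes "x \<in> ball x0 (infdist x0 K / 2)"
  shows "infdist x0 K / 2 < infdist x K" "infdist x K < 3 / 2 * infdist x0 K"
proof -
  have "infdist x0 K \<le> infdist x K + dist x0 x" "infdist x K \<le> infdist x0 K + dist x x0"
    by (rule infdist_triangle)+
  then show "infdist x0 K / 2 < infdist x K" "infdist x K < 3 / 2 * infdist x0 K"
    using assms by (auto simp: dist_commute)
qed

lemma annulus_weight_nonzero_active:
  assumes "x \<in> ball x0 (infdist x0 K / 2)" "annulus_weight j x \<noteq> 0"
  shows "j \<in> active_scales (infdist x0 K)"
  using infdist_half_ball[OF assms(1)] annulus_weight_nonzero[OF assms(2)]
  unfolding active_scales_def scale_ratio_def by (auto simp: algebra_simps)

lemma extension_local: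
  assumes "x \<in> ball x0 (infdist x0 K / 2)"
  shows "extension x = (\<Sum>j\<in>active_scales (infdist x0 K). annulus_weight j x * local_average (scale j) x)"
  unfolding extension_def
  by (rule sum.mono_neutral_left[OF active_scales_bound(1)])
    (use annulus_weight_nonzero_active[OF assms] in auto)

lemma annulus_weight_sum:
  assumes "x \<in> ball x0 (infdist x0 K / 2)" "infdist x0 K \<le> 1/2"
  shows "(\<Sum>j\<in>active_scales (infdist x0 K). annulus_weight j x) = 1"
proof -
  have pos: "infdist x K > 0"
    using infdist_half_ball(1)[OF assms(1)] infdist_nonneg[of x0 K] by linarith
  have telescope: "(\<Sum>j<M. annulus_weight j x) = cutoff (scale 0) x - cutoff (scale M) x" for M
    by (induction M) (auto simp: annulus_weight_def)
  obtain M where M: "(1/2::real) ^ M < infdist x K / real (2 * support_radius + 1)"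
    using real_arch_pow_inv[of "infdist x K / real (2 * support_radius + 1)" "1/2"] pos by auto
  have far: "infdist x K > real (2 * support_radius + 1) * scale j" if "j \<ge> M" for j
  proof -
    have "scale j \<le> (1/2) ^ M" unfolding scale_def using that by (intro power_decreasing) auto
    then have "scale j < infdist x K / real (2 * support_radius + 1)" using M by linarith
    then show ?thesis by (simp add: field_simps)
  qed
  have "{j. annulus_weight j x \<noteq> 0} \<subseteq> {..<M}"
    using far annulus_weight_nonzero(2)
    by (metis (mono_tags, lifting) lessThan_iff mem_Collect_eq not_le subsetI)
  then have "(\<Sum>j\<in>{j. annulus_weight j x \<noteq> 0}. annulus_weight j x) = (\<Sum>j<M. annulus_weight j x)"
    by (intro sum.mono_neutral_left) auto
  also have "\<dots> = 1"
    unfolding telescope using cutoff_eq_0[of "scale M" x] far[of M] cutoff_eq_1[of 1 x]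
      infdist_half_ball(2)[OF assms(1)] assms(2) by (simp add: scale_def)
  finally have "(\<Sum>j\<in>{j. annulus_weight j x \<noteq> 0}. annulus_weight j x) = 1" .
  moreover have "(\<Sum>j\<in>{j. annulus_weight j x \<noteq> 0}. annulus_weight j x) =
      (\<Sum>j\<in>active_scales (infdist x0 K). annulus_weight j x)"
    by (rule sum.mono_neutral_left[OF active_scales_bound(1)])
      (use annulus_weight_nonzero_active[OF assms(1)] in auto)
  ultimately show ?thesis by simp
qed

lemma infdist_pos: "x \<notin> K \<Longrightarrow> infdist x K > 0"
  using compact_K K_nonempty compact_imp_closed infdist_pos_not_in_closed by blast

lemma Ck_on_extension: "Ck_on p (- K) extension"
proof (rule Ck_on_locally)
  fix x assume "x \<in> - K"
  then have pos: "infdist x K > 0" using infdist_pos by simp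
  let ?S = "ball x (infdist x K / 2)"
  have "Ck_on p ?S (\<lambda>y. \<Sum>j\<in>active_scales (infdist x K). annulus_weight j y * local_average (scale j) y)"
    by (rule Ck_on_subset[OF _ subset_UNIV])
      (intro Ck_on_sum Ck_on_mult Ck_on_annulus_weight Ck_on_local_average open_UNIV)
  then have "Ck_on p ?S extension"
    by (rule Ck_on_cong[OF open_ball, rotated]) (simp add: extension_local)
  then show "\<exists>V. open V \<and> x \<in> V \<and> Ck_on p V extension" using pos by (intro exI[of _ ?S]) auto
qed

definition bump_const :: real where "bump_const = (2 ^ p * 2 ^ Suc p) ^ CARD('n)"

definition overlap :: "nat \<Rightarrow> nat" where "overlap c = (2 * (support_radius + c) + 1) ^ CARD('n)"

text \<open>Distance within which the Taylor polynomials contributing near a point are based, in units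
  of the distance from the point to \<open>K\<close>.\<close>
definition reach :: nat where "reach = 3 * (8 * support_radius + 3 + scale_ratio) + 1"

definition taylor_const :: real
  where "taylor_const = (1 + real CARD('n)) ^ p * (2 * real reach) ^ p"

definition weight_const :: real where
  "weight_const = 2 * (real (2 * scale_ratio) ^ p * (overlap (2 * scale_ratio) * bump_const))"

definition average_const :: real where
  "average_const = overlap scale_ratio * (2 ^ p * (real scale_ratio ^ p * bump_const) * taylor_const)"

definition extension_const :: real where
  "extension_const = real (3 * scale_ratio) * (2 ^ p * weight_const * average_const)"

lemma const_nonneg:
  "0 \<le> bump_const" "0 \<le> taylor_const" "0 \<le> weight_const" "0 \<le> average_const" "0 \<le> extension_const"
  by (auto simp: bump_const_def taylor_const_def weight_const_def average_const_def extension_const_def)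

lemma grid_bump_active:
  fixes e d :: real and x0 :: "real^'n"
  assumes "e > 0" "d \<le> real c * e" "x \<in> ball x0 (d / 2)" "grid_bump p e q x \<noteq> 0"
  shows "q \<in> {q. dist x0 (grid_point e q) \<le> real (support_radius + c) * e}"
proof -
  have "dist x (grid_point e q) \<le> real support_radius * e" by (rule grid_bump_dist[OF assms(1,4)])
  moreover have "dist x0 (grid_point e q) \<le> dist x0 x + dist x (grid_point e q)"
    by (rule dist_triangle)
  moreover have "dist x0 x < d / 2" "0 \<le> dist x0 x" using assms(3) by auto
  ultimately have "dist x0 (grid_point e q) \<le> real c * e + real support_radius * e"
    using assms(2) by linarith
  then show ?thesis by (simp add: algebra_simps)
qed

lemma Ck_bounded_cutoff:
  fixes e d :: real
  assumes "e > 0" "d > 0" "d \<le> real c * e" "c \<ge> 1"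
  shows "Ck_bounded p (ball x0 (d / 2)) d (real c ^ p * (overlap c * bump_const)) (cutoff e)"
proof -
  let ?S = "ball x0 (d / 2)"
  have "Ck_bounded p ?S e (overlap c * bump_const) (cutoff e)"
    unfolding cutoff_def[abs_def] overlap_def
  proof (rule Ck_bounded_sum_sparse[OF open_ball assms(1) finite_grid_near[OF assms(1)] const_nonneg(1)])
    show "finite {q. dist x0 (grid_point e q) \<le> real (support_radius + c) * e}"
      "card {q. dist x0 (grid_point e q) \<le> real (support_radius + c) * e} \<le>
        (2 * (support_radius + c) + 1) ^ CARD('n)"
      by (rule grid_points_near[OF assms(1)])+
    show "Ck_on p ?S (grid_bump p e q) \<and> Ck_bounded p ?S e bump_const (grid_bump p e q)"
      for q :: "'n \<Rightarrow> int"
      using Ck_on_subset[OF Ck_on_grid_bump subset_UNIV]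
        Ck_bounded_subset[OF Ck_bounded_grid_bump[OF assms(1)] subset_UNIV]
      unfolding bump_const_def by blast
    show "grid_bump p e q x = 0"
      if "x \<in> ?S" "q \<notin> {q. dist x0 (grid_point e q) \<le> real (support_radius + c) * e}" for q x
      using grid_bump_active[OF assms(1,3) that(1)] that(2) by blast
  qed
  then show ?thesis by (rule Ck_bounded_rescale[rotated 5]) (use assms in auto)
qed

lemma Ck_bounded_annulus_weight:
  assumes "j \<in> active_scales d" "d > 0"
  shows "Ck_bounded p (ball x0 (d / 2)) d weight_const (annulus_weight j)"
proof -
  have "d \<le> real (2 * scale_ratio) * scale j" "d \<le> real (2 * scale_ratio) * scale (Suc j)"
    using active_scalesD(1)[OF assms(1)] \<open>d > 0\<close> by (simp_all add: scale_Suc)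
  then show ?thesis
    unfolding annulus_weight_def[abs_def] weight_const_def mult_2[of "_ * (_ * bump_const)"]
    using assms(2) scale_ratio_ge_1
    by (intro Ck_bounded_diff Ck_bounded_cutoff Ck_on_subset[OF Ck_on_cutoff] open_ball scale_pos) auto
qed

lemma Ck_bounded_taylor_diff:
  fixes e d \<delta> :: real
  assumes "jet_close p K g e \<delta>" "e > 0" "a \<in> K" "a' \<in> K" "d > 0" "2 * real reach * d < \<delta>"
    and "dist x0 a \<le> d" "dist x0 a' \<le> (real reach - 1) * d"
  shows "Ck_bounded p (ball x0 (d / 2)) d (taylor_const * (e * d ^ p)) (\<lambda>x. taylor_fun a' x - taylor_fun a x)"
proof -
  let ?S = "ball x0 (d / 2)"
  define h where "h = 2 * real reach * d"
  have reach_d: "real reach * d \<le> h" using assms(5) by (simp add: h_def)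
  have aa': "dist a a' \<le> real reach * d"
    using dist_triangle3[of a a' x0] assms(7,8) by (simp add: algebra_simps)
  have bound: "\<bar>taylor a' \<beta> x - taylor a \<beta> x\<bar> \<le> taylor_const * (e * d ^ p) / d ^ mdeg \<beta>"
    if \<beta>: "mdeg \<beta> \<le> p" and x: "x \<in> ?S" for \<beta> x
  proof -
    have "dist x a' \<le> real reach * d"
      using dist_triangle[of x a' x0] x assms(5,8) by (simp add: dist_commute algebra_simps)
    then have "\<bar>taylor a' \<beta> x - taylor a \<beta> x\<bar> \<le> (1 + real CARD('n)) ^ p * (e * h ^ (p - mdeg \<beta>))"
      using aa' reach_d assms(6) \<beta> unfolding h_def
      by (intro abs_taylor_diff_le[OF assms(1-4)]) linarith+
    also have "h ^ (p - mdeg \<beta>) = (2 * real reach) ^ (p - mdeg \<beta>) * (d ^ p / d ^ mdeg \<beta>)"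
      unfolding h_def using \<beta> assms(5) by (simp add: power_mult_distrib power_diff)
    also have "(1 + real CARD('n)) ^ p * (e * \<dots>) \<le>
        (1 + real CARD('n)) ^ p * (e * ((2 * real reach) ^ p * (d ^ p / d ^ mdeg \<beta>)))"
      using assms(2,5)
      by (intro mult_left_mono mult_right_mono power_increasing) (auto simp: reach_def)
    finally show ?thesis by (simp add: taylor_const_def mult_ac)
  qed
  have "Ck_bounded p ?S d (taylor_const * (e * d ^ p) / d ^ mdeg (\<lambda>_::'n. 0))
      ((\<lambda>\<beta> x. taylor a' \<beta> x - taylor a \<beta> x) (\<lambda>_. 0))"
    by (rule derivative_family_imp_Ck_bounded[OF open_ball _ bound])
      (auto intro: derivative_family_diff derivative_family_taylor_poly)
  then show ?thesis by simp
qed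

definition average_deviation :: "real^'n \<Rightarrow> real \<Rightarrow> real^'n \<Rightarrow> real" where
  "average_deviation a e x = (\<Sum>q\<in>grid_near (7 * support_radius + 3) e.
     grid_bump p e q x * (taylor_fun (nearest (grid_point e q)) x - taylor_fun a x))"

lemma Ck_on_average_deviation: "Ck_on p UNIV (average_deviation a e)"
  unfolding average_deviation_def[abs_def]
  by (intro Ck_on_sum Ck_on_mult Ck_on_diff Ck_on_taylor_fun Ck_on_grid_bump open_UNIV)

lemma extension_minus_taylor:
  assumes x: "x \<in> ball x0 (infdist x0 K / 2)" and "infdist x0 K \<le> 1/2"
  shows "extension x - taylor_fun a x =
    (\<Sum>j\<in>active_scales (infdist x0 K). annulus_weight j x * average_deviation a (scale j) x)"
proof -
  have "average_deviation a (scale j) x = local_average (scale j) x - taylor_fun a x"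
    if "j \<in> active_scales (infdist x0 K)" for j
  proof -
    have "infdist x K \<le> real (6 * support_radius + 3) * scale j"
      using infdist_half_ball(2)[OF x] active_scalesD(1)[OF that]
      by (simp add: scale_ratio_def algebra_simps)
    then have "(\<Sum>q\<in>grid_near (7 * support_radius + 3) (scale j). grid_bump p (scale j) q x) = 1"
      using grid_bump_near_sum[of "scale j" x "6 * support_radius + 3"] by (simp add: algebra_simps)
    then show ?thesis unfolding local_average_def average_deviation_def
      by (simp add: right_diff_distrib sum_subtractf sum_distrib_right[symmetric])
  qed
  then have "(\<Sum>j\<in>active_scales (infdist x0 K). annulus_weight j x * average_deviation a (scale j) x) =
      (\<Sum>j\<in>active_scales (infdist x0 K). annulus_weight j x * local_average (scale j) x) -
      (\<Sum>j\<in>active_scales (infdist x0 K). annulus_weight j x) * taylor_fun a x"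
    by (simp add: right_diff_distrib sum_subtractf sum_distrib_right)
  then show ?thesis using extension_local[OF x] annulus_weight_sum[OF x assms(2)] by simp
qed

lemma Ck_bounded_average_deviation:
  fixes e d \<delta> :: real
  assumes "jet_close p K g e \<delta>" "e > 0" "a \<in> K" "d > 0" "2 * real reach * d < \<delta>" "dist x0 a \<le> d"
    and j: "j \<in> active_scales d"
  shows "Ck_bounded p (ball x0 (d / 2)) d (average_const * (e * d ^ p)) (average_deviation a (scale j))"
proof -
  let ?S = "ball x0 (d / 2)"
  let ?R = "{q. dist x0 (grid_point (scale j) q) \<le> real (support_radius + scale_ratio) * scale j}"
  let ?term = "\<lambda>q x. grid_bump p (scale j) q x * (taylor_fun (nearest (grid_point (scale j) q)) x - taylor_fun a x)"
  let ?B = "2 ^ p * (real scale_ratio ^ p * bump_const) * (taylor_const * (e * d ^ p))"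
  have d: "d \<le> real scale_ratio * scale j" "scale j \<le> 3 * d" using active_scalesD[OF j] by auto
  have smooth: "Ck_on p ?S (?term q)" for q
    by (rule Ck_on_subset[OF _ subset_UNIV])
      (intro Ck_on_mult Ck_on_diff Ck_on_taylor_fun Ck_on_grid_bump open_UNIV)
  have bounded: "Ck_bounded p ?S d ?B (?term q)"
    if q: "q \<in> grid_near (7 * support_radius + 3) (scale j)" "q \<in> ?R" for q
  proof (intro Ck_bounded_mult open_ball Ck_on_subset[of p UNIV _ ?S, OF _ subset_UNIV]
      Ck_on_diff Ck_on_taylor_fun Ck_on_grid_bump open_UNIV)
    let ?a = "nearest (grid_point (scale j) q)"
    have "dist x0 ?a \<le> dist x0 (grid_point (scale j) q) + dist (grid_point (scale j) q) ?a"
      by (rule dist_triangle)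
    also have "\<dots> \<le> real (support_radius + scale_ratio) * scale j + real (7 * support_radius + 3) * scale j"
      using q nearest(2) by (intro add_mono) (auto simp: grid_near_def)
    also have "\<dots> = real (8 * support_radius + 3 + scale_ratio) * scale j"
      by (simp add: algebra_simps)
    also have "\<dots> \<le> real (8 * support_radius + 3 + scale_ratio) * (3 * d)"
      using d(2) by (intro mult_left_mono) auto
    also have "\<dots> = (real reach - 1) * d" by (simp add: reach_def)
    finally show "Ck_bounded p ?S d (taylor_const * (e * d ^ p)) (\<lambda>x. taylor_fun ?a x - taylor_fun a x)"
      by (rule Ck_bounded_taylor_diff[OF assms(1,2,3) nearest(1) assms(4-6)])
    have "Ck_bounded p ?S (scale j) bump_const (grid_bump p (scale j) q)"
      using Ck_bounded_subset[OF Ck_bounded_grid_bump[OF scale_pos] subset_UNIV]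
      by (simp only: bump_const_def)
    then show "Ck_bounded p ?S d (real scale_ratio ^ p * bump_const) (grid_bump p (scale j) q)"
      by (rule Ck_bounded_rescale[rotated 5]) (use scale_ratio_ge_1 d \<open>d > 0\<close> in auto)
  qed (use \<open>d > 0\<close> in auto)
  have "Ck_bounded p ?S d (overlap scale_ratio * ?B) (average_deviation a (scale j))"
    unfolding average_deviation_def[abs_def] overlap_def
  proof (rule Ck_bounded_sum_sparse[OF open_ball \<open>d > 0\<close> finite_grid_near[OF scale_pos]])
    show "finite ?R" "card ?R \<le> (2 * (support_radius + scale_ratio) + 1) ^ CARD('n)"
      by (rule grid_points_near[OF scale_pos])+
    show "?term q x = 0" if "q \<notin> ?R" "x \<in> ?S" for q x
      using grid_bump_active[OF scale_pos d(1) that(2)] that(1) by auto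
  qed (use smooth bounded const_nonneg assms(2,4) in auto)
  then show ?thesis by (simp add: average_const_def mult_ac)
qed

lemma Ck_bounded_extension_minus_taylor:
  fixes e \<delta> :: real
  assumes "jet_close p K g e \<delta>" "e > 0" "x0 \<notin> K" "infdist x0 K \<le> 1/2"
    "2 * real reach * infdist x0 K < \<delta>"
  shows "Ck_bounded p (ball x0 (infdist x0 K / 2)) (infdist x0 K)
    (extension_const * (e * infdist x0 K ^ p)) (\<lambda>x. extension x - taylor_fun (nearest x0) x)"
proof -
  define d where "d = infdist x0 K"
  let ?S = "ball x0 (d / 2)" and ?a = "nearest x0"
  let ?term = "\<lambda>j x. annulus_weight j x * average_deviation ?a (scale j) x"
  let ?B = "2 ^ p * weight_const * (average_const * (e * d ^ p))"
  have d: "d > 0" "dist x0 ?a \<le> d" using infdist_pos assms(3) nearest(2) by (auto simp: d_def)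
  have "Ck_on p ?S (?term j)" for j
    by (rule Ck_on_subset[OF _ subset_UNIV])
      (intro Ck_on_mult Ck_on_annulus_weight Ck_on_average_deviation open_UNIV)
  moreover have "Ck_bounded p ?S d ?B (?term j)" if "j \<in> active_scales d" for j
    using assms(5) d(1) unfolding d_def[symmetric]
    by (intro Ck_bounded_mult Ck_bounded_annulus_weight that d open_ball
        Ck_bounded_average_deviation[OF assms(1,2) nearest(1)]
        Ck_on_subset[of p UNIV _ ?S, OF _ subset_UNIV] Ck_on_annulus_weight Ck_on_average_deviation) auto
  ultimately have "Ck_bounded p ?S d (real (3 * scale_ratio) * ?B) (\<lambda>x. \<Sum>j\<in>active_scales d. ?term j x)"
    by (intro Ck_bounded_sum_sparse[OF open_ball d(1) active_scales_bound(1) _ _ _ active_scales_bound])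
      (use const_nonneg assms(2) d(1) in auto)
  then have "Ck_bounded p ?S d (real (3 * scale_ratio) * ?B) (\<lambda>x. extension x - taylor_fun ?a x)"
    by (rule Ck_bounded_cong[OF open_ball, rotated])
      (use extension_minus_taylor[OF _ assms(4)] in \<open>simp add: d_def\<close>)
  then show ?thesis by (simp add: extension_const_def d_def mult_ac)
qed

lemma extension_derivative_close:
  fixes e \<delta> :: real
  assumes "derivative_family p (- K) D" "\<And>x. x \<in> - K \<Longrightarrow> D (\<lambda>_. 0) x = extension x"
    and "jet_close p K g e \<delta>" "e > 0" "y \<notin> K" "infdist y K \<le> 1/2" "2 * real reach * infdist y K < \<delta>"
    and "mdeg \<beta> \<le> p"
  shows "\<bar>D \<beta> y - taylor (nearest y) \<beta> y\<bar> \<le> extension_const * e * infdist y K ^ (p - mdeg \<beta>)"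
proof -
  define d where "d = infdist y K"
  let ?S = "ball y (d / 2)"
  have "d > 0" using infdist_pos[OF assms(5)] by (simp add: d_def)
  have subset: "?S \<subseteq> - K"
  proof
    fix x assume "x \<in> ?S"
    then have "infdist x K > 0" using infdist_half_ball(1)[of x y] \<open>d > 0\<close> by (simp add: d_def)
    then show "x \<in> - K" by auto
  qed
  let ?D = "\<lambda>\<beta> x. D \<beta> x - taylor (nearest y) \<beta> x"
  have "Ck_bounded p ?S d (extension_const * (e * d ^ p)) (?D (\<lambda>_. 0))"
    using Ck_bounded_extension_minus_taylor[OF assms(3-7)] unfolding d_def[symmetric]
    by (rule Ck_bounded_cong[OF open_ball, rotated]) (use subset assms(2) in auto)
  moreover have "derivative_family p ?S ?D"
    by (intro derivative_family_diff derivative_family_taylor_poly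
        derivative_family_subset[OF assms(1) subset])
  ultimately have "Ck_bounded (p - mdeg \<beta>) ?S d (extension_const * (e * d ^ p) / d ^ mdeg \<beta>) (?D \<beta>)"
    using derivative_family_Ck_bounded[OF open_ball, where D = ?D] assms(8) by blast
  then have "\<bar>?D \<beta> y\<bar> \<le> extension_const * (e * d ^ p) / d ^ mdeg \<beta>"
    by (rule Ck_bounded_imp_abs_le) (use \<open>d > 0\<close> in simp)
  also have "\<dots> = extension_const * e * d ^ (p - mdeg \<beta>)"
    using assms(8) \<open>d > 0\<close> by (simp add: power_diff)
  finally show ?thesis by (simp add: d_def)
qed

lemma extension_close_to_taylor:
  fixes e \<delta> :: real
  assumes "derivative_family p (- K) D" "\<And>x. x \<in> - K \<Longrightarrow> D (\<lambda>_. 0) x = extension x"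
    and close: "jet_close p K g e \<delta>" and "e > 0" "a \<in> K" "y \<notin> K"
    and ay: "dist a y \<le> 1/2" "2 * real reach * dist a y < \<delta>" and \<beta>: "mdeg \<beta> \<le> p"
  shows "\<bar>D \<beta> y - taylor a \<beta> y\<bar> \<le>
    (extension_const + (1 + real CARD('n)) ^ p * 2 ^ p) * e * dist a y ^ (p - mdeg \<beta>)"
proof -
  define b where "b = nearest y"
  have b: "b \<in> K" "dist y b = infdist y K" using nearest by (auto simp: b_def)
  have near: "infdist y K \<le> dist a y" using infdist_le[OF \<open>a \<in> K\<close>, of y] by (simp add: dist_commute)
  have "2 * real reach * infdist y K \<le> 2 * real reach * dist a y"
    using near by (intro mult_left_mono) auto
  then have "\<bar>D \<beta> y - taylor b \<beta> y\<bar> \<le> extension_const * e * infdist y K ^ (p - mdeg \<beta>)"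
    unfolding b_def using near ay
    by (intro extension_derivative_close[OF assms(1,2) close \<open>e > 0\<close> \<open>y \<notin> K\<close> _ _ \<beta>]) auto
  also have "\<dots> \<le> extension_const * e * dist a y ^ (p - mdeg \<beta>)"
    using near infdist_nonneg const_nonneg(5) \<open>e > 0\<close> by (intro mult_left_mono power_mono) auto
  finally have far: "\<bar>D \<beta> y - taylor b \<beta> y\<bar> \<le> extension_const * e * dist a y ^ (p - mdeg \<beta>)" .
  have ab: "dist a b \<le> 2 * dist a y" using dist_triangle[of a b y] b(2) near by linarith
  have "1 * dist a y \<le> real reach * dist a y"
    by (intro mult_right_mono) (auto simp: reach_def)
  then have "\<bar>taylor b \<beta> y - taylor a \<beta> y\<bar> \<le> (1 + real CARD('n)) ^ p * (e * (2 * dist a y) ^ (p - mdeg \<beta>))"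
    using ab ay(2) b(2) near zero_le_dist[of a y]
    by (intro abs_taylor_diff_le[OF close \<open>e > 0\<close> \<open>a \<in> K\<close> b(1) _ ab _ \<beta>]) linarith+
  also have "\<dots> \<le> (1 + real CARD('n)) ^ p * (e * (2 ^ p * dist a y ^ (p - mdeg \<beta>)))"
    unfolding power_mult_distrib using \<open>e > 0\<close>
    by (intro mult_left_mono mult_right_mono power_increasing) auto
  finally show ?thesis using far by (simp add: algebra_simps)
qed

lemma extension_taylor_approximates_at:
  assumes D: "derivative_family p (- K) D" "\<And>x. x \<in> - K \<Longrightarrow> D (\<lambda>_. 0) x = extension x"
    and a: "a \<in> K" and \<beta>: "mdeg \<beta> \<le> p"
  shows "taylor_approximates_at p (\<lambda>\<beta> y. if y \<in> K then g \<beta> y else D \<beta> y) a \<beta>"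
  unfolding taylor_approximates_at_def
proof (intro allI impI)
  let ?H = "\<lambda>\<beta> y. if y \<in> K then g \<beta> y else D \<beta> y"
  fix e :: real assume "e > 0"
  define C where "C = 1 + (extension_const + (1 + real CARD('n)) ^ p * 2 ^ p)"
  have C: "C \<ge> 1" using const_nonneg(5) by (simp add: C_def)
  define e' where "e' = e / C"
  have e': "e' > 0" "C * e' = e" using \<open>e > 0\<close> C by (auto simp: e'_def)
  obtain \<delta> where \<delta>: "\<delta> > 0" "jet_close p K g e' \<delta>"
    using whitney_jet_g e'(1) unfolding whitney_jet_def by blast
  have reach: "real reach \<ge> 1" by (simp add: reach_def)
  have "\<bar>taylor_remainder p ?H a \<beta> y\<bar> \<le> e * dist a y ^ (p - mdeg \<beta>)"
    if y: "dist a y < min (1/2) (\<delta> / (2 * real reach))" for y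
  proof -
    have ay: "dist a y \<le> 1/2" "2 * real reach * dist a y < \<delta>"
      using y reach by (auto simp: field_simps)
    have "dist a y \<le> 2 * real reach * dist a y"
      using mult_right_mono[of 1 "2 * real reach" "dist a y"] reach by simp
    then have in_K: "\<bar>g \<beta> y - taylor a \<beta> y\<bar> \<le> 1 * (e' * dist a y ^ (p - mdeg \<beta>))" if "y \<in> K"
      using jet_closeD[OF \<delta>(2) a that _ \<beta>] ay(2) by (simp add: taylor_remainder_def)
    have off_K: "\<bar>D \<beta> y - taylor a \<beta> y\<bar> \<le> (C - 1) * (e' * dist a y ^ (p - mdeg \<beta>))" if "y \<notin> K"
      using extension_close_to_taylor[OF D \<delta>(2) e'(1) a that ay \<beta>] by (simp add: C_def)
    have scaled: "c * (e' * dist a y ^ (p - mdeg \<beta>)) \<le> e * dist a y ^ (p - mdeg \<beta>)" if "c \<le> C" for c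
      unfolding e'(2)[symmetric] mult.assoc using that e'(1) by (intro mult_right_mono) auto
    have "\<bar>?H \<beta> y - taylor a \<beta> y\<bar> \<le> e * dist a y ^ (p - mdeg \<beta>)"
      using order_trans[OF in_K scaled[of 1]] order_trans[OF off_K scaled[of "C - 1"]] C by simp
    then show ?thesis using a by (simp add: taylor_remainder_def)
  qed
  moreover have "min (1/2) (\<delta> / (2 * real reach)) > 0" using \<delta>(1) reach by simp
  ultimately show "\<exists>\<delta>>0. \<forall>y. dist a y < \<delta> \<longrightarrow> \<bar>taylor_remainder p ?H a \<beta> y\<bar> \<le> e * dist a y ^ (p - mdeg \<beta>)"
    by blast
qed

lemma Cp_extension: "\<exists>F. Cp_on p UNIV F \<and> (\<forall>x\<in>K. F x = g (\<lambda>_. 0) x)"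
proof -
  have closed_K: "closed K" using compact_K by (rule compact_imp_closed)
  obtain D where D: "\<And>x. x \<in> - K \<Longrightarrow> D (\<lambda>_. 0) x = extension x" "derivative_family p (- K) D"
    using Ck_on_imp_derivative_family[OF open_Compl[OF closed_K] Ck_on_extension] by blast
  let ?H = "\<lambda>\<beta> y. if y \<in> K then g \<beta> y else D \<beta> y"
  have "derivative_family p UNIV ?H"
  proof (rule derivative_family_UNIV_of_taylor_approximates_at[OF closed_K])
    show "derivative_family p (- K) ?H"
      by (rule derivative_family_cong[OF open_Compl[OF closed_K] _ D(2)]) simp
  qed (rule extension_taylor_approximates_at[OF D(2,1)])
  then show ?thesis
    unfolding Cp_on_iff_derivative_family by (intro exI[of _ "?H (\<lambda>_. 0)"] conjI exI[of _ ?H]) auto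
qed

end

theorem whitney_extension:
  assumes "compact K" "whitney_jet p K g"
  obtains F where "Cp_on p UNIV F" "\<And>x. x \<in> K \<Longrightarrow> F x = g (\<lambda>_. 0) x"
proof (cases "K = {}")
  case True
  then show thesis using that Cp_on_iff_Ck_on[OF open_UNIV] Ck_on_const by blast
next
  case False
  then interpret whitney_field K g p by unfold_locales (use assms in auto)
  show thesis using Cp_extension that by blast
qed

subsection \<open>Patching local extensions\<close>

lemma Ck_on_mult_supported:
  assumes "Ck_on p UNIV \<theta>" "open U" "Ck_on p U F" "closed B" "B \<subseteq> U" "\<And>x. \<theta> x \<noteq> 0 \<Longrightarrow> x \<in> B"
  shows "Ck_on p UNIV (\<lambda>x. \<theta> x * F x)"
proof (rule Ck_on_locally)
  fix x
  show "\<exists>V. open V \<and> x \<in> V \<and> Ck_on p V (\<lambda>x. \<theta> x * F x)"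
  proof (cases "x \<in> U")
    case True
    have "Ck_on p U (\<lambda>x. \<theta> x * F x)"
      by (intro Ck_on_mult assms(2,3) Ck_on_subset[OF assms(1)]) auto
    then show ?thesis using True assms(2) by blast
  next
    case False
    have "Ck_on p (- B) (\<lambda>x. \<theta> x * F x)"
      by (rule Ck_on_cong[OF _ _ Ck_on_const[of p "- B" 0]]) (use assms(4,6) in auto)
    then show ?thesis using False assms(4,5) by blast
  qed
qed

lemma grid_bump_blend:
  fixes f :: "real^'n::finite \<Rightarrow> real"
  assumes e: "e > 0" and smooth: "\<And>q. Ck_on p UNIV (\<lambda>x. grid_bump p e q x * F q x)"
    and agree: "\<And>q x. x \<in> X \<Longrightarrow> grid_bump p e q x \<noteq> 0 \<Longrightarrow> F q x = f x"
  obtains H where "Ck_on p UNIV H" "\<And>x. x \<in> X \<Longrightarrow> H x = f x"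
proof -
  define active where "active x = {q. dist x (grid_point e q) \<le> real (CARD('n) * (1 + p)) * e + 1}"
    for x :: "real^'n"
  define H where "H x = (\<Sum>q\<in>active x. grid_bump p e q x * F q x)" for x
  have finite_active: "finite (active x)" for x
    unfolding active_def by (rule finite_grid_points_near[OF e])
  have active: "q \<in> active x0" if "x \<in> ball x0 1" "grid_bump p e q x \<noteq> 0" for q x x0
    using that(1) dist_grid_point_le[OF e that(2)] dist_triangle[of x0 "grid_point e q" x]
    by (auto simp: active_def)
  have H_local: "H x = (\<Sum>q\<in>active x0. grid_bump p e q x * F q x)" if "x \<in> ball x0 1" for x x0
  proof -
    have "H x = (\<Sum>q\<in>active x \<inter> active x0. grid_bump p e q x * F q x)"
      unfolding H_def by (rule sum.mono_neutral_right) (use finite_active active[OF that] in auto)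
    also have "\<dots> = (\<Sum>q\<in>active x0. grid_bump p e q x * F q x)"
      by (rule sum.mono_neutral_left) (use finite_active active[of x x] in auto)
    finally show ?thesis .
  qed
  have "Ck_on p UNIV H"
  proof (rule Ck_on_locally)
    fix x0 :: "real^'n"
    have "Ck_on p (ball x0 1) (\<lambda>x. \<Sum>q\<in>active x0. grid_bump p e q x * F q x)"
      using Ck_on_subset[OF Ck_on_sum[OF open_UNIV smooth] subset_UNIV] .
    then have "Ck_on p (ball x0 1) H"
      by (rule Ck_on_cong[OF open_ball, rotated]) (simp add: H_local)
    then show "\<exists>V. open V \<and> x0 \<in> V \<and> Ck_on p V H" by (intro exI[of _ "ball x0 1"]) auto
  qed
  moreover have "H x = f x" if x: "x \<in> X" for x
  proof -
    have "H x = (\<Sum>q\<in>active x. grid_bump p e q x) * f x"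
      unfolding H_def sum_distrib_right by (rule sum.cong) (use agree[OF x] in auto)
    also have "(\<Sum>q\<in>active x. grid_bump p e q x) = 1"
      by (rule grid_bump_sum[OF finite_active]) (use active[of x x] in auto)
    finally show ?thesis by simp
  qed
  ultimately show thesis by (rule that)
qed

lemma grid_bump_supports_subordinate:
  fixes C :: "(real^'n::finite) set"
  assumes "compact C" "\<And>z. z \<in> C \<Longrightarrow> open (U z)" "\<And>z. z \<in> C \<Longrightarrow> z \<in> U z"
  obtains e where "e > 0"
    "\<And>q x. x \<in> C \<Longrightarrow> grid_bump p e q x \<noteq> 0 \<Longrightarrow> \<exists>z\<in>C. cball (grid_point e q) (real (CARD('n) * (1 + p)) * e) \<subseteq> U z"
proof -
  obtain \<epsilon> where \<epsilon>: "\<epsilon> > 0" "\<And>x. x \<in> C \<Longrightarrow> \<exists>V\<in>U ` C. ball x \<epsilon> \<subseteq> V"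
    using Heine_Borel_lemma[OF assms(1), of "U ` C"] assms(2,3) by blast
  define r where "r = real (CARD('n) * (1 + p))"
  define e where "e = \<epsilon> / (2 * r + 1)"
  have "r \<ge> 0" by (simp add: r_def)
  then have "e > 0" "(2 * r + 1) * e = \<epsilon>" using \<epsilon>(1) by (auto simp: e_def)
  then have e: "e > 0" "2 * (r * e) + e = \<epsilon>" by (auto simp: algebra_simps)
  have "cball (grid_point e q) (r * e) \<subseteq> ball x \<epsilon>"
    if "grid_bump p e q x \<noteq> 0" for q :: "'n \<Rightarrow> int" and x
  proof
    fix y assume "y \<in> cball (grid_point e q) (r * e)"
    then show "y \<in> ball x \<epsilon>"
      using dist_grid_point_le[OF e(1) that] dist_triangle[of x y "grid_point e q"] e
      by (simp add: r_def)
  qed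
  then show thesis using that[OF e(1)] \<epsilon>(2) unfolding r_def by blast
qed

lemma Ck_on_extension_on_compact:
  fixes f :: "real^'n::finite \<Rightarrow> real"
  assumes loc: "\<And>z. z \<in> C \<Longrightarrow> \<exists>U F. open U \<and> z \<in> U \<and> Ck_on p U F \<and> (\<forall>x\<in>X \<inter> U. F x = f x)"
    and "compact C"
  obtains F where "Ck_on p UNIV F" "\<And>x. x \<in> X \<inter> C \<Longrightarrow> F x = f x"
proof -
  obtain U F where U: "\<And>z. z \<in> C \<Longrightarrow> open (U z)" "\<And>z. z \<in> C \<Longrightarrow> z \<in> U z"
    "\<And>z. z \<in> C \<Longrightarrow> Ck_on p (U z) (F z)" "\<And>z x. z \<in> C \<Longrightarrow> x \<in> X \<Longrightarrow> x \<in> U z \<Longrightarrow> F z x = f x"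
    using loc by (metis IntI)
  obtain e where "e > 0" and subordinate: "\<And>q x. x \<in> C \<Longrightarrow> grid_bump p e q x \<noteq> 0 \<Longrightarrow>
      \<exists>z\<in>C. cball (grid_point e q) (real (CARD('n) * (1 + p)) * e) \<subseteq> U z"
    using grid_bump_supports_subordinate[OF assms(2) U(1,2), where p = p] by blast
  let ?B = "\<lambda>q. cball (grid_point e q) (real (CARD('n) * (1 + p)) * e)"
  have support: "x \<in> ?B q" if "grid_bump p e q x \<noteq> 0" for q :: "'n \<Rightarrow> int" and x
    using dist_grid_point_le[OF \<open>e > 0\<close> that] by (simp add: dist_commute)
  define meets where "meets q \<longleftrightarrow> (\<exists>x\<in>C. grid_bump p e q x \<noteq> 0)" for q
  have "\<exists>z. z \<in> C \<and> ?B q \<subseteq> U z" if "meets q" for q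
    using that subordinate unfolding meets_def by blast
  then obtain z where z: "\<And>q. meets q \<Longrightarrow> z q \<in> C" "\<And>q. meets q \<Longrightarrow> ?B q \<subseteq> U (z q)"
    by metis
  define G where "G q = (if meets q then F (z q) else (\<lambda>_. 0))" for q
  show thesis
  proof (rule grid_bump_blend[OF \<open>e > 0\<close>])
    show "Ck_on p UNIV (\<lambda>x. grid_bump p e q x * G q x)" for q
    proof (cases "meets q")
      case True
      then show ?thesis unfolding G_def
        using Ck_on_mult_supported[OF Ck_on_grid_bump U(1,3)[OF z(1)] closed_cball z(2) support]
        by simp
    qed (simp add: G_def Ck_on_const)
    show "G q x = f x" if "x \<in> X \<inter> C" "grid_bump p e q x \<noteq> 0" for q x
    proof -
      have "meets q" using that by (auto simp: meets_def)
      moreover have "x \<in> U (z q)" using z(2)[OF \<open>meets q\<close>] support[OF that(2)] by blast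
      ultimately show ?thesis using U(4) z(1) that(1) by (simp add: G_def)
    qed
  qed (rule that)
qed

lemma Ck_on_extension_of_local:
  fixes f :: "real^'n::finite \<Rightarrow> real"
  assumes "closed X"
    and loc: "\<And>z. z \<in> X \<Longrightarrow> \<exists>U F. open U \<and> z \<in> U \<and> Ck_on p U F \<and> (\<forall>x\<in>X \<inter> U. F x = f x)"
  obtains F where "Ck_on p UNIV F" "\<And>x. x \<in> X \<Longrightarrow> F x = f x"
proof -
  have loc': "\<exists>U F. open U \<and> z \<in> U \<and> Ck_on p U F \<and> (\<forall>x\<in>X \<inter> U. F x = f x)" for z
  proof (cases "z \<in> X")
    case False
    then show ?thesis using assms(1) Ck_on_const[of p "- X" 0] by (intro exI[of _ "- X"]) auto
  qed (rule loc)
  let ?B = "\<lambda>q :: 'n \<Rightarrow> int. cball (grid_point 1 q) (real (CARD('n) * (1 + p)))"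
  have "\<exists>F. Ck_on p UNIV F \<and> (\<forall>x\<in>X \<inter> ?B q. F x = f x)" for q
    using Ck_on_extension_on_compact
      [OF loc' compact_cball[of "grid_point 1 q" "real (CARD('n) * (1 + p))"]] by metis
  then obtain F where F: "\<And>q. Ck_on p UNIV (F q)" "\<And>q x. x \<in> X \<Longrightarrow> x \<in> ?B q \<Longrightarrow> F q x = f x"
    by (metis IntI)
  show thesis
  proof (rule grid_bump_blend[of 1])
    show "Ck_on p UNIV (\<lambda>x. grid_bump p 1 q x * F q x)" for q
      by (intro Ck_on_mult Ck_on_grid_bump F(1) open_UNIV)
    show "F q x = f x" if "x \<in> X" "grid_bump p 1 q x \<noteq> 0" for q x
      using F(2)[OF that(1)] dist_grid_point_le[OF _ that(2)] by (simp add: dist_commute)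
  qed (use that in auto)
qed

subsection \<open>Functionals on polynomials\<close>

lemma tendsto_fun_iff:
  fixes f :: "'k \<Rightarrow> 'i \<Rightarrow> 'a::topological_space"
  shows "(f \<longlongrightarrow> l) F \<longleftrightarrow> (\<forall>i. ((\<lambda>k. f k i) \<longlongrightarrow> l i) F)"
  using limitin_componentwise[of "\<lambda>_. euclidean" UNIV f l F]
  by (simp add: euclidean_product_topology)

definition mpow :: "real^'n::finite \<Rightarrow> ('n \<Rightarrow> nat) \<Rightarrow> real" where
  "mpow x \<kappa> = (\<Prod>i\<in>UNIV. (x$i) ^ \<kappa> i)"

lemma pdelta_eq_mpow: "pdelta p a \<kappa> = (if mdeg \<kappa> \<le> p then mpow a \<kappa> else 0)"
  by (simp add: pdelta_def mpow_def)

lemma Ck_on_mpow: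
  "open U \<Longrightarrow> (\<And>j. Ck_on k U (\<lambda>x. \<phi> x $ j)) \<Longrightarrow> Ck_on k U (\<lambda>x. mpow (\<phi> x) \<kappa>)"
  unfolding mpow_def by (intro Ck_on_prod Ck_on_power)

lemma binomial_divided:
  fixes x y :: real
  shows "(\<Sum>s\<le>M. x ^ (M - s) / fact (M - s) * (y ^ s / fact s)) = (x + y) ^ M / fact M"
proof -
  have "(x + y) ^ M / fact M = (\<Sum>s\<le>M. of_nat (M choose s) * y ^ s * x ^ (M - s)) / fact M"
    unfolding add.commute[of x y] binomial_ring ..
  also have "\<dots> = (\<Sum>s\<le>M. x ^ (M - s) / fact (M - s) * (y ^ s / fact s))"
    unfolding sum_divide_distrib
    by (rule sum.cong) (auto simp: binomial_fact mult_ac)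
  finally show ?thesis by simp
qed

definition shifted_power_coeff :: "real \<Rightarrow> nat \<Rightarrow> nat \<Rightarrow> real" where
  "shifted_power_coeff b m k = (if k \<le> m then (-b) ^ (m - k) / (fact (m - k) * fact k) else 0)"

lemma shifted_power_coeff_eval:
  "(\<Sum>k\<le>m. shifted_power_coeff b m k * x ^ k) = (x - b) ^ m / fact m"
proof -
  have "(\<Sum>k\<le>m. shifted_power_coeff b m k * x ^ k) =
      (\<Sum>k\<le>m. (-b) ^ (m - k) / fact (m - k) * (x ^ k / fact k))"
    by (rule sum.cong) (auto simp: shifted_power_coeff_def)
  then show ?thesis unfolding binomial_divided by simp
qed

lemma shifted_power_coeff_recenter:
  "shifted_power_coeff a m k = (\<Sum>j\<le>m. (b - a) ^ (m - j) / fact (m - j) * shifted_power_coeff b j k)"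
proof (cases "k \<le> m")
  case True
  define M where "M = m - k"
  have m: "m = M + k" using True by (simp add: M_def)
  have "(\<Sum>j\<le>m. (b - a) ^ (m - j) / fact (m - j) * shifted_power_coeff b j k) =
      (\<Sum>j\<in>{k..m}. (b - a) ^ (m - j) / fact (m - j) * shifted_power_coeff b j k)"
    by (rule sum.mono_neutral_right) (auto simp: shifted_power_coeff_def)
  also have "\<dots> = (\<Sum>s\<le>M. (b - a) ^ (M - s) / fact (M - s) * ((-b) ^ s / fact s) / fact k)"
    by (rule sum.reindex_bij_witness[where i = "\<lambda>s. s + k" and j = "\<lambda>j. j - k"])
      (auto simp: m shifted_power_coeff_def)
  also have "\<dots> = ((b - a) + (-b)) ^ M / fact M / fact k"
    unfolding sum_divide_distrib[symmetric] binomial_divided ..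
  finally show ?thesis using True by (simp add: shifted_power_coeff_def M_def)
next
  case False
  then show ?thesis by (auto simp: shifted_power_coeff_def intro!: sum.neutral[symmetric])
qed

lemma shifted_mono_eq_prod:
  "shifted_mono b \<alpha> \<beta> = (\<Prod>i\<in>UNIV. shifted_power_coeff (b$i) (\<alpha> i) (\<beta> i))"
proof (cases "\<forall>i. \<beta> i \<le> \<alpha> i")
  case True
  have "shifted_mono b \<alpha> \<beta> =
      (\<Prod>i\<in>UNIV. real (\<alpha> i choose \<beta> i) * (- (b$i)) ^ (\<alpha> i - \<beta> i) / fact (\<alpha> i))"
    using True by (simp add: shifted_mono_def mfact_def prod_dividef)
  also have "\<dots> = (\<Prod>i\<in>UNIV. shifted_power_coeff (b$i) (\<alpha> i) (\<beta> i))"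
    by (rule prod.cong) (use True in \<open>auto simp: shifted_power_coeff_def binomial_fact\<close>)
  finally show ?thesis .
next
  case False
  then obtain i where "\<not> \<beta> i \<le> \<alpha> i" by blast
  then have "shifted_power_coeff (b$i) (\<alpha> i) (\<beta> i) = 0" by (simp add: shifted_power_coeff_def)
  then have "(\<Prod>i\<in>UNIV. shifted_power_coeff (b$i) (\<alpha> i) (\<beta> i)) = 0"
    by (metis UNIV_I finite prod_zero)
  moreover have "shifted_mono b \<alpha> \<beta> = 0" unfolding shifted_mono_def by (rule if_not_P[OF False])
  ultimately show ?thesis by simp
qed

lemma mdeg_mono: "(\<And>i. \<beta> i \<le> \<alpha> i) \<Longrightarrow> mdeg \<beta> \<le> mdeg \<alpha>"
  unfolding mdeg_def by (rule sum_mono) auto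

lemma mindex_below_eq:
  assumes "mdeg \<alpha> \<le> p"
  shows "{\<beta> \<in> mindex p. \<forall>i. \<beta> i \<le> \<alpha> i} = PiE UNIV (\<lambda>i. {..\<alpha> i})"
  using order_trans[OF mdeg_mono assms] by (auto simp: mem_mindex)

lemma shifted_mono_eval:
  assumes "mdeg \<alpha> \<le> p"
  shows "(\<Sum>\<kappa>\<in>mindex p. shifted_mono b \<alpha> \<kappa> * mpow x \<kappa>) = divided_power \<alpha> (x - b)"
proof -
  have "(\<Sum>\<kappa>\<in>mindex p. shifted_mono b \<alpha> \<kappa> * mpow x \<kappa>) =
      (\<Sum>\<kappa>\<in>{\<kappa>\<in>mindex p. \<forall>i. \<kappa> i \<le> \<alpha> i}. shifted_mono b \<alpha> \<kappa> * mpow x \<kappa>)"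
    by (rule sum.mono_neutral_right) (auto simp: shifted_mono_def)
  also have "\<dots> = (\<Sum>\<kappa>\<in>PiE UNIV (\<lambda>i. {..\<alpha> i}).
      \<Prod>i\<in>UNIV. shifted_power_coeff (b$i) (\<alpha> i) (\<kappa> i) * (x$i) ^ \<kappa> i)"
    by (simp add: mindex_below_eq[OF assms] shifted_mono_eq_prod mpow_def prod.distrib)
  also have "\<dots> = (\<Prod>i\<in>UNIV. \<Sum>k\<le>\<alpha> i. shifted_power_coeff (b$i) (\<alpha> i) k * (x$i) ^ k)"
    by (rule prod_sum_PiE[symmetric]) auto
  finally show ?thesis by (simp add: shifted_power_coeff_eval divided_power_def)
qed

lemma shifted_mono_recenter:
  "shifted_mono a \<gamma> \<kappa> = (\<Sum>\<alpha>\<in>PiE UNIV (\<lambda>i. {..\<gamma> i}).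
     divided_power (\<lambda>i. \<gamma> i - \<alpha> i) (b - a) * shifted_mono b \<alpha> \<kappa>)"
proof -
  let ?term = "\<lambda>i j. ((b - a)$i) ^ (\<gamma> i - j) / fact (\<gamma> i - j) * shifted_power_coeff (b$i) j (\<kappa> i)"
  have "shifted_mono a \<gamma> \<kappa> = (\<Prod>i\<in>UNIV. \<Sum>j\<le>\<gamma> i. ?term i j)"
    unfolding shifted_mono_eq_prod vector_minus_component
    by (rule prod.cong[OF refl]) (rule shifted_power_coeff_recenter)
  also have "\<dots> = (\<Sum>\<alpha>\<in>PiE UNIV (\<lambda>i. {..\<gamma> i}). \<Prod>i\<in>UNIV. ?term i (\<alpha> i))"
    by (rule prod_sum_PiE) auto
  also have "\<dots> = (\<Sum>\<alpha>\<in>PiE UNIV (\<lambda>i. {..\<gamma> i}).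
      divided_power (\<lambda>i. \<gamma> i - \<alpha> i) (b - a) * shifted_mono b \<alpha> \<kappa>)"
    unfolding shifted_mono_eq_prod divided_power_def prod.distrib ..
  finally show ?thesis .
qed

lemma dual_comp_pdelta: "mdeg \<alpha> \<le> p \<Longrightarrow> dual_comp p (pdelta p a) \<alpha> b = divided_power \<alpha> (a - b)"
  unfolding dual_comp_def dual_app_def
  by (subst shifted_mono_eval[symmetric], assumption, rule sum.cong)
    (auto simp: pdelta_eq_mpow mem_mindex)

lemma dual_comp_recenter:
  assumes "mdeg \<gamma> \<le> p"
  shows "dual_comp p \<eta> \<gamma> a = (\<Sum>\<alpha>\<in>{\<alpha>\<in>mindex p. \<forall>i. \<alpha> i \<le> \<gamma> i}.
    divided_power (\<lambda>i. \<gamma> i - \<alpha> i) (b - a) * dual_comp p \<eta> \<alpha> b)"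
  unfolding dual_comp_def dual_app_def mindex_below_eq[OF assms] sum_distrib_left
  by (subst sum.swap) (simp add: shifted_mono_recenter[of a \<gamma> _ b] sum_distrib_right mult.assoc)

lemma dual_comp_add: "dual_comp p (\<lambda>\<beta>. \<xi> \<beta> + \<eta> \<beta>) \<alpha> b = dual_comp p \<xi> \<alpha> b + dual_comp p \<eta> \<alpha> b"
  by (simp add: dual_comp_def dual_app_def algebra_simps sum.distrib)

lemma dual_comp_scale: "dual_comp p (\<lambda>\<beta>. c * \<xi> \<beta>) \<alpha> b = c * dual_comp p \<xi> \<alpha> b"
  by (simp add: dual_comp_def dual_app_def algebra_simps sum_distrib_left)

lemma dual_comp_zero [simp]: "dual_comp p (\<lambda>\<beta>. 0) \<alpha> b = 0"
  by (simp add: dual_comp_def dual_app_def)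

lemma dual_comp_sum:
  "dual_comp p (\<lambda>\<beta>. \<Sum>v\<in>V. c v * \<xi> v \<beta>) \<alpha> b = (\<Sum>v\<in>V. c v * dual_comp p (\<xi> v) \<alpha> b)"
  unfolding dual_comp_def dual_app_def sum_distrib_left
  by (subst sum.swap) (simp add: mult_ac)

lemma tendsto_shifted_mono:
  assumes "(b \<longlongrightarrow> c) F"
  shows "((\<lambda>k. shifted_mono (b k) \<alpha> \<kappa>) \<longlongrightarrow> shifted_mono c \<alpha> \<kappa>) F"
proof -
  have "((\<lambda>k. shifted_power_coeff (b k $ i) m j) \<longlongrightarrow> shifted_power_coeff (c $ i) m j) F" for i m j
    unfolding shifted_power_coeff_def by (cases "j \<le> m") (auto intro!: tendsto_intros assms)
  then show ?thesis unfolding shifted_mono_eq_prod by (intro tendsto_prod)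
qed

lemma tendsto_dual_comp:
  assumes "(b \<longlongrightarrow> c) F" "\<And>\<kappa>. ((\<lambda>k. \<xi> k \<kappa>) \<longlongrightarrow> \<zeta> \<kappa>) F"
  shows "((\<lambda>k. dual_comp p (\<xi> k) \<alpha> (b k)) \<longlongrightarrow> dual_comp p \<zeta> \<alpha> c) F"
  unfolding dual_comp_def dual_app_def
  by (intro tendsto_sum tendsto_mult tendsto_shifted_mono assms)

subsection \<open>Restrictions of \<open>C\<^sup>p\<close> functions\<close>

definition jet_eval ::
    "nat \<Rightarrow> (('n::finite \<Rightarrow> nat) \<Rightarrow> real^'n \<Rightarrow> real) \<Rightarrow> real^'n \<Rightarrow> (('n \<Rightarrow> nat) \<Rightarrow> real) \<Rightarrow> real" where
  "jet_eval p D a \<xi> = (\<Sum>\<alpha>\<in>mindex p. D \<alpha> a * dual_comp p \<xi> \<alpha> a)"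

lemma jet_eval_add: "jet_eval p D a (\<lambda>\<beta>. \<xi> \<beta> + \<eta> \<beta>) = jet_eval p D a \<xi> + jet_eval p D a \<eta>"
  by (simp add: jet_eval_def dual_comp_add algebra_simps sum.distrib)

lemma jet_eval_scale: "jet_eval p D a (\<lambda>\<beta>. c * \<xi> \<beta>) = c * jet_eval p D a \<xi>"
  by (simp add: jet_eval_def dual_comp_scale algebra_simps sum_distrib_left)

lemma jet_eval_sum:
  "jet_eval p D a (\<lambda>\<beta>. \<Sum>v\<in>V. c v * \<xi> v \<beta>) = (\<Sum>v\<in>V. c v * jet_eval p D a (\<xi> v))"
  unfolding jet_eval_def dual_comp_sum sum_distrib_left
  by (subst sum.swap) (simp add: mult_ac)

lemma jet_eval_pdelta: "jet_eval p D a (pdelta p a) = D (\<lambda>_. 0) a"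
proof -
  have "jet_eval p D a (pdelta p a) = (\<Sum>\<alpha>\<in>mindex p. D \<alpha> a * (if \<alpha> = (\<lambda>_. 0) then 1 else 0))"
    unfolding jet_eval_def
    by (rule sum.cong) (auto simp: dual_comp_pdelta divided_power_zero mem_mindex)
  also have "\<dots> = D (\<lambda>_. 0) a"
    by (subst sum.mono_neutral_right[of _ "{\<lambda>_. 0}"]) (auto simp: mem_mindex)
  finally show ?thesis .
qed

lemma sum_mindex_above:
  assumes "mdeg \<alpha> \<le> p"
  shows "(\<Sum>\<gamma>\<in>{\<gamma>\<in>mindex p. \<forall>i. \<alpha> i \<le> \<gamma> i}. F \<gamma> (\<lambda>i. \<gamma> i - \<alpha> i)) =
    (\<Sum>\<delta>\<in>mindex (p - mdeg \<alpha>). F (\<lambda>i. \<alpha> i + \<delta> i) \<delta>)"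
proof (rule sum.reindex_bij_witness[where i = "\<lambda>\<delta> i. \<alpha> i + \<delta> i" and j = "\<lambda>\<gamma> i. \<gamma> i - \<alpha> i"])
  fix \<gamma> :: "'a \<Rightarrow> nat" assume \<gamma>: "\<gamma> \<in> {\<gamma>\<in>mindex p. \<forall>i. \<alpha> i \<le> \<gamma> i}"
  then show eq: "(\<lambda>i. \<alpha> i + (\<gamma> i - \<alpha> i)) = \<gamma>" by auto
  have "mdeg \<gamma> = mdeg \<alpha> + mdeg (\<lambda>i. \<gamma> i - \<alpha> i)"
    using mdeg_add[of \<alpha> "\<lambda>i. \<gamma> i - \<alpha> i"] by (simp only: eq)
  then show "(\<lambda>i. \<gamma> i - \<alpha> i) \<in> mindex (p - mdeg \<alpha>)" using \<gamma> by (auto simp: mem_mindex)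
  show "F (\<lambda>i. \<alpha> i + (\<gamma> i - \<alpha> i)) (\<lambda>i. \<gamma> i - \<alpha> i) = F \<gamma> (\<lambda>i. \<gamma> i - \<alpha> i)" by (simp only: eq)
next
  fix \<delta> :: "'a \<Rightarrow> nat" assume "\<delta> \<in> mindex (p - mdeg \<alpha>)"
  then show "(\<lambda>i. \<alpha> i + \<delta> i) \<in> {\<gamma>\<in>mindex p. \<forall>i. \<alpha> i \<le> \<gamma> i}"
    using assms by (auto simp: mem_mindex mdeg_add)
qed auto

lemma jet_eval_recenter:
  "jet_eval p D a \<eta> = (\<Sum>\<alpha>\<in>mindex p. dual_comp p \<eta> \<alpha> b * taylor_poly p (\<lambda>\<gamma>. D \<gamma> a) a \<alpha> b)"
proof -
  let ?term = "\<lambda>\<gamma> \<alpha>. dual_comp p \<eta> \<alpha> b * (D \<gamma> a * divided_power (\<lambda>i. \<gamma> i - \<alpha> i) (b - a))"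
  have "jet_eval p D a \<eta> = (\<Sum>\<gamma>\<in>mindex p. \<Sum>\<alpha>\<in>{\<alpha>\<in>mindex p. \<forall>i. \<alpha> i \<le> \<gamma> i}. ?term \<gamma> \<alpha>)"
    unfolding jet_eval_def
    by (rule sum.cong[OF refl], subst dual_comp_recenter[of _ p \<eta> a b])
      (auto simp: mem_mindex sum_distrib_left mult_ac)
  also have "\<dots> = (\<Sum>\<alpha>\<in>mindex p. \<Sum>\<gamma>\<in>{\<gamma>\<in>mindex p. \<forall>i. \<alpha> i \<le> \<gamma> i}. ?term \<gamma> \<alpha>)"
    by (rule sum.swap_restrict) auto
  also have "\<dots> = (\<Sum>\<alpha>\<in>mindex p. dual_comp p \<eta> \<alpha> b * taylor_poly p (\<lambda>\<gamma>. D \<gamma> a) a \<alpha> b)"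
    unfolding taylor_poly_def sum_distrib_left[symmetric]
    using sum_mindex_above[of _ p "\<lambda>\<gamma> \<delta>. D \<gamma> a * divided_power \<delta> (b - a)"]
    by (intro sum.cong) (auto simp: mem_mindex)
  finally show ?thesis .
qed

lemma jet_eval_diff:
  "jet_eval p D b \<eta> - jet_eval p D a \<eta> =
    (\<Sum>\<alpha>\<in>mindex p. dual_comp p \<eta> \<alpha> b * taylor_remainder p D a \<alpha> b)"
  unfolding jet_eval_recenter[of p D a \<eta> b]
  by (simp add: jet_eval_def taylor_remainder_def right_diff_distrib sum_subtractf mult.commute)

definition components_bounded ::
    "nat \<Rightarrow> real^'n::finite \<Rightarrow> real^'n \<Rightarrow> (('n \<Rightarrow> nat) \<Rightarrow> real) \<Rightarrow> real \<Rightarrow> bool" where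
  "components_bounded p a b \<eta> C \<longleftrightarrow>
     (\<forall>\<alpha>. mdeg \<alpha> \<le> p \<longrightarrow> dist a b ^ (p - mdeg \<alpha>) * \<bar>dual_comp p \<eta> \<alpha> b\<bar> \<le> C)"

lemma components_bounded_zero: "0 \<le> C \<Longrightarrow> components_bounded p a b (\<lambda>\<beta>. 0) C"
  by (simp add: components_bounded_def)

lemma components_bounded_scale:
  assumes "components_bounded p a b \<eta> C" "\<bar>r\<bar> * C \<le> C'"
  shows "components_bounded p a b (\<lambda>\<kappa>. r * \<eta> \<kappa>) C'"
  unfolding components_bounded_def dual_comp_scale abs_mult
proof (intro allI impI)
  fix \<alpha> :: "'a \<Rightarrow> nat" assume "mdeg \<alpha> \<le> p"
  then have "\<bar>r\<bar> * (dist a b ^ (p - mdeg \<alpha>) * \<bar>dual_comp p \<eta> \<alpha> b\<bar>) \<le> \<bar>r\<bar> * C"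
    using assms(1) unfolding components_bounded_def by (intro mult_left_mono) auto
  then show "dist a b ^ (p - mdeg \<alpha>) * (\<bar>r\<bar> * \<bar>dual_comp p \<eta> \<alpha> b\<bar>) \<le> C'"
    using assms(2) by (simp add: mult_ac)
qed

lemma components_bounded_mult_remainder:
  assumes "components_bounded p a b \<eta> C" "mdeg \<alpha> \<le> p"
  shows "\<bar>dual_comp p \<eta> \<alpha> b * taylor_remainder p D a \<alpha> b\<bar> \<le>
    C * \<bar>taylor_remainder p D a \<alpha> b / dist a b ^ (p - mdeg \<alpha>)\<bar>"
proof (cases "a = b")
  case False
  then have "\<bar>dual_comp p \<eta> \<alpha> b * taylor_remainder p D a \<alpha> b\<bar> =
      (dist a b ^ (p - mdeg \<alpha>) * \<bar>dual_comp p \<eta> \<alpha> b\<bar>) *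
        \<bar>taylor_remainder p D a \<alpha> b / dist a b ^ (p - mdeg \<alpha>)\<bar>"
    by (simp add: abs_mult abs_divide)
  also have "\<dots> \<le> C * \<bar>taylor_remainder p D a \<alpha> b / dist a b ^ (p - mdeg \<alpha>)\<bar>"
    using assms unfolding components_bounded_def by (intro mult_right_mono) auto
  finally show ?thesis .
qed simp

lemma jet_eval_sum_tendsto:
  fixes D :: "('n::finite \<Rightarrow> nat) \<Rightarrow> real^'n \<Rightarrow> real"
  assumes D: "derivative_family p UNIV D" and lim: "a \<longlonglongrightarrow> c" "b \<longlonglongrightarrow> c"
    and "\<And>\<kappa>. (\<lambda>k. \<xi> k \<kappa> + \<eta> k \<kappa>) \<longlonglongrightarrow> \<zeta> \<kappa>"
    and bounded: "\<And>k::nat. components_bounded p (a k) (b k) (\<eta> k) C"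
  shows "(\<lambda>k. jet_eval p D (a k) (\<xi> k) + jet_eval p D (b k) (\<eta> k)) \<longlonglongrightarrow> jet_eval p D c \<zeta>"
proof -
  have "(\<lambda>k. D \<alpha> (a k)) \<longlonglongrightarrow> D \<alpha> c" if "mdeg \<alpha> \<le> p" for \<alpha>
    using derivative_family_isCont[OF D that open_UNIV UNIV_I] lim(1)
    by (rule isCont_tendsto_compose)
  then have "(\<lambda>k. jet_eval p D (a k) (\<lambda>\<kappa>. \<xi> k \<kappa> + \<eta> k \<kappa>)) \<longlonglongrightarrow> jet_eval p D c \<zeta>"
    unfolding jet_eval_def
    by (intro tendsto_sum tendsto_mult tendsto_dual_comp assms) (simp add: mem_mindex)
  moreover have "(\<lambda>k. jet_eval p D (b k) (\<eta> k) - jet_eval p D (a k) (\<eta> k)) \<longlonglongrightarrow> 0"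
    unfolding jet_eval_diff
  proof (rule tendsto_null_sum)
    fix \<alpha> :: "'n \<Rightarrow> nat" assume "\<alpha> \<in> mindex p"
    then have \<alpha>: "mdeg \<alpha> \<le> p" by (simp add: mem_mindex)
    have jet: "whitney_jet p (cball c 1) D"
      by (rule derivative_family_imp_whitney_jet[OF open_UNIV D]) auto
    have "\<forall>\<^sub>F k in sequentially. dist (a k) c < 1" "\<forall>\<^sub>F k in sequentially. dist (b k) c < 1"
      using tendstoD[OF lim(1), of 1] tendstoD[OF lim(2), of 1] by simp_all
    then have "\<forall>\<^sub>F k in sequentially. a k \<in> cball c 1 \<and> b k \<in> cball c 1"
      by eventually_elim (auto simp: dist_commute)
    moreover have "(\<lambda>k. dist (a k) (b k)) \<longlonglongrightarrow> 0" using tendsto_dist[OF lim] by simp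
    ultimately have "(\<lambda>k. taylor_remainder p D (a k) \<alpha> (b k) / dist (a k) (b k) ^ (p - mdeg \<alpha>)) \<longlonglongrightarrow> 0"
      by (rule whitney_jet_remainder_tendsto[OF jet \<alpha>])
    then have "(\<lambda>k. C * \<bar>taylor_remainder p D (a k) \<alpha> (b k) / dist (a k) (b k) ^ (p - mdeg \<alpha>)\<bar>) \<longlonglongrightarrow> 0"
      by (intro tendsto_mult_right_zero tendsto_rabs_zero)
    then show "(\<lambda>k. dual_comp p (\<eta> k) \<alpha> (b k) * taylor_remainder p D (a k) \<alpha> (b k)) \<longlonglongrightarrow> 0"
      by (rule Lim_null_comparison[rotated])
        (use components_bounded_mult_remainder[OF bounded \<alpha>] in simp)
  qed
  ultimately show ?thesis using tendsto_add by (fastforce simp: jet_eval_add)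
qed

lemma primeF_E:
  assumes "(c, \<zeta>, l) \<in> primeF p X \<Phi>"
  obtains a b \<xi> \<eta> x y where "c \<in> X" "\<And>k::nat. a k \<in> X" "\<And>k. b k \<in> X"
    "\<And>k. (a k, \<xi> k, x k) \<in> \<Phi>" "\<And>k. (b k, \<eta> k, y k) \<in> \<Phi>"
    "\<And>k. components_bounded p (a k) (b k) (\<eta> k) 1"
    "a \<longlonglongrightarrow> c" "b \<longlonglongrightarrow> c" "\<And>\<kappa>. (\<lambda>k. \<xi> k \<kappa> + \<eta> k \<kappa>) \<longlonglongrightarrow> \<zeta> \<kappa>" "(\<lambda>k. x k + y k) \<longlonglongrightarrow> l"
proof -
  have c: "c \<in> X" and "(c, c, \<zeta>, l) \<in> closure (DeltaF p X \<Phi>)" using assms by (auto simp: primeF_def)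
  then obtain s where s: "\<And>k. s k \<in> DeltaF p X \<Phi>" "s \<longlonglongrightarrow> (c, c, \<zeta>, l)"
    unfolding closure_sequential by blast
  have "\<forall>k. \<exists>a b \<xi> \<eta> x y. s k = (a, b, \<lambda>\<beta>. \<xi> \<beta> + \<eta> \<beta>, x + y) \<and> a \<in> X \<and> b \<in> X \<and>
      (a, \<xi>, x) \<in> \<Phi> \<and> (b, \<eta>, y) \<in> \<Phi> \<and> components_bounded p a b \<eta> 1"
    using s(1) unfolding DeltaF_def fibre_def components_bounded_def by blast
  from this[unfolded choice_iff] obtain a b \<xi> \<eta> x y
    where s_eq: "\<And>k. s k = (a k, b k, \<lambda>\<beta>. \<xi> k \<beta> + \<eta> k \<beta>, x k + y k)"
      and mem: "\<And>k. a k \<in> X \<and> b k \<in> X \<and> (a k, \<xi> k, x k) \<in> \<Phi> \<and> (b k, \<eta> k, y k) \<in> \<Phi> \<and>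
        components_bounded p (a k) (b k) (\<eta> k) 1"
    by blast
  have "a \<longlonglongrightarrow> c" using tendsto_fst[OF s(2)] by (simp add: s_eq)
  moreover have "b \<longlonglongrightarrow> c" using tendsto_fst[OF tendsto_snd[OF s(2)]] by (simp add: s_eq)
  moreover have "\<forall>\<kappa>. (\<lambda>k. \<xi> k \<kappa> + \<eta> k \<kappa>) \<longlonglongrightarrow> \<zeta> \<kappa>"
    using tendsto_fst[OF tendsto_snd[OF tendsto_snd[OF s(2)]]] by (simp add: s_eq tendsto_fun_iff)
  moreover have "(\<lambda>k. x k + y k) \<longlonglongrightarrow> l"
    using tendsto_snd[OF tendsto_snd[OF tendsto_snd[OF s(2)]]] by (simp add: s_eq)
  ultimately show thesis using that c mem by blast
qed

lemma primeF_I: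
  assumes "c \<in> X" "\<And>k::nat. a k \<in> X" "\<And>k. b k \<in> X" "\<And>k. (a k, \<xi> k, x k) \<in> \<Phi>"
    "\<And>k. (b k, \<eta> k, y k) \<in> \<Phi>"
    "\<And>k. components_bounded p (a k) (b k) (\<eta> k) 1"
    "a \<longlonglongrightarrow> c" "b \<longlonglongrightarrow> c" "\<And>\<kappa>. (\<lambda>k. \<xi> k \<kappa> + \<eta> k \<kappa>) \<longlonglongrightarrow> \<zeta> \<kappa>" "(\<lambda>k. x k + y k) \<longlonglongrightarrow> l"
  shows "(c, \<zeta>, l) \<in> primeF p X \<Phi>"
proof -
  let ?s = "\<lambda>k. (a k, b k, \<lambda>\<beta>. \<xi> k \<beta> + \<eta> k \<beta>, x k + y k)"
  have "?s k \<in> DeltaF p X \<Phi>" for k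
    using assms(2-6)[of k] unfolding DeltaF_def fibre_def components_bounded_def by blast
  moreover have "?s \<longlonglongrightarrow> (c, c, \<zeta>, l)"
    using assms(7-10) by (intro tendsto_Pair) (auto simp: tendsto_fun_iff)
  ultimately have "(c, c, \<zeta>, l) \<in> closure (DeltaF p X \<Phi>)"
    unfolding closure_sequential by (intro exI[of _ ?s]) simp
  then show ?thesis using assms(1) by (simp add: primeF_def)
qed

lemma primeE_imp_primeF:
  assumes "(c, \<zeta>) \<in> primeE p X E"
  shows "(c, \<zeta>, 0) \<in> primeF p X {(a, \<xi>, 0) | a \<xi>. (a, \<xi>) \<in> E}" (is "_ \<in> primeF p X ?\<Phi>")
proof -
  let ?f = "\<lambda>(a, b, \<zeta>). (a, b, \<zeta>, 0::real)"
  have "?f ` closure (DeltaE p X E) \<subseteq> closure (DeltaF p X ?\<Phi>)"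
  proof (rule image_closure_subset[OF _ closed_closure])
    show "continuous_on (closure (DeltaE p X E)) ?f"
      unfolding case_prod_beta by (intro continuous_intros)
    have "?f ` DeltaE p X E \<subseteq> DeltaF p X ?\<Phi>"
      unfolding DeltaE_def DeltaF_def fibre_def by fastforce
    then show "?f ` DeltaE p X E \<subseteq> closure (DeltaF p X ?\<Phi>)" using closure_subset by blast
  qed
  then show ?thesis using assms by (fastforce simp: primeE_def primeF_def)
qed

lemma lspan2_superset: "S \<subseteq> lspan2 S"
proof
  fix v assume "v \<in> S"
  then show "v \<in> lspan2 S"
    unfolding lspan2_def by (cases v) (auto intro!: exI[of _ "{v}"] exI[of _ "\<lambda>_. 1"])
qed

lemma lspan2_zero: "(\<lambda>\<beta>. 0, 0) \<in> lspan2 S"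
  unfolding lspan2_def by (auto intro!: exI[of _ "{}"])

lemma lspan2_scale:
  assumes "(\<xi>, l) \<in> lspan2 S"
  shows "(\<lambda>\<beta>. c * \<xi> \<beta>, c * l) \<in> lspan2 S"
proof -
  obtain T d where T: "finite T" "T \<subseteq> S" "\<xi> = (\<lambda>\<beta>. \<Sum>v\<in>T. d v * fst v \<beta>)" "l = (\<Sum>v\<in>T. d v * snd v)"
    using assms unfolding lspan2_def by blast
  then have "(\<lambda>\<beta>. c * \<xi> \<beta>) = (\<lambda>\<beta>. \<Sum>v\<in>T. (c * d v) * fst v \<beta>)" "c * l = (\<Sum>v\<in>T. (c * d v) * snd v)"
    by (simp_all add: sum_distrib_left mult.assoc)
  then show ?thesis using T(1,2) unfolding lspan2_def mem_Collect_eq case_prod_conv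
    by (intro exI[of _ T] exI[of _ "\<lambda>v. c * d v"]) simp
qed

lemma lspan2_add:
  assumes "(\<xi>, l) \<in> lspan2 S" "(\<eta>, m) \<in> lspan2 S"
  shows "(\<lambda>\<beta>. \<xi> \<beta> + \<eta> \<beta>, l + m) \<in> lspan2 S"
proof -
  obtain T d where T: "finite T" "T \<subseteq> S" "\<xi> = (\<lambda>\<beta>. \<Sum>v\<in>T. d v * fst v \<beta>)" "l = (\<Sum>v\<in>T. d v * snd v)"
    using assms(1) unfolding lspan2_def by blast
  obtain R e where R: "finite R" "R \<subseteq> S" "\<eta> = (\<lambda>\<beta>. \<Sum>v\<in>R. e v * fst v \<beta>)" "m = (\<Sum>v\<in>R. e v * snd v)"
    using assms(2) unfolding lspan2_def by blast
  define c where "c v = (if v \<in> T then d v else 0) + (if v \<in> R then e v else 0)" for v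
  have sum: "(\<Sum>v\<in>T. d v * g v) + (\<Sum>v\<in>R. e v * g v) = (\<Sum>v\<in>T \<union> R. c v * g v)" for g
  proof -
    have "(\<Sum>v\<in>T. d v * g v) = (\<Sum>v\<in>T \<union> R. (if v \<in> T then d v else 0) * g v)"
      by (rule sum.mono_neutral_cong_left) (use T R in auto)
    moreover have "(\<Sum>v\<in>R. e v * g v) = (\<Sum>v\<in>T \<union> R. (if v \<in> R then e v else 0) * g v)"
      by (rule sum.mono_neutral_cong_left) (use T R in auto)
    ultimately show ?thesis by (simp add: c_def distrib_right sum.distrib)
  qed
  have "(\<lambda>\<beta>. \<xi> \<beta> + \<eta> \<beta>) = (\<lambda>\<beta>. \<Sum>v\<in>T \<union> R. c v * fst v \<beta>)" "l + m = (\<Sum>v\<in>T \<union> R. c v * snd v)"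
    unfolding T R sum by (rule refl)+
  then show ?thesis using T(1,2) R(1,2)
    unfolding lspan2_def mem_Collect_eq case_prod_conv
    by (intro exI[of _ "T \<union> R"] exI[of _ c]) simp
qed

lemma primeF_subset_rhoF: "primeF p X \<Phi> \<subseteq> rhoF p X \<Phi>"
  using lspan2_superset by (fastforce simp: rhoF_def fibre_def primeF_def)

lemma subset_rhoF:
  assumes "\<And>a v. (a, v) \<in> \<Phi> \<Longrightarrow> a \<in> X" "\<And>a. a \<in> X \<Longrightarrow> (a, \<lambda>\<beta>. 0, 0) \<in> \<Phi>"
  shows "\<Phi> \<subseteq> rhoF p X \<Phi>"
proof
  fix z assume z: "z \<in> \<Phi>"
  obtain a \<xi> l where z_eq: "z = (a, \<xi>, l)" by (cases z) auto
  have a: "a \<in> X" using assms(1) z z_eq by blast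
  have "(a, \<xi>, l) \<in> primeF p X \<Phi>"
    by (rule primeF_I[where a = "\<lambda>_. a" and b = "\<lambda>_. a" and \<xi> = "\<lambda>_. \<xi>" and \<eta> = "\<lambda>_ _. 0"
          and x = "\<lambda>_. l" and y = "\<lambda>_. 0"])
      (use a z z_eq assms(2) in \<open>auto intro: components_bounded_zero\<close>)
  then show "z \<in> rhoF p X \<Phi>" using primeF_subset_rhoF z_eq by blast
qed

definition nabla_iter :: "nat \<Rightarrow> (real^'n::finite) set \<Rightarrow> (real^'n \<Rightarrow> real) \<Rightarrow> nat \<Rightarrow>
    ((real^'n) \<times> (('n \<Rightarrow> nat) \<Rightarrow> real) \<times> real) set" where
  "nabla_iter p X f i = (rhoF p X ^^ i) (Phi0 p X f)"

lemma nabla_iter_simps [simp]: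
  "nabla_iter p X f 0 = Phi0 p X f" "nabla_iter p X f (Suc i) = rhoF p X (nabla_iter p X f i)"
  by (simp_all add: nabla_iter_def)

lemma nabla_iter_base: "(a, v) \<in> nabla_iter p X f i \<Longrightarrow> a \<in> X"
  by (cases i) (auto simp: Phi0_def rhoF_def)

lemma nabla_iter_pdelta: "a \<in> X \<Longrightarrow> (a, pdelta p a, f a) \<in> nabla_iter p X f 0"
  by (auto simp: Phi0_def intro!: exI[of _ 1])

lemma nabla_iter_scale:
  assumes "(a, \<xi>, l) \<in> nabla_iter p X f i"
  shows "(a, \<lambda>\<beta>. c * \<xi> \<beta>, c * l) \<in> nabla_iter p X f i"
proof (cases i)
  case 0
  then obtain d where "a \<in> X" "\<xi> = (\<lambda>\<beta>. d * pdelta p a \<beta>)" "l = d * f a"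
    using assms by (auto simp: Phi0_def)
  then show ?thesis using 0 by (auto simp: Phi0_def mult.assoc intro!: exI[of _ "c * d"])
next
  case (Suc j)
  then show ?thesis using assms lspan2_scale[of \<xi> l] by (simp add: rhoF_def)
qed

lemma nabla_iter_add:
  assumes "(a, \<xi>, l) \<in> nabla_iter p X f i" "(a, \<eta>, m) \<in> nabla_iter p X f i"
  shows "(a, \<lambda>\<beta>. \<xi> \<beta> + \<eta> \<beta>, l + m) \<in> nabla_iter p X f i"
proof (cases i)
  case 0
  then obtain d e where "a \<in> X" "\<xi> = (\<lambda>\<beta>. d * pdelta p a \<beta>)" "l = d * f a"
     "\<eta> = (\<lambda>\<beta>. e * pdelta p a \<beta>)" "m = e * f a" using assms by (auto simp: Phi0_def)
  then show ?thesis using 0 by (auto simp: Phi0_def distrib_right intro!: exI[of _ "d + e"])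
next
  case (Suc j)
  then show ?thesis using assms lspan2_add[of \<xi> l _ \<eta> m] by (simp add: rhoF_def)
qed

lemma nabla_iter_diff:
  assumes "(a, \<xi>, l) \<in> nabla_iter p X f i" "(a, \<eta>, m) \<in> nabla_iter p X f i"
  shows "(a, \<lambda>\<beta>. \<xi> \<beta> - \<eta> \<beta>, l - m) \<in> nabla_iter p X f i"
  using nabla_iter_add[OF assms(1) nabla_iter_scale[OF assms(2), of "-1"]] by simp

lemma nabla_iter_zero: "a \<in> X \<Longrightarrow> (a, \<lambda>\<beta>. 0, 0) \<in> nabla_iter p X f i"
  by (cases i) (auto simp: Phi0_def rhoF_def lspan2_zero intro!: exI[of _ 0])

lemma nabla_iter_sum:
  assumes "a \<in> X" "\<And>v. v \<in> V \<Longrightarrow> (a, \<xi> v, l v) \<in> nabla_iter p X f i"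
  shows "(a, \<lambda>\<beta>. \<Sum>v\<in>V. c v * \<xi> v \<beta>, \<Sum>v\<in>V. c v * l v) \<in> nabla_iter p X f i"
  using assms(2)
proof (induction V rule: infinite_finite_induct)
  case (insert v V)
  have "(a, \<lambda>\<beta>. c v * \<xi> v \<beta> + (\<Sum>v\<in>V. c v * \<xi> v \<beta>), c v * l v + (\<Sum>v\<in>V. c v * l v)) \<in> nabla_iter p X f i"
    by (rule nabla_iter_add[OF nabla_iter_scale]) (use insert in auto)
  then show ?case using insert by simp
qed (use nabla_iter_zero[OF assms(1)] in auto)

lemma nabla_iter_mono: "i \<le> j \<Longrightarrow> nabla_iter p X f i \<subseteq> nabla_iter p X f j"
proof (induction j)
  case (Suc j)
  have "nabla_iter p X f j \<subseteq> nabla_iter p X f (Suc j)"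
    unfolding nabla_iter_simps by (rule subset_rhoF) (auto intro: nabla_iter_base nabla_iter_zero)
  then show ?case using Suc by (cases "i = Suc j") auto
qed simp

lemma nabla_eq_nabla_iter:
  fixes X :: "(real^'n::finite) set"
  shows "nabla p X f = nabla_iter p X f (2 * (card (mindex p :: ('n \<Rightarrow> nat) set) + 1))"
  by (simp only: nabla_def nabla_iter_def)

definition jet_graph ::
    "nat \<Rightarrow> (('n::finite \<Rightarrow> nat) \<Rightarrow> real^'n \<Rightarrow> real) \<Rightarrow> ((real^'n) \<times> (('n \<Rightarrow> nat) \<Rightarrow> real) \<times> real) set" where
  "jet_graph p D = {(a, \<xi>, l). l = jet_eval p D a \<xi>}"

lemma mem_jet_graph [simp]: "(a, \<xi>, l) \<in> jet_graph p D \<longleftrightarrow> l = jet_eval p D a \<xi>"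
  by (simp add: jet_graph_def)

lemma primeF_subset_jet_graph:
  assumes "derivative_family p UNIV D" "\<Phi> \<subseteq> jet_graph p D"
  shows "primeF p X \<Phi> \<subseteq> jet_graph p D"
proof clarify
  fix c \<zeta> l assume "(c, \<zeta>, l) \<in> primeF p X \<Phi>"
  then obtain a b \<xi> \<eta> x y where mem: "\<And>k::nat. (a k, \<xi> k, x k) \<in> \<Phi>" "\<And>k. (b k, \<eta> k, y k) \<in> \<Phi>"
    and bounded: "\<And>k. components_bounded p (a k) (b k) (\<eta> k) 1"
    and lim: "a \<longlonglongrightarrow> c" "b \<longlonglongrightarrow> c" "\<And>\<kappa>. (\<lambda>k. \<xi> k \<kappa> + \<eta> k \<kappa>) \<longlonglongrightarrow> \<zeta> \<kappa>" "(\<lambda>k. x k + y k) \<longlonglongrightarrow> l"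
    by (rule primeF_E) blast
  have "x k = jet_eval p D (a k) (\<xi> k)" "y k = jet_eval p D (b k) (\<eta> k)" for k
    using mem[of k] assms(2) by auto
  then have "(\<lambda>k. x k + y k) \<longlonglongrightarrow> jet_eval p D c \<zeta>"
    using jet_eval_sum_tendsto[OF assms(1) lim(1-3) bounded] by simp
  then show "(c, \<zeta>, l) \<in> jet_graph p D" using lim(4) LIMSEQ_unique by auto
qed

lemma rhoF_subset_jet_graph:
  assumes "derivative_family p UNIV D" "\<Phi> \<subseteq> jet_graph p D"
  shows "rhoF p X \<Phi> \<subseteq> jet_graph p D"
proof clarify
  fix a \<xi> l assume "(a, \<xi>, l) \<in> rhoF p X \<Phi>"
  then obtain T c where T: "T \<subseteq> fibre (primeF p X \<Phi>) a" "\<xi> = (\<lambda>\<beta>. \<Sum>v\<in>T. c v * fst v \<beta>)"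
    "l = (\<Sum>v\<in>T. c v * snd v)"
    by (auto simp: rhoF_def lspan2_def)
  have "snd v = jet_eval p D a (fst v)" if "v \<in> T" for v
  proof -
    have "(a, fst v, snd v) \<in> primeF p X \<Phi>" using T(1) that by (auto simp: fibre_def)
    from subsetD[OF primeF_subset_jet_graph[OF assms] this] show ?thesis by (cases v) simp
  qed
  then show "(a, \<xi>, l) \<in> jet_graph p D" by (simp add: T jet_eval_sum)
qed

lemma primeE_jet_eval_mem_primeF:
  assumes "derivative_family p UNIV D" "\<And>a \<xi>. (a, \<xi>) \<in> E \<Longrightarrow> (a, \<xi>, jet_eval p D a \<xi>) \<in> \<Phi>"
    and "(c, \<zeta>) \<in> primeE p X E"
  shows "(c, \<zeta>, jet_eval p D c \<zeta>) \<in> primeF p X \<Phi>"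
  using primeE_imp_primeF[OF assms(3)]
proof (rule primeF_E)
  fix a b \<xi> \<eta> and x y :: "nat \<Rightarrow> real"
  let ?E0 = "{(a, \<xi>, 0) | a \<xi>. (a, \<xi>) \<in> E}"
  assume mem: "c \<in> X" "\<And>k::nat. a k \<in> X" "\<And>k. b k \<in> X" "\<And>k. (a k, \<xi> k, x k) \<in> ?E0"
    "\<And>k. (b k, \<eta> k, y k) \<in> ?E0"
    and bounded: "\<And>k. components_bounded p (a k) (b k) (\<eta> k) 1"
    and lim: "a \<longlonglongrightarrow> c" "b \<longlonglongrightarrow> c" "\<And>\<kappa>. (\<lambda>k. \<xi> k \<kappa> + \<eta> k \<kappa>) \<longlonglongrightarrow> \<zeta> \<kappa>"
  show ?thesis
    by (rule primeF_I[OF mem(1-3) assms(2) assms(2) bounded lim])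
      (use mem(4,5) jet_eval_sum_tendsto[OF assms(1) lim bounded] in auto)
qed

lemma rhoE_jet_eval_mem_rhoF:
  assumes "derivative_family p UNIV D" "\<And>a \<xi>. (a, \<xi>) \<in> E \<Longrightarrow> (a, \<xi>, jet_eval p D a \<xi>) \<in> \<Phi>"
    and "(a, \<xi>) \<in> rhoE p X E"
  shows "(a, \<xi>, jet_eval p D a \<xi>) \<in> rhoF p X \<Phi>"
proof -
  have a: "a \<in> X" and "\<xi> \<in> lspan (fibre (primeE p X E) a)" using assms(3) by (auto simp: rhoE_def)
  then obtain T c where T: "finite T" "T \<subseteq> fibre (primeE p X E) a" "\<xi> = (\<lambda>\<beta>. \<Sum>v\<in>T. c v * v \<beta>)"
    by (auto simp: lspan_def)
  let ?g = "\<lambda>v. (v, jet_eval p D a v)"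
  have inj: "inj_on ?g T" by (auto simp: inj_on_def)
  have "\<xi> = (\<lambda>\<beta>. \<Sum>v\<in>?g ` T. c (fst v) * fst v \<beta>)"
    "jet_eval p D a \<xi> = (\<Sum>v\<in>?g ` T. c (fst v) * snd v)"
    unfolding sum.reindex[OF inj] using T(3) jet_eval_sum[of p D a c "\<lambda>v. v" T] by simp_all
  moreover have "?g ` T \<subseteq> fibre (primeF p X \<Phi>) a"
    using T(2) primeE_jet_eval_mem_primeF[OF assms(1,2)] by (auto simp: fibre_def)
  ultimately have "(\<xi>, jet_eval p D a \<xi>) \<in> lspan2 (fibre (primeF p X \<Phi>) a)"
    unfolding lspan2_def mem_Collect_eq case_prod_conv
    using T(1) by (intro exI[of _ "?g ` T"] exI[of _ "\<lambda>v. c (fst v)"]) simp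
  then show ?thesis using a by (simp add: rhoF_def)
qed

theorem nabla_function_of_extension:
  fixes X :: "(real^'n::finite) set"
  assumes "Cp_on p UNIV F" "\<And>x. x \<in> X \<Longrightarrow> F x = f x" "\<xi> \<in> fibre (tau p X) a"
  shows "\<exists>!l. (a, \<xi>, l) \<in> nabla p X f"
proof -
  obtain D where D: "\<And>x. D (\<lambda>_. 0) x = F x" "derivative_family p UNIV D"
    using assms(1) unfolding Cp_on_iff_derivative_family by blast
  have graph: "nabla_iter p X f i \<subseteq> jet_graph p D" for i
  proof (induction i)
    case 0
    then show ?case using D(1) assms(2) by (auto simp: Phi0_def jet_eval_scale jet_eval_pdelta)
  next
    case (Suc i)
    then show ?case unfolding nabla_iter_simps by (rule rhoF_subset_jet_graph[OF D(2)])
  qed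
  have lift: "(a, \<xi>) \<in> (rhoE p X ^^ i) (E0 p X) \<Longrightarrow> (a, \<xi>, jet_eval p D a \<xi>) \<in> nabla_iter p X f i"
    for i a \<xi>
  proof (induction i arbitrary: a \<xi>)
    case 0
    then show ?case
      using D(1) assms(2) by (auto simp: E0_def Phi0_def jet_eval_scale jet_eval_pdelta)
  next
    case (Suc i)
    then show ?case using rhoE_jet_eval_mem_rhoF[OF D(2) Suc.IH] by simp
  qed
  define r where "r = card (mindex p :: ('n \<Rightarrow> nat) set)"
  have "(a, \<xi>, jet_eval p D a \<xi>) \<in> nabla_iter p X f (2 * r)"
    using assms(3) by (intro lift) (simp add: fibre_def tau_def r_def)
  then have "(a, \<xi>, jet_eval p D a \<xi>) \<in> nabla p X f"
    using nabla_iter_mono[of "2 * r" "2 * (r + 1)" p X f]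
    unfolding nabla_eq_nabla_iter r_def[symmetric] by auto
  moreover have "l = jet_eval p D a \<xi>" if "(a, \<xi>, l) \<in> nabla p X f" for l
    using subsetD[OF graph that[unfolded nabla_eq_nabla_iter]] by simp
  ultimately show ?thesis by blast
qed

subsection \<open>Vanishing order\<close>

fun vanishes_to_order :: "nat \<Rightarrow> real^'n::finite \<Rightarrow> (real^'n \<Rightarrow> real) \<Rightarrow> bool" where
  "vanishes_to_order 0 y F \<longleftrightarrow> True"
| "vanishes_to_order (Suc m) y F \<longleftrightarrow> F y = 0 \<and> (\<forall>i. vanishes_to_order m y (partial i F))"

lemma vanishes_to_order_cong:
  assumes "open U" "y \<in> U" "\<And>x. x \<in> U \<Longrightarrow> F x = G x" "vanishes_to_order m y F"
  shows "vanishes_to_order m y G"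
  using assms(3,4)
proof (induction m arbitrary: F G)
  case (Suc m)
  have "vanishes_to_order m y (partial i G)" for i
    by (rule Suc.IH[of "partial i F"])
      (use partial_cong[OF assms(1) _ Suc.prems(1)] Suc.prems(2) in auto)
  then show ?case using Suc.prems assms(2) by auto
qed simp

lemma vanishes_to_order_add:
  assumes "open U" "y \<in> U"
  shows "Ck_on k U F \<Longrightarrow> Ck_on k U G \<Longrightarrow> n \<le> Suc k \<Longrightarrow>
    vanishes_to_order n y F \<Longrightarrow> vanishes_to_order n y G \<Longrightarrow> vanishes_to_order n y (\<lambda>x. F x + G x)"
proof (induction n arbitrary: k F G)
  case (Suc n)
  show ?case
  proof (cases k)
    case 0
    then show ?thesis using Suc.prems by simp
  next
    case k: (Suc l)
    have "vanishes_to_order n y (partial i (\<lambda>x. F x + G x))" for i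
    proof (rule vanishes_to_order_cong[OF assms])
      show "vanishes_to_order n y (\<lambda>x. partial i F x + partial i G x)"
        using Suc.prems k by (intro Suc.IH[of l]) auto
      show "partial i F x + partial i G x = partial i (\<lambda>x. F x + G x) x" if "x \<in> U" for x
        using Suc.prems k that by (simp add: partial_add)
    qed
    then show ?thesis using Suc.prems by simp
  qed
qed simp

lemma vanishes_to_order_mult:
  assumes "open U" "y \<in> U"
  shows "Ck_on k U F \<Longrightarrow> Ck_on k U G \<Longrightarrow> n \<le> Suc k \<Longrightarrow> n \<le> m + l \<Longrightarrow>
    vanishes_to_order m y F \<Longrightarrow> vanishes_to_order l y G \<Longrightarrow> vanishes_to_order n y (\<lambda>x. F x * G x)"
proof (induction n arbitrary: k F G m l)
  case (Suc n)
  have zero: "F y * G y = 0" using Suc.prems(4-6) by (cases m; cases l) auto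
  show ?case
  proof (cases k)
    case 0
    then show ?thesis using Suc.prems zero by simp
  next
    case k: (Suc k')
    have smooth: "Ck_on k' U F" "Ck_on k' U G" "Ck_on k' U (partial i F)" "Ck_on k' U (partial i G)"
      for i
      using Suc.prems k Ck_on_SucD by auto
    have vanish: "vanishes_to_order (m - 1) y (partial i F)"
      "vanishes_to_order (l - 1) y (partial i G)" for i
      using Suc.prems(5,6) by (cases m; cases l; auto)+
    have "vanishes_to_order n y (partial i (\<lambda>x. F x * G x))" for i
    proof (rule vanishes_to_order_cong[OF assms])
      have "vanishes_to_order n y (\<lambda>x. partial i F x * G x)"
        by (rule Suc.IH[OF smooth(3,2) _ _ vanish(1) Suc.prems(6)]) (use Suc.prems k in auto)
      moreover have "vanishes_to_order n y (\<lambda>x. F x * partial i G x)"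
        by (rule Suc.IH[OF smooth(1,4) _ _ Suc.prems(5) vanish(2)]) (use Suc.prems k in auto)
      moreover have "Ck_on k' U (\<lambda>x. partial i F x * G x)" "Ck_on k' U (\<lambda>x. F x * partial i G x)"
        by (intro Ck_on_mult assms(1) smooth)+
      ultimately show "vanishes_to_order n y (\<lambda>x. partial i F x * G x + F x * partial i G x)"
        using vanishes_to_order_add[OF assms] Suc.prems(3) k by auto
      show "partial i F x * G x + F x * partial i G x = partial i (\<lambda>x. F x * G x) x"
        if "x \<in> U" for x
        using Suc.prems(1,2) k that by (simp add: partial_mult)
    qed
    then show ?thesis using zero by simp
  qed
qed simp

lemma vanishes_to_order_power:
  assumes "open U" "y \<in> U" "Ck_on k U F" "F y = 0"
  shows "m \<le> Suc k \<Longrightarrow> vanishes_to_order m y (\<lambda>x. F x ^ m)"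
proof (induction m)
  case (Suc m)
  have "vanishes_to_order (Suc m) y (\<lambda>x. F x * F x ^ m)"
    by (rule vanishes_to_order_mult[OF assms(1-3) Ck_on_power[OF assms(1,3)], of _ 1 m])
      (use Suc assms(4) in auto)
  then show ?case by simp
qed simp

lemma vanishes_to_order_prod:
  assumes "open U" "y \<in> U" "finite I" "\<And>i. i \<in> I \<Longrightarrow> Ck_on k U (F i)"
    and "\<And>i. i \<in> I \<Longrightarrow> vanishes_to_order (m i) y (F i)" "(\<Sum>i\<in>I. m i) \<le> Suc k"
  shows "vanishes_to_order (\<Sum>i\<in>I. m i) y (\<lambda>x. \<Prod>i\<in>I. F i x)"
  using assms(3-)
proof (induction I rule: finite_induct)
  case (insert i I)
  have "vanishes_to_order (m i + (\<Sum>i\<in>I. m i)) y (\<lambda>x. F i x * (\<Prod>i\<in>I. F i x))"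
    by (rule vanishes_to_order_mult[OF assms(1,2) _ Ck_on_prod[OF assms(1)]]) (use insert in auto)
  then show ?case using insert by simp
qed simp

lemma vanishes_to_order_divided_power:
  fixes \<phi> :: "real^'m::finite \<Rightarrow> real^'n::finite"
  assumes "open U" "y \<in> U" "\<And>j. Ck_on k U (\<lambda>x. \<phi> x $ j)" "mdeg \<alpha> \<le> k"
  shows "vanishes_to_order (mdeg \<alpha>) y (\<lambda>x. divided_power \<alpha> (\<phi> x - \<phi> y))"
proof -
  let ?\<phi> = "\<lambda>i x. \<phi> x $ i - \<phi> y $ i"
  have smooth: "Ck_on k U (?\<phi> i)" for i by (intro Ck_on_diff assms Ck_on_const)
  have \<alpha>_le: "\<alpha> i \<le> k" for i using le_mdeg[of \<alpha> i] assms(4) by simp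
  have "vanishes_to_order (\<alpha> i) y (\<lambda>x. 1 / fact (\<alpha> i) * ?\<phi> i x ^ \<alpha> i)" for i
  proof (rule vanishes_to_order_mult[OF assms(1,2) Ck_on_const Ck_on_power[OF assms(1) smooth], of _ 0 "\<alpha> i"])
    show "vanishes_to_order (\<alpha> i) y (\<lambda>x. ?\<phi> i x ^ \<alpha> i)"
      by (rule vanishes_to_order_power[OF assms(1,2) smooth]) (use \<alpha>_le[of i] in auto)
  qed (use \<alpha>_le[of i] in auto)
  then have "vanishes_to_order (\<Sum>i\<in>UNIV. \<alpha> i) y (\<lambda>x. \<Prod>i\<in>UNIV. 1 / fact (\<alpha> i) * ?\<phi> i x ^ \<alpha> i)"
    by (intro vanishes_to_order_prod[OF assms(1,2), where k = k] Ck_on_cmult[OF assms(1)]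
        Ck_on_power[OF assms(1)] smooth)
      (use assms(4) in \<open>auto simp: mdeg_def\<close>)
  then show ?thesis by (simp add: mdeg_def divided_power_def)
qed

lemma derivative_family_vanishes_to_order:
  assumes "open U" "y \<in> U" "derivative_family p U D" "vanishes_to_order n y (D (\<lambda>_. 0))"
  shows "mdeg \<beta> \<le> p \<Longrightarrow> vanishes_to_order (n - mdeg \<beta>) y (D \<beta>)"
proof (induction \<beta> rule: multi_index_induct)
  case zero
  then show ?case using assms(4) by simp
next
  case (minc i \<beta>)
  then have IH: "vanishes_to_order (n - mdeg \<beta>) y (D \<beta>)" by simp
  show ?case
  proof (cases "n - mdeg \<beta>")
    case (Suc m)
    then have "vanishes_to_order m y (partial i (D \<beta>))" using IH by simp
    then have "vanishes_to_order m y (D (minc i \<beta>))"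
      by (rule vanishes_to_order_cong[OF assms(1,2), rotated])
        (use derivative_family_partial[OF assms(3)] minc.prems in simp)
    moreover have "n - mdeg (minc i \<beta>) = m" using Suc by simp
    ultimately show ?thesis by simp
  qed simp
qed

subsection \<open>Limits in the iterated bundles\<close>

lemma nabla_iter_limit_scaled:
  assumes "\<And>k::nat. (a k, \<xi> k, x k) \<in> nabla_iter p X f i" "\<And>k. (b k, \<eta> k, y k) \<in> nabla_iter p X f i"
    "\<And>k. components_bounded p (a k) (b k) (\<eta> k) C" "a \<longlonglongrightarrow> c" "b \<longlonglongrightarrow> c" "c \<in> X"
    "\<And>\<kappa>. (\<lambda>k. \<xi> k \<kappa> + \<eta> k \<kappa>) \<longlonglongrightarrow> \<zeta> \<kappa>"
    and s: "\<And>k. 0 \<le> s k" "\<And>k. s k \<le> 1" "s \<longlonglongrightarrow> t" "(\<lambda>k. s k * (x k + y k)) \<longlonglongrightarrow> l"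
  shows "(c, \<lambda>\<kappa>. t * \<zeta> \<kappa>, l) \<in> nabla_iter p X f (Suc i)"
proof -
  define C' where "C' = max C 1"
  have C': "C' \<ge> 1" "C \<le> C'" by (auto simp: C'_def)
  define r where "r k = s k / C'" for k
  have r_lim: "(\<lambda>k. r k * z k) \<longlonglongrightarrow> w / C'" if "(\<lambda>k. s k * z k) \<longlonglongrightarrow> w" for z w
    using tendsto_divide[OF that tendsto_const, of C'] C' by (simp add: r_def)
  have "(c, \<lambda>\<kappa>. t * \<zeta> \<kappa> / C', l / C') \<in> primeF p X (nabla_iter p X f i)"
  proof (rule primeF_I[where a = a and b = b and \<xi> = "\<lambda>k \<kappa>. r k * \<xi> k \<kappa>" and \<eta> = "\<lambda>k \<kappa>. r k * \<eta> k \<kappa>"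
        and x = "\<lambda>k. r k * x k" and y = "\<lambda>k. r k * y k"])
    show "a k \<in> X" "b k \<in> X" for k using assms(1,2) nabla_iter_base by blast+
    show "(a k, \<lambda>\<kappa>. r k * \<xi> k \<kappa>, r k * x k) \<in> nabla_iter p X f i"
      "(b k, \<lambda>\<kappa>. r k * \<eta> k \<kappa>, r k * y k) \<in> nabla_iter p X f i" for k
      by (intro nabla_iter_scale assms)+
    show "components_bounded p (a k) (b k) (\<lambda>\<kappa>. r k * \<eta> k \<kappa>) 1" for k
    proof (rule components_bounded_scale[OF assms(3)])
      have "\<bar>r k\<bar> * C \<le> \<bar>r k\<bar> * C'" using C'(2) by (intro mult_left_mono) auto
      also have "\<dots> = s k" using C' s(1) by (simp add: r_def)
      finally show "\<bar>r k\<bar> * C \<le> 1" using s(2)[of k] by linarith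
    qed
    show "(\<lambda>k. r k * \<xi> k \<kappa> + r k * \<eta> k \<kappa>) \<longlonglongrightarrow> t * \<zeta> \<kappa> / C'" for \<kappa>
      using r_lim[OF tendsto_mult[OF s(3) assms(7)]] by (simp add: distrib_left)
    show "(\<lambda>k. r k * x k + r k * y k) \<longlonglongrightarrow> l / C'"
      using r_lim[OF s(4)] by (simp add: distrib_left)
  qed (rule assms)+
  then have "(c, \<lambda>\<kappa>. t * \<zeta> \<kappa> / C', l / C') \<in> nabla_iter p X f (Suc i)"
    using primeF_subset_rhoF by auto
  from nabla_iter_scale[OF this, of C'] show ?thesis using C' by simp
qed

lemma normalized_subsequence:
  fixes z :: "nat \<Rightarrow> real"
  obtains q t u where "strict_mono q" "(\<lambda>k. 1 / (1 + \<bar>z (q k)\<bar>)) \<longlonglongrightarrow> t"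
    "(\<lambda>k. 1 / (1 + \<bar>z (q k)\<bar>) * z (q k)) \<longlonglongrightarrow> u" "\<bar>u\<bar> = 1 - t"
proof -
  define s where "s k = 1 / (1 + \<bar>z k\<bar>)" for k
  have s: "0 \<le> s k" "\<bar>s k * z k\<bar> = 1 - s k" for k
    by (auto simp: s_def abs_mult field_simps)
  have "s k \<le> 1" for k by (simp add: s_def)
  moreover have "\<bar>s k * z k\<bar> \<le> 1" for k using s[of k] by simp
  ultimately have mem: "(s k, s k * z k) \<in> {0..1} \<times> {-1..1}" for k
    using s(1)[of k] unfolding abs_le_iff by auto
  have "compact ({0..1::real} \<times> {-1..1::real})" by (intro compact_Times compact_Icc)
  from this[unfolded compact_def, rule_format, of "\<lambda>k. (s k, s k * z k)", OF mem]
  obtain q w where q: "strict_mono q" "((\<lambda>k. (s k, s k * z k)) \<circ> q) \<longlonglongrightarrow> w" by blast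
  have lim: "(\<lambda>k. s (q k)) \<longlonglongrightarrow> fst w" "(\<lambda>k. s (q k) * z (q k)) \<longlonglongrightarrow> snd w"
    using tendsto_fst[OF q(2)] tendsto_snd[OF q(2)] by (auto simp: o_def)
  have "(\<lambda>k. \<bar>s (q k) * z (q k)\<bar>) \<longlonglongrightarrow> 1 - fst w"
    unfolding s(2) by (intro tendsto_intros lim)
  moreover have "(\<lambda>k. \<bar>s (q k) * z (q k)\<bar>) \<longlonglongrightarrow> \<bar>snd w\<bar>" by (intro tendsto_rabs lim)
  ultimately have "\<bar>snd w\<bar> = 1 - fst w" using LIMSEQ_unique by blast
  then show thesis using that q(1) lim unfolding s_def by blast
qed

lemma LIMSEQ_of_subsequences:
  assumes "\<And>r :: nat \<Rightarrow> nat. strict_mono r \<Longrightarrow> \<exists>q :: nat \<Rightarrow> nat. (\<lambda>k. z (r (q k))) \<longlonglongrightarrow> l"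
  shows "z \<longlonglongrightarrow> l"
proof (rule ccontr)
  assume "\<not> z \<longlonglongrightarrow> l"
  then obtain S where S: "open S" "l \<in> S" "\<not> (\<forall>\<^sub>F k in sequentially. z k \<in> S)"
    unfolding tendsto_def by blast
  obtain r :: "nat \<Rightarrow> nat" where r: "strict_mono r" "\<And>k. z (r k) \<notin> S"
    using not_eventually_sequentiallyD[OF S(3)] by blast
  obtain q :: "nat \<Rightarrow> nat" where "(\<lambda>k. z (r (q k))) \<longlonglongrightarrow> l" using assms[OF r(1)] by blast
  from topological_tendstoD[OF this S(1,2)] show False using r(2) by simp
qed

text \<open>If the values \<open>x + y\<close> did not converge, rescaling by \<open>1 / (1 + \<bar>x + y\<bar>)\<close> would produce a
  nonzero value over the zero functional.\<close>

lemma nabla_iter_limit: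
  assumes uniq: "\<And>c l. (c, \<lambda>_. 0, l) \<in> nabla_iter p X f (Suc i) \<Longrightarrow> l = 0"
    and "\<And>k::nat. (a k, \<xi> k, x k) \<in> nabla_iter p X f i" "\<And>k. (b k, \<eta> k, y k) \<in> nabla_iter p X f i"
    "\<And>k. components_bounded p (a k) (b k) (\<eta> k) C" "a \<longlonglongrightarrow> c" "b \<longlonglongrightarrow> c" "c \<in> X"
    "\<And>\<kappa>. (\<lambda>k. \<xi> k \<kappa> + \<eta> k \<kappa>) \<longlonglongrightarrow> \<zeta> \<kappa>"
  obtains l where "(\<lambda>k. x k + y k) \<longlonglongrightarrow> l" "(c, \<zeta>, l) \<in> nabla_iter p X f (Suc i)"
proof -
  let ?N = "nabla_iter p X f (Suc i)"
  define z where "z k = x k + y k" for k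
  have cluster: "\<exists>q l. (\<lambda>k. z (r (q k))) \<longlonglongrightarrow> l \<and> (c, \<zeta>, l) \<in> ?N"
    if r: "strict_mono (r :: nat \<Rightarrow> nat)" for r
  proof -
    obtain q t u where q: "strict_mono q" and lim: "(\<lambda>k. 1 / (1 + \<bar>z (r (q k))\<bar>)) \<longlonglongrightarrow> t"
      "(\<lambda>k. 1 / (1 + \<bar>z (r (q k))\<bar>) * z (r (q k))) \<longlonglongrightarrow> u" and u: "\<bar>u\<bar> = 1 - t"
      by (rule normalized_subsequence[of "\<lambda>k. z (r k)"])
    have sub: "filterlim (\<lambda>k. r (q k)) sequentially sequentially"
      using filterlim_subseq[OF strict_mono_o[OF r q]] by (simp add: o_def)
    have mem: "(c, \<lambda>\<kappa>. t * \<zeta> \<kappa>, u) \<in> ?N"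
      by (rule nabla_iter_limit_scaled[OF assms(2,3,4) filterlim_compose[OF assms(5) sub]
            filterlim_compose[OF assms(6) sub] assms(7) filterlim_compose[OF assms(8) sub] _ _ lim(1)])
        (use lim(2) in \<open>auto simp: z_def\<close>)
    have "t \<noteq> 0"
    proof
      assume "t = 0"
      then show False using uniq[of c u] mem u by simp
    qed
    have "(c, \<zeta>, u / t) \<in> ?N"
      using nabla_iter_scale[OF mem, of "1 / t"] \<open>t \<noteq> 0\<close> by simp
    moreover have "(\<lambda>k. z (r (q k))) \<longlonglongrightarrow> u / t"
      using tendsto_divide[OF lim(2,1) \<open>t \<noteq> 0\<close>] by (simp add: add_nonneg_eq_0_iff)
    ultimately show ?thesis by blast
  qed
  obtain l where l: "(c, \<zeta>, l) \<in> ?N" using cluster[of id] by (auto simp: strict_mono_def)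
  have "z \<longlonglongrightarrow> l"
  proof (rule LIMSEQ_of_subsequences)
    fix r :: "nat \<Rightarrow> nat" assume "strict_mono r"
    then obtain q l' where q: "(\<lambda>k. z (r (q k))) \<longlonglongrightarrow> l'" "(c, \<zeta>, l') \<in> ?N" using cluster by blast
    have "l' = l" using uniq[of c "l' - l"] nabla_iter_diff[OF q(2) l] by simp
    then show "\<exists>q. (\<lambda>k. z (r (q k))) \<longlonglongrightarrow> l" using q(1) by blast
  qed
  then show thesis using that l unfolding z_def by blast
qed

subsection \<open>Pulling back by a parametrization\<close>

lemma compact_common_bound:
  fixes F :: "'i \<Rightarrow> 'a::topological_space \<Rightarrow> real"
  assumes "compact B" "finite I" "\<And>i. i \<in> I \<Longrightarrow> continuous_on B (F i)"
  obtains M where "M \<ge> 0" "\<And>i x. i \<in> I \<Longrightarrow> x \<in> B \<Longrightarrow> \<bar>F i x\<bar> \<le> M"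
proof -
  have "continuous_on B (\<lambda>x. \<Sum>i\<in>I. \<bar>F i x\<bar>)" by (intro continuous_intros assms(3))
  then have "bounded ((\<lambda>x. \<Sum>i\<in>I. \<bar>F i x\<bar>) ` B)"
    using assms(1) compact_continuous_image compact_imp_bounded by blast
  then obtain M where M: "M > 0" "\<And>x. x \<in> B \<Longrightarrow> (\<Sum>i\<in>I. \<bar>F i x\<bar>) \<le> M"
    by (force simp: bounded_pos)
  have "\<bar>F i x\<bar> \<le> M" if "i \<in> I" "x \<in> B" for i x
  proof -
    have "\<bar>F i x\<bar> \<le> (\<Sum>i\<in>I. \<bar>F i x\<bar>)" using that(1) assms(2) by (intro member_le_sum) auto
    also have "\<dots> \<le> M" using M(2) that(2) .
    finally show ?thesis .
  qed
  then show thesis using that[of M] M(1) by simp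
qed

lemma Ck_on_increment_bound:
  fixes F :: "real^'n::finite \<Rightarrow> real"
  assumes "open U" "Ck_on (Suc k) U F" "compact B" "convex B" "B \<subseteq> U"
  obtains L where "L \<ge> 0" "\<And>x y. x \<in> B \<Longrightarrow> y \<in> B \<Longrightarrow> \<bar>F x - F y\<bar> \<le> L * dist x y"
proof -
  obtain D where D: "\<And>x. x \<in> U \<Longrightarrow> D (\<lambda>_. 0) x = F x" "derivative_family (Suc k) U D"
    using Ck_on_imp_derivative_family[OF assms(1,2)] by blast
  have "continuous_on B (D (minc i (\<lambda>_. 0)))" for i
    by (rule continuous_on_subset[OF derivative_family_continuous_on[OF D(2)] assms(5)]) simp
  then obtain M where M: "M \<ge> 0" "\<And>i x. x \<in> B \<Longrightarrow> \<bar>D (minc i (\<lambda>_. 0)) x\<bar> \<le> M"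
    using compact_common_bound[OF assms(3) finite_class.finite_UNIV, of "\<lambda>i. D (minc i (\<lambda>_. 0))"]
    by auto
  have "\<bar>F x - F y\<bar> \<le> real CARD('n) * M * dist x y" if "x \<in> B" "y \<in> B" for x y
  proof -
    have "x \<in> U" "y \<in> U" using that assms(5) by auto
    then show ?thesis
      using derivative_family_increment_bound[OF assms(1) D(2), of "\<lambda>_. 0" B y x M]
        that assms(4,5) M(2)
      by (simp add: D(1) dist_norm)
  qed
  then show thesis using that[of "real CARD('n) * M"] M(1) by simp
qed

lemma Ck_on_imp_lipschitz_on:
  fixes h :: "real^'m::finite \<Rightarrow> real^'n::finite"
  assumes "open U" "\<And>j. Ck_on (Suc k) U (\<lambda>y. h y $ j)" "compact B" "convex B" "B \<subseteq> U"
  obtains L where "L-lipschitz_on B h"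
proof -
  have "\<exists>L\<ge>0. \<forall>x\<in>B. \<forall>y\<in>B. \<bar>h x $ j - h y $ j\<bar> \<le> L * dist x y" for j
    using Ck_on_increment_bound[OF assms(1) assms(2)[of j] assms(3-5)] by metis
  then obtain L where L: "\<And>j. L j \<ge> 0"
    "\<And>j x y. x \<in> B \<Longrightarrow> y \<in> B \<Longrightarrow> \<bar>h x $ j - h y $ j\<bar> \<le> L j * dist x y" by metis
  have "(\<Sum>j\<in>UNIV. L j)-lipschitz_on B h"
  proof (rule lipschitz_onI)
    fix x y assume "x \<in> B" "y \<in> B"
    have "dist (h x) (h y) \<le> (\<Sum>j\<in>UNIV. \<bar>(h x - h y) $ j\<bar>)"
      unfolding dist_norm by (rule norm_le_l1_cart)
    also have "\<dots> \<le> (\<Sum>j\<in>UNIV. L j * dist x y)"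
      using L(2) \<open>x \<in> B\<close> \<open>y \<in> B\<close> by (intro sum_mono) simp
    finally show "dist (h x) (h y) \<le> (\<Sum>j\<in>UNIV. L j) * dist x y" by (simp add: sum_distrib_right)
  qed (simp add: L(1) sum_nonneg)
  then show thesis by (rule that)
qed

text \<open>\<open>deriv_functional \<beta> y\<close> sends a polynomial \<open>P\<close> to the \<open>\<beta>\<close>-th derivative of \<open>P \<circ> h\<close> at \<open>y\<close>. The
  map \<open>h\<close> need not be injective.\<close>

locale parametrization =
  fixes p :: nat and W :: "(real^'m::finite) set" and h :: "real^'m \<Rightarrow> real^'n::finite"
  assumes open_W: "open W" and Ck_on_h: "\<And>j. Ck_on p W (\<lambda>y. h y $ j)"
begin

definition monomial_derivs :: "('n \<Rightarrow> nat) \<Rightarrow> ('m \<Rightarrow> nat) \<Rightarrow> real^'m \<Rightarrow> real" where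
  "monomial_derivs \<kappa> = (SOME D. (\<forall>y\<in>W. D (\<lambda>_. 0) y = mpow (h y) \<kappa>) \<and> derivative_family p W D)"

lemma monomial_derivs:
  shows monomial_derivs_zero: "y \<in> W \<Longrightarrow> monomial_derivs \<kappa> (\<lambda>_. 0) y = mpow (h y) \<kappa>"
    and derivative_family_monomial_derivs: "derivative_family p W (monomial_derivs \<kappa>)"
proof -
  have "\<exists>D. (\<forall>y\<in>W. D (\<lambda>_. 0) y = mpow (h y) \<kappa>) \<and> derivative_family p W D"
    using Ck_on_imp_derivative_family[OF open_W Ck_on_mpow[OF open_W Ck_on_h]] by metis
  from someI_ex[OF this, folded monomial_derivs_def]
  show "y \<in> W \<Longrightarrow> monomial_derivs \<kappa> (\<lambda>_. 0) y = mpow (h y) \<kappa>"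
    "derivative_family p W (monomial_derivs \<kappa>)"
    by blast+
qed

definition deriv_functional :: "('m \<Rightarrow> nat) \<Rightarrow> real^'m \<Rightarrow> ('n \<Rightarrow> nat) \<Rightarrow> real" where
  "deriv_functional \<beta> y \<kappa> = (if mdeg \<kappa> \<le> p then monomial_derivs \<kappa> \<beta> y else 0)"

lemma deriv_functional_zero: "y \<in> W \<Longrightarrow> deriv_functional (\<lambda>_. 0) y = pdelta p (h y)"
  by (auto simp: deriv_functional_def pdelta_eq_mpow monomial_derivs_zero)

lemma continuous_on_h: "continuous_on W h"
  by (intro continuous_on_vec_components Ck_on_imp_continuous_on[OF Ck_on_h])

lemma tendsto_h: "y \<in> W \<Longrightarrow> (g \<longlongrightarrow> y) F \<Longrightarrow> ((\<lambda>k. h (g k)) \<longlongrightarrow> h y) F"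
  using continuous_on_h open_W by (simp add: continuous_on_eq_continuous_at isCont_tendsto_compose)

lemma tendsto_deriv_functional:
  assumes "mdeg \<beta> \<le> p" "y \<in> W" "(g \<longlongrightarrow> y) F"
  shows "((\<lambda>k. deriv_functional \<beta> (g k) \<kappa>) \<longlongrightarrow> deriv_functional \<beta> y \<kappa>) F"
  using isCont_tendsto_compose[OF derivative_family_isCont[OF derivative_family_monomial_derivs
        assms(1) open_W assms(2)] assms(3)]
  by (simp add: deriv_functional_def)

lemma deriv_functional_difference_quotient_tendsto:
  assumes "mdeg \<beta> < p" "y \<in> W" "t \<longlonglongrightarrow> 0" "\<And>k. t k \<noteq> 0"
  shows "(\<lambda>k. (deriv_functional \<beta> (y + t k *\<^sub>R axis j 1) \<kappa> - deriv_functional \<beta> y \<kappa>) / t k)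
    \<longlonglongrightarrow> deriv_functional (minc j \<beta>) y \<kappa>"
proof (cases "mdeg \<kappa> \<le> p")
  case True
  have "((\<lambda>s. (monomial_derivs \<kappa> \<beta> (y + s *\<^sub>R axis j 1) - monomial_derivs \<kappa> \<beta> y) / s)
      \<longlongrightarrow> monomial_derivs \<kappa> (minc j \<beta>) y) (at 0)"
    using derivative_family_has_partial[OF derivative_family_monomial_derivs[of \<kappa>] assms(1,2), of j]
    unfolding has_partial_def DERIV_def by simp
  moreover have "filterlim t (at 0) sequentially"
    using assms(3,4) by (intro filterlim_atI always_eventually allI)
  ultimately have "(\<lambda>k. (monomial_derivs \<kappa> \<beta> (y + t k *\<^sub>R axis j 1) - monomial_derivs \<kappa> \<beta> y) / t k)
      \<longlonglongrightarrow> monomial_derivs \<kappa> (minc j \<beta>) y"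
    by (rule filterlim_compose)
  then show ?thesis using True by (simp add: deriv_functional_def)
qed (simp add: deriv_functional_def)

lemma dual_comp_deriv_functional:
  "dual_comp p (deriv_functional \<beta> y) \<alpha> b = (\<Sum>\<kappa>\<in>mindex p. shifted_mono b \<alpha> \<kappa> * monomial_derivs \<kappa> \<beta> y)"
  unfolding dual_comp_def dual_app_def
  by (rule sum.cong) (auto simp: deriv_functional_def mem_mindex)

lemma dual_comp_deriv_functional_eq_0:
  assumes "y \<in> W" "mdeg \<beta> < mdeg \<alpha>" "mdeg \<alpha> \<le> p"
  shows "dual_comp p (deriv_functional \<beta> y) \<alpha> (h y) = 0"
proof -
  define D where "D \<beta> x = (\<Sum>\<kappa>\<in>mindex p. shifted_mono (h y) \<alpha> \<kappa> * monomial_derivs \<kappa> \<beta> x)" for \<beta> x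
  have family: "derivative_family p W D"
    unfolding D_def
    by (intro derivative_familyI continuous_intros has_partial_sum has_partial_cmult
        derivative_family_continuous_on[OF derivative_family_monomial_derivs]
        derivative_family_has_partial[OF derivative_family_monomial_derivs])
  have "vanishes_to_order (mdeg \<alpha>) y (\<lambda>x. divided_power \<alpha> (h x - h y))"
    by (rule vanishes_to_order_divided_power[OF open_W assms(1) Ck_on_h assms(3)])
  then have "vanishes_to_order (mdeg \<alpha>) y (D (\<lambda>_. 0))"
    by (rule vanishes_to_order_cong[OF open_W assms(1), rotated])
      (simp add: D_def monomial_derivs_zero shifted_mono_eval[OF assms(3)])
  then have "vanishes_to_order (mdeg \<alpha> - mdeg \<beta>) y (D \<beta>)"
    by (rule derivative_family_vanishes_to_order[OF open_W assms(1) family]) (use assms in simp)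
  moreover obtain n where "mdeg \<alpha> - mdeg \<beta> = Suc n" using assms(2) by (metis Suc_diff_Suc)
  ultimately have "D \<beta> y = 0" by simp
  then show ?thesis by (simp add: dual_comp_deriv_functional D_def)
qed

lemma dual_comp_deriv_functional_bounded:
  assumes "compact B" "B \<subseteq> W" "mdeg \<beta> \<le> p"
  obtains M where "M \<ge> 0"
    "\<And>\<alpha> y. mdeg \<alpha> \<le> p \<Longrightarrow> y \<in> B \<Longrightarrow> \<bar>dual_comp p (deriv_functional \<beta> y) \<alpha> (h y)\<bar> \<le> M"
proof -
  have "continuous_on B (\<lambda>y. dual_comp p (deriv_functional \<beta> y) \<alpha> (h y))" for \<alpha>
    unfolding continuous_on_def
    using assms
    by (intro ballI tendsto_dual_comp tendsto_h tendsto_deriv_functional tendsto_ident_at) auto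
  then show thesis
    using compact_common_bound[OF assms(1) finite_mindex,
        of p "\<lambda>\<alpha> y. dual_comp p (deriv_functional \<beta> y) \<alpha> (h y)"] that
    by (auto simp: mem_mindex)
qed

lemma dist_h_power_le:
  assumes "compact B" "convex B" "B \<subseteq> W"
  obtains L where "L \<ge> 1" "\<And>x y k. x \<in> B \<Longrightarrow> y \<in> B \<Longrightarrow> k \<le> p \<Longrightarrow> dist (h x) (h y) ^ k \<le> L * dist x y ^ k"
proof (cases p)
  case 0
  then show thesis using that[of 1] by simp
next
  case (Suc k)
  obtain C where C: "C-lipschitz_on B h"
    using Ck_on_imp_lipschitz_on[OF open_W Ck_on_h[unfolded Suc] assms] .
  define L where "L = max 1 C"
  have "dist (h x) (h y) ^ k \<le> L ^ p * dist x y ^ k" if "x \<in> B" "y \<in> B" "k \<le> p" for x y k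
  proof -
    have "dist (h x) (h y) \<le> L * dist x y"
      using lipschitz_onD[OF C that(1,2)] mult_right_mono[of C L "dist x y"] by (simp add: L_def)
    then have "dist (h x) (h y) ^ k \<le> (L * dist x y) ^ k" by (rule power_mono) simp
    also have "\<dots> \<le> L ^ p * dist x y ^ k"
      unfolding power_mult_distrib using that(3)
      by (intro mult_right_mono power_increasing) (auto simp: L_def)
    finally show ?thesis .
  qed
  then show thesis using that[of "L ^ p"] by (simp add: L_def)
qed

lemma components_bounded_deriv_functional:
  assumes B: "compact B" "convex B" "B \<subseteq> W" and \<beta>: "mdeg \<beta> \<le> p"
  obtains C where "\<And>y y' s. y \<in> B \<Longrightarrow> y' \<in> B \<Longrightarrow> \<bar>s\<bar> * dist y y' ^ (p - mdeg \<beta>) \<le> 1 \<Longrightarrow>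
    components_bounded p (h y) (h y') (\<lambda>\<kappa>. s * deriv_functional \<beta> y' \<kappa>) C"
proof -
  obtain L where L: "L \<ge> 1"
    "\<And>x y k. x \<in> B \<Longrightarrow> y \<in> B \<Longrightarrow> k \<le> p \<Longrightarrow> dist (h x) (h y) ^ k \<le> L * dist x y ^ k"
    using dist_h_power_le[OF B] by blast
  obtain M where M: "M \<ge> 0"
    "\<And>\<alpha> y. mdeg \<alpha> \<le> p \<Longrightarrow> y \<in> B \<Longrightarrow> \<bar>dual_comp p (deriv_functional \<beta> y) \<alpha> (h y)\<bar> \<le> M"
    using dual_comp_deriv_functional_bounded[OF B(1,3) \<beta>] by blast
  define R where "R = diameter B + 1"
  have R: "R \<ge> 1" using diameter_ge_0[OF compact_imp_bounded[OF B(1)]] by (simp add: R_def)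
  show thesis
  proof (rule that, unfold components_bounded_def dual_comp_scale abs_mult, intro allI impI)
    fix y y' s and \<alpha> :: "'n \<Rightarrow> nat"
    assume y: "y \<in> B" "y' \<in> B" and s: "\<bar>s\<bar> * dist y y' ^ (p - mdeg \<beta>) \<le> 1" and \<alpha>: "mdeg \<alpha> \<le> p"
    define t where "t = dist y y'"
    have t: "0 \<le> t" "t \<le> R"
      using diameter_bounded_bound[OF compact_imp_bounded[OF B(1)] y] by (auto simp: t_def R_def)
    show "dist (h y) (h y') ^ (p - mdeg \<alpha>) * (\<bar>s\<bar> * \<bar>dual_comp p (deriv_functional \<beta> y') \<alpha> (h y')\<bar>)
        \<le> L * M * R ^ p"
    proof (cases "mdeg \<beta> < mdeg \<alpha>")
      case True
      then have "dual_comp p (deriv_functional \<beta> y') \<alpha> (h y') = 0"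
        using dual_comp_deriv_functional_eq_0 y(2) B(3) \<alpha> by blast
      then show ?thesis using L(1) M(1) R by simp
    next
      case False
      have "dist (h y) (h y') ^ (p - mdeg \<alpha>) * (\<bar>s\<bar> * \<bar>dual_comp p (deriv_functional \<beta> y') \<alpha> (h y')\<bar>)
          \<le> (L * t ^ (p - mdeg \<alpha>)) * (\<bar>s\<bar> * M)"
        unfolding t_def using L y M(2)[OF \<alpha> y(2)] by (intro mult_mono) auto
      also have "t ^ (p - mdeg \<alpha>) = t ^ (p - mdeg \<beta>) * t ^ (mdeg \<beta> - mdeg \<alpha>)"
        using False \<beta> by (simp flip: power_add)
      also have "(L * \<dots>) * (\<bar>s\<bar> * M) = L * M * ((\<bar>s\<bar> * t ^ (p - mdeg \<beta>)) * t ^ (mdeg \<beta> - mdeg \<alpha>))"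
        by (simp add: mult_ac)
      also have "\<dots> \<le> L * M * (1 * R ^ p)"
      proof (intro mult_left_mono mult_mono)
        show "\<bar>s\<bar> * t ^ (p - mdeg \<beta>) \<le> 1" using s by (simp add: t_def)
        have "t ^ (mdeg \<beta> - mdeg \<alpha>) \<le> R ^ (mdeg \<beta> - mdeg \<alpha>)" using t by (intro power_mono) auto
        also have "\<dots> \<le> R ^ p" using R \<beta> by (intro power_increasing) auto
        finally show "t ^ (mdeg \<beta> - mdeg \<alpha>) \<le> R ^ p" .
      qed (use L M t in auto)
      finally show ?thesis by simp
    qed
  qed
qed

end

lemma scaled_taylor_remainder_eq:
  "s * taylor_remainder p g x \<beta> y =
    (\<Sum>\<gamma>\<in>mindex (p - mdeg \<beta>). (- s * divided_power \<gamma> (y - x)) * g (\<lambda>i. \<beta> i + \<gamma> i) x) + s * g \<beta> y"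
  by (simp add: taylor_remainder_def taylor_poly_def right_diff_distrib sum_distrib_left sum_negf mult_ac)

locale nabla_parametrization = parametrization p W h
  for p :: nat and W :: "(real^'m::finite) set" and h :: "real^'m \<Rightarrow> real^'n::finite" +
  fixes X :: "(real^'n) set" and f :: "real^'n \<Rightarrow> real"
  assumes value_over_zero: "\<And>c l. (c, \<lambda>_. 0, l) \<in> nabla_iter p X f (p + 2) \<Longrightarrow> l = 0"
    and regular: "W \<inter> h -` X \<subseteq> closure (interior (W \<inter> h -` X))"
begin

definition preimage :: "(real^'m) set" where "preimage = W \<inter> h -` X"

lemma mem_preimage: "y \<in> preimage \<longleftrightarrow> y \<in> W \<and> h y \<in> X"
  by (simp add: preimage_def)

lemma value_over_zero_le: "i \<le> p + 2 \<Longrightarrow> (c, \<lambda>_. 0, l) \<in> nabla_iter p X f i \<Longrightarrow> l = 0"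
  using nabla_iter_mono[of i "p + 2" p X f] value_over_zero by blast

lemma nabla_iter_unique:
  assumes "i \<le> p + 2" "(c, \<xi>, l) \<in> nabla_iter p X f i" "(c, \<xi>, m) \<in> nabla_iter p X f i"
  shows "l = m"
  using value_over_zero_le[OF assms(1), of c "l - m"] nabla_iter_diff[OF assms(2,3)] by simp

lemma nabla_iter_limit_le:
  assumes "Suc i \<le> p + 2"
    and "\<And>k::nat. (a k, \<xi> k, x k) \<in> nabla_iter p X f i" "\<And>k. (b k, \<eta> k, y k) \<in> nabla_iter p X f i"
    "\<And>k. components_bounded p (a k) (b k) (\<eta> k) C" "a \<longlonglongrightarrow> c" "b \<longlonglongrightarrow> c" "c \<in> X"
    "\<And>\<kappa>. (\<lambda>k. \<xi> k \<kappa> + \<eta> k \<kappa>) \<longlonglongrightarrow> \<zeta> \<kappa>"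
  obtains l where "(\<lambda>k. x k + y k) \<longlonglongrightarrow> l" "(c, \<zeta>, l) \<in> nabla_iter p X f (Suc i)"
  using nabla_iter_limit[OF value_over_zero_le[OF assms(1)] assms(2-)] .

lemma deriv_functional_zero_mem:
  "y \<in> preimage \<Longrightarrow> (h y, deriv_functional (\<lambda>_. 0) y, f (h y)) \<in> nabla_iter p X f 0"
  using nabla_iter_pdelta[of "h y" X p f] by (simp add: deriv_functional_zero mem_preimage)

lemma deriv_functional_minc_mem:
  assumes y: "y \<in> interior preimage" and \<beta>: "mdeg \<beta> < p" and i: "i \<le> p"
    and mem: "\<And>y. y \<in> interior preimage \<Longrightarrow> \<exists>l. (h y, deriv_functional \<beta> y, l) \<in> nabla_iter p X f i"
  shows "\<exists>l. (h y, deriv_functional (minc j \<beta>) y, l) \<in> nabla_iter p X f (Suc i)"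
proof -
  obtain r0 where "r0 > 0" "cball y r0 \<subseteq> interior preimage"
    using y open_contains_cball[of "interior preimage"] by auto
  moreover define r where "r = min r0 1"
  ultimately have r: "r > 0" "r \<le> 1" "cball y r \<subseteq> interior preimage" by auto
  have ball_W: "cball y r \<subseteq> W" and y_mem: "y \<in> W" "h y \<in> X"
    using r(3) y interior_subset[of preimage] by (auto simp: mem_preimage)
  define t where "t k = r * inverse (real (Suc k))" for k
  have t: "t k > 0" "t k \<le> r" for k using r(1) by (auto simp: t_def field_simps)
  have t_lim: "t \<longlonglongrightarrow> 0"
    unfolding t_def by (rule tendsto_mult_right_zero[OF LIMSEQ_inverse_real_of_nat])
  define v where "v k = y + t k *\<^sub>R axis j 1" for k
  have v: "v k \<in> cball y r" "dist y (v k) = t k" for k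
    using t[of k] by (auto simp: v_def dist_norm)
  have "v \<longlonglongrightarrow> y + 0 *\<^sub>R axis j 1" unfolding v_def by (intro tendsto_intros t_lim)
  then have hv_lim: "(\<lambda>k. h (v k)) \<longlonglongrightarrow> h y" using tendsto_h[OF y_mem(1)] by simp
  obtain l_y where l_y: "(h y, deriv_functional \<beta> y, l_y) \<in> nabla_iter p X f i"
    using mem[OF y] by blast
  have "\<exists>l. (h (v k), deriv_functional \<beta> (v k), l) \<in> nabla_iter p X f i" for k
    using mem[OF subsetD[OF r(3) v(1)]] .
  then obtain l where l: "\<And>k. (h (v k), deriv_functional \<beta> (v k), l k) \<in> nabla_iter p X f i"
    by metis
  obtain C where C: "\<And>y1 y2 s. y1 \<in> cball y r \<Longrightarrow> y2 \<in> cball y r \<Longrightarrow>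
      \<bar>s\<bar> * dist y1 y2 ^ (p - mdeg \<beta>) \<le> 1 \<Longrightarrow>
      components_bounded p (h y1) (h y2) (\<lambda>\<kappa>. s * deriv_functional \<beta> y2 \<kappa>) C"
    using components_bounded_deriv_functional[OF compact_cball convex_cball ball_W less_imp_le[OF \<beta>]] by blast
  have bounded: "components_bounded p (h y) (h (v k)) (\<lambda>\<kappa>. 1 / t k * deriv_functional \<beta> (v k) \<kappa>) C"
    for k
  proof (rule C)
    have "t k ^ (p - mdeg \<beta>) \<le> t k ^ 1"
      using t[of k] r \<beta> by (intro power_decreasing) auto
    then show "\<bar>1 / t k\<bar> * dist y (v k) ^ (p - mdeg \<beta>) \<le> 1"
      using t[of k] v(2)[of k] by (simp add: field_simps)
  qed (use v r in auto)
  have quotient_lim: "(\<lambda>k. - (1 / t k) * deriv_functional \<beta> y \<kappa> + 1 / t k * deriv_functional \<beta> (v k) \<kappa>)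
      \<longlonglongrightarrow> deriv_functional (minc j \<beta>) y \<kappa>" for \<kappa>
    using deriv_functional_difference_quotient_tendsto[OF \<beta> y_mem(1) t_lim, of j \<kappa>] t(1)
    by (simp add: v_def diff_divide_distrib less_imp_neq[symmetric])
  have "Suc i \<le> p + 2" using i by simp
  from nabla_iter_limit_le[OF this nabla_iter_scale[OF l_y] nabla_iter_scale[OF l]
      bounded tendsto_const hv_lim y_mem(2) quotient_lim]
  show ?thesis by blast
qed

lemma deriv_functional_mem_interior:
  assumes "i \<le> p"
  shows "y \<in> interior preimage \<Longrightarrow> mdeg \<beta> \<le> i \<Longrightarrow> \<exists>l. (h y, deriv_functional \<beta> y, l) \<in> nabla_iter p X f i"
  using assms
proof (induction i arbitrary: y \<beta>)
  case 0
  then have "\<beta> = (\<lambda>_. 0)" "y \<in> preimage" using interior_subset by auto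
  then show ?case using deriv_functional_zero_mem by blast
next
  case (Suc i)
  show ?case
  proof (cases "mdeg \<beta> \<le> i")
    case True
    then show ?thesis
      using Suc nabla_iter_mono[of i "Suc i" p X f] by (meson Suc_leD le_SucI order_refl subsetD)
  next
    case False
    then obtain \<gamma> j where "\<beta> = minc j \<gamma>" "mdeg \<gamma> = i"
      using mdeg_SucE[of \<beta> i] Suc.prems(2) by (metis le_antisym not_less_eq_eq)
    then show ?thesis using deriv_functional_minc_mem[OF Suc.prems(1), of \<gamma> i j] Suc by simp
  qed
qed

lemma deriv_functional_mem:
  assumes "y \<in> preimage" "mdeg \<beta> \<le> p"
  shows "\<exists>l. (h y, deriv_functional \<beta> y, l) \<in> nabla_iter p X f (Suc p)"
proof -
  have y: "y \<in> W" "h y \<in> X" using assms(1) by (auto simp: mem_preimage)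
  obtain v where v: "\<And>k. v k \<in> interior preimage" "v \<longlonglongrightarrow> y"
    using subsetD[OF regular[folded preimage_def] assms(1)] unfolding closure_sequential by blast
  obtain l where l: "\<And>k. (h (v k), deriv_functional \<beta> (v k), l k) \<in> nabla_iter p X f p"
    using deriv_functional_mem_interior[OF order_refl v(1) assms(2)] by metis
  have zero: "(h (v k), \<lambda>_. 0, 0) \<in> nabla_iter p X f p" for k
    using l nabla_iter_base nabla_iter_zero by blast
  have "(\<lambda>k. deriv_functional \<beta> (v k) \<kappa> + 0) \<longlonglongrightarrow> deriv_functional \<beta> y \<kappa>" for \<kappa>
    using tendsto_deriv_functional[OF assms(2) y(1) v(2)] by simp
  then show ?thesis
    using nabla_iter_limit_le[OF _ l zero components_bounded_zero[OF zero_le_one]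
        tendsto_h[OF y(1) v(2)] tendsto_h[OF y(1) v(2)] y(2)] by fastforce
qed

definition pullback_jet :: "('m \<Rightarrow> nat) \<Rightarrow> real^'m \<Rightarrow> real" where
  "pullback_jet \<beta> y = (SOME l. (h y, deriv_functional \<beta> y, l) \<in> nabla_iter p X f (Suc p))"

lemma pullback_jet_mem:
  "y \<in> preimage \<Longrightarrow> mdeg \<beta> \<le> p \<Longrightarrow> (h y, deriv_functional \<beta> y, pullback_jet \<beta> y) \<in> nabla_iter p X f (Suc p)"
  unfolding pullback_jet_def by (rule someI_ex) (rule deriv_functional_mem)

lemma pullback_jet_zero:
  assumes "y \<in> preimage"
  shows "pullback_jet (\<lambda>_. 0) y = f (h y)"
proof -
  have "(h y, deriv_functional (\<lambda>_. 0) y, f (h y)) \<in> nabla_iter p X f (Suc p)"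
    using deriv_functional_zero_mem[OF assms] nabla_iter_mono[of 0 "Suc p" p X f] by blast
  then show ?thesis using nabla_iter_unique[OF _ pullback_jet_mem[OF assms]] by simp
qed

lemma pullback_jet_remainder_tendsto:
  assumes B: "compact B" "convex B" "B \<subseteq> W" and \<beta>: "mdeg \<beta> \<le> p"
    and mem: "\<And>k. x k \<in> B \<inter> h -` X" "\<And>k. y k \<in> B \<inter> h -` X" and "\<And>k. x k \<noteq> y k"
    and lim: "x \<longlonglongrightarrow> c" "y \<longlonglongrightarrow> c" and "c \<in> preimage"
  shows "(\<lambda>k. taylor_remainder p pullback_jet (x k) \<beta> (y k) / dist (x k) (y k) ^ (p - mdeg \<beta>)) \<longlonglongrightarrow> 0"
proof -
  define s where "s k = 1 / dist (x k) (y k) ^ (p - mdeg \<beta>)" for k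
  have mem_preimage': "x k \<in> preimage" "y k \<in> preimage" for k
    using mem B(3) by (auto simp: mem_preimage)
  define a where "a k \<gamma> = - s k * divided_power \<gamma> (y k - x k)" for k \<gamma>
  let ?I = "mindex (p - mdeg \<beta>) :: ('m \<Rightarrow> nat) set"
  have index: "mdeg (\<lambda>i. \<beta> i + \<gamma> i) \<le> p" if "\<gamma> \<in> ?I" for \<gamma>
    using that \<beta> by (simp add: mem_mindex mdeg_add)
  have base: "(h (x k), \<lambda>\<kappa>. \<Sum>\<gamma>\<in>?I. a k \<gamma> * deriv_functional (\<lambda>i. \<beta> i + \<gamma> i) (x k) \<kappa>,
      \<Sum>\<gamma>\<in>?I. a k \<gamma> * pullback_jet (\<lambda>i. \<beta> i + \<gamma> i) (x k)) \<in> nabla_iter p X f (Suc p)" for k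
    using mem_preimage'(1)[of k] index
    by (intro nabla_iter_sum pullback_jet_mem) (auto simp: mem_preimage)
  obtain C where C: "\<And>y1 y2 s. y1 \<in> B \<Longrightarrow> y2 \<in> B \<Longrightarrow> \<bar>s\<bar> * dist y1 y2 ^ (p - mdeg \<beta>) \<le> 1 \<Longrightarrow>
      components_bounded p (h y1) (h y2) (\<lambda>\<kappa>. s * deriv_functional \<beta> y2 \<kappa>) C"
    using components_bounded_deriv_functional[OF B \<beta>] by blast
  have bounded: "components_bounded p (h (x k)) (h (y k)) (\<lambda>\<kappa>. s k * deriv_functional \<beta> (y k) \<kappa>) C"
    for k
    using mem[of k] assms(7)[of k] by (intro C) (auto simp: s_def)
  have functional_lim: "(\<lambda>k. (\<Sum>\<gamma>\<in>?I. a k \<gamma> * deriv_functional (\<lambda>i. \<beta> i + \<gamma> i) (x k) \<kappa>) +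
      s k * deriv_functional \<beta> (y k) \<kappa>) \<longlonglongrightarrow> 0" for \<kappa>
  proof (cases "mdeg \<kappa> \<le> p")
    case True
    have "whitney_jet p B (monomial_derivs \<kappa>)"
      by (rule derivative_family_imp_whitney_jet[OF open_W derivative_family_monomial_derivs B])
    moreover have "(\<lambda>k. dist (x k) (y k)) \<longlonglongrightarrow> 0" using tendsto_dist[OF lim] by simp
    moreover have "\<forall>\<^sub>F k in sequentially. x k \<in> B \<and> y k \<in> B" using mem by simp
    ultimately have "(\<lambda>k. taylor_remainder p (monomial_derivs \<kappa>) (x k) \<beta> (y k) /
        dist (x k) (y k) ^ (p - mdeg \<beta>)) \<longlonglongrightarrow> 0"
      using whitney_jet_remainder_tendsto[OF _ \<beta>] by blast
    then have "(\<lambda>k. s k * taylor_remainder p (monomial_derivs \<kappa>) (x k) \<beta> (y k)) \<longlonglongrightarrow> 0"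
      by (simp add: s_def)
    then show ?thesis
      using True unfolding scaled_taylor_remainder_eq deriv_functional_def a_def by simp
  qed (simp add: deriv_functional_def)
  have c: "c \<in> W" "h c \<in> X" using \<open>c \<in> preimage\<close> by (auto simp: mem_preimage)
  obtain l where l: "(\<lambda>k. (\<Sum>\<gamma>\<in>?I. a k \<gamma> * pullback_jet (\<lambda>i. \<beta> i + \<gamma> i) (x k)) +
      s k * pullback_jet \<beta> (y k)) \<longlonglongrightarrow> l" "(h c, \<lambda>_. 0, l) \<in> nabla_iter p X f (Suc (Suc p))"
    by (rule nabla_iter_limit_le[OF _ base
          nabla_iter_scale[OF pullback_jet_mem[OF mem_preimage'(2) \<beta>]] bounded
          tendsto_h[OF c(1) lim(1)] tendsto_h[OF c(1) lim(2)] c(2) functional_lim]) simp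
  then have "l = 0" using value_over_zero_le[OF _ l(2)] by simp
  then have "(\<lambda>k. s k * taylor_remainder p pullback_jet (x k) \<beta> (y k)) \<longlonglongrightarrow> 0"
    using l(1) unfolding scaled_taylor_remainder_eq a_def by simp
  then show ?thesis by (simp add: s_def)
qed

theorem extension_on_compact_convex:
  assumes B: "compact B" "convex B" "B \<subseteq> W" and "closed X"
  obtains F where "Ck_on p UNIV F" "\<And>y. y \<in> B \<Longrightarrow> h y \<in> X \<Longrightarrow> F y = f (h y)"
proof -
  have "closed (B \<inter> h -` X)"
    using continuous_on_subset[OF continuous_on_h B(3)] compact_imp_closed[OF B(1)] assms(4)
    by (rule continuous_closed_preimage)
  then have compact: "compact (B \<inter> h -` X)"
    using compact_Int_closed[OF B(1)] by (metis Int_assoc inf.idem)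
  have "whitney_jet p (B \<inter> h -` X) pullback_jet"
    by (rule whitney_jetI_sequentially[OF compact], rule pullback_jet_remainder_tendsto[OF B])
      (use B(3) in \<open>auto simp: image_subset_iff mem_preimage\<close>)
  then obtain F where F: "Cp_on p UNIV F" "\<And>y. y \<in> B \<inter> h -` X \<Longrightarrow> F y = pullback_jet (\<lambda>_. 0) y"
    using whitney_extension[OF compact] by blast
  have "Ck_on p UNIV F" using F(1) Cp_on_iff_Ck_on[OF open_UNIV] by blast
  moreover have "F y = f (h y)" if "y \<in> B" "h y \<in> X" for y
    using F(2)[of y] pullback_jet_zero[of y] that B(3) by (auto simp: mem_preimage)
  ultimately show thesis by (rule that)
qed

end

subsection \<open>Charts\<close>

lemma subspace_projection:
  fixes L :: "'a::euclidean_space set"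
  assumes "subspace L"
  obtains \<pi> :: "'a \<Rightarrow> 'a" where "linear \<pi>" "range \<pi> \<subseteq> L" "\<And>v. v \<in> L \<Longrightarrow> \<pi> v = v"
  using linear_exists_left_inverse_on[OF linear_id assms, of] that by auto

lemma Cp_diffeoE:
  assumes "Cp_diffeo p U V \<phi>"
  obtains \<psi> where "open U" "open V" "\<And>j. Ck_on p U (\<lambda>x. \<phi> x $ j)" "\<And>j. Ck_on p V (\<lambda>x. \<psi> x $ j)"
    "\<And>x. x \<in> U \<Longrightarrow> \<psi> (\<phi> x) = x"
proof -
  have U: "open U" "open V" "Cp_map_on p U \<phi>" using assms unfolding Cp_diffeo_def by blast+
  obtain \<psi> where "Cp_map_on p V \<psi>" "\<And>x. x \<in> U \<Longrightarrow> \<psi> (\<phi> x) = x"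
    using assms unfolding Cp_diffeo_def by blast
  then show thesis using that[of \<psi>] U Cp_on_iff_Ck_on unfolding Cp_map_on_def by blast
qed

text \<open>The parametrization \<open>h\<close> is a chart inverse composed with a linear projection onto the model
  subspace; moving along that subspace lifts points of \<open>M\<close> near \<open>h y\<close> to points near \<open>y\<close>.\<close>

lemma Cp_submanifold_parametrization:
  fixes M :: "(real^'n::finite) set"
  assumes "Cp_submanifold p M" "m \<in> M"
  obtains U W and \<phi> h :: "real^'n \<Rightarrow> real^'n" where "open U" "m \<in> U" "open W"
    "\<And>j. Ck_on p U (\<lambda>x. \<phi> x $ j)" "\<And>j. Ck_on p W (\<lambda>y. h y $ j)"
    "\<And>x. x \<in> M \<inter> U \<Longrightarrow> \<phi> x \<in> W \<and> h (\<phi> x) = x" "\<And>y. y \<in> W \<Longrightarrow> h y \<in> M \<inter> U"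
    "\<And>x y. x \<in> M \<inter> U \<Longrightarrow> y \<in> W \<Longrightarrow> \<exists>z\<in>W. h z = x \<and> dist z y = dist (\<phi> x) (\<phi> (h y))"
proof -
  obtain U V \<phi> L where U: "m \<in> U" "Cp_diffeo p U V \<phi>" and "subspace L"
    and image: "\<phi> ` (M \<inter> U) = V \<inter> L"
    using assms unfolding Cp_submanifold_def by blast
  obtain \<psi> where \<psi>: "open U" "open V" "\<And>j. Ck_on p U (\<lambda>x. \<phi> x $ j)" "\<And>j. Ck_on p V (\<lambda>x. \<psi> x $ j)"
    "\<And>x. x \<in> U \<Longrightarrow> \<psi> (\<phi> x) = x"
    using Cp_diffeoE[OF U(2)] by blast
  obtain \<pi> where \<pi>: "linear \<pi>" "range \<pi> \<subseteq> L" "\<And>v. v \<in> L \<Longrightarrow> \<pi> v = v"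
    using subspace_projection[OF \<open>subspace L\<close>] by blast
  have bounded_\<pi>: "bounded_linear \<pi>" using \<pi>(1) by (simp add: linear_linear)
  have open_W: "open (\<pi> -` V)"
    using \<psi>(2) by (rule open_vimage) (rule linear_continuous_on[OF bounded_\<pi>])
  have smooth: "Ck_on p (\<pi> -` V) (\<lambda>y. \<psi> (\<pi> y) $ j)" for j
  proof (rule Ck_on_compose[OF open_W \<psi>(2) _ \<psi>(4)])
    show "Ck_on p (\<pi> -` V) (\<lambda>x. \<pi> x $ j)" for j
      by (rule Ck_on_subset[OF Ck_on_bounded_linear subset_UNIV])
        (rule bounded_linear_compose[OF bounded_linear_vec_nth bounded_\<pi>])
  qed auto
  have \<phi>_mem: "\<phi> x \<in> V" "\<pi> (\<phi> x) = \<phi> x" if "x \<in> M \<inter> U" for x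
    using imageI[OF that, of \<phi>] \<pi>(3) unfolding image by auto
  have h_mem: "\<psi> (\<pi> y) \<in> M \<inter> U" "\<phi> (\<psi> (\<pi> y)) = \<pi> y" if "\<pi> y \<in> V" for y
  proof -
    have "\<pi> y \<in> \<phi> ` (M \<inter> U)" using that \<pi>(2) image by auto
    then obtain x where "x \<in> M \<inter> U" "\<pi> y = \<phi> x" by blast
    then show "\<psi> (\<pi> y) \<in> M \<inter> U" "\<phi> (\<psi> (\<pi> y)) = \<pi> y" using \<psi>(5) by auto
  qed
  have lift: "\<exists>z\<in>\<pi> -` V. \<psi> (\<pi> z) = x \<and> dist z y = dist (\<phi> x) (\<phi> (\<psi> (\<pi> y)))"
    if "x \<in> M \<inter> U" "y \<in> \<pi> -` V" for x y
  proof (rule bexI[of _ "y - \<pi> y + \<phi> x"])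
    have "\<pi> (\<pi> y) = \<pi> y" using \<pi>(2) by (intro \<pi>(3)) auto
    then have \<pi>_z: "\<pi> (y - \<pi> y + \<phi> x) = \<phi> x"
      using \<phi>_mem[OF that(1)] by (simp add: linear_add[OF \<pi>(1)] linear_diff[OF \<pi>(1)])
    then show "y - \<pi> y + \<phi> x \<in> \<pi> -` V" using \<phi>_mem[OF that(1)] by simp
    show "\<psi> (\<pi> (y - \<pi> y + \<phi> x)) = x \<and> dist (y - \<pi> y + \<phi> x) y = dist (\<phi> x) (\<phi> (\<psi> (\<pi> y)))"
      unfolding \<pi>_z using that \<psi>(5) h_mem by (simp add: dist_norm)
  qed
  show thesis
    by (rule that[of U "\<pi> -` V" \<phi> "\<lambda>y. \<psi> (\<pi> y)"])
      (use U(1) \<psi> open_W smooth \<phi>_mem h_mem lift in auto)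
qed

lemma preimage_subset_closure_interior:
  fixes X M :: "'a::metric_space set" and h :: "'b::metric_space \<Rightarrow> 'a" and \<phi> :: "'a \<Rightarrow> 'b"
  assumes regular: "X = (top_of_set M) closure_of ((top_of_set M) interior_of X)"
    and "open U" "continuous_on U \<phi>" "open W" "continuous_on W h"
    and h_mem: "\<And>y. y \<in> W \<Longrightarrow> h y \<in> M \<inter> U"
    and lift: "\<And>x y. x \<in> M \<inter> U \<Longrightarrow> y \<in> W \<Longrightarrow> \<exists>z\<in>W. h z = x \<and> dist z y = dist (\<phi> x) (\<phi> (h y))"
  shows "W \<inter> h -` X \<subseteq> closure (interior (W \<inter> h -` X))"
proof
  let ?Z = "W \<inter> h -` X"
  obtain T where T: "open T" "(top_of_set M) interior_of X = M \<inter> T"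
    using openin_interior_of[of "top_of_set M" X] unfolding openin_open by blast
  have "M \<inter> T \<subseteq> X" using T(2) interior_of_subset by metis
  then have "W \<inter> h -` T \<subseteq> ?Z" using h_mem by auto
  then have interior: "W \<inter> h -` T \<subseteq> interior ?Z"
    using continuous_open_preimage[OF assms(5,4) T(1)] by (intro interior_maximal)
  fix y assume y: "y \<in> ?Z"
  show "y \<in> closure (interior ?Z)"
    unfolding closure_approachable
  proof (intro allI impI)
    fix e :: real assume "e > 0"
    let ?A = "U \<inter> \<phi> -` ball (\<phi> (h y)) e"
    have "open ?A" by (rule continuous_open_preimage[OF assms(3,2) open_ball])
    moreover have "h y \<in> ?A" "h y \<in> M" using h_mem y \<open>e > 0\<close> by auto
    moreover have "h y \<in> (top_of_set M) closure_of ((top_of_set M) interior_of X)"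
      using y regular by blast
    ultimately obtain x where x: "x \<in> M \<inter> T" "x \<in> M \<inter> ?A"
      unfolding in_closure_of T(2) by (metis IntI openin_open_Int)
    then obtain z where z: "z \<in> W" "h z = x" "dist z y = dist (\<phi> x) (\<phi> (h y))"
      using lift[of x y] y by blast
    then have "z \<in> interior ?Z" using interior x(1) by blast
    moreover have "dist z y < e" using z(3) x(2) by (simp add: dist_commute)
    ultimately show "\<exists>z\<in>interior ?Z. dist z y < e" by blast
  qed
qed

lemma Ck_on_extension_near:
  fixes X M :: "(real^'n::finite) set"
  assumes "closed X" "X \<subseteq> M" "Cp_submanifold p M"
    and "X = (top_of_set M) closure_of ((top_of_set M) interior_of X)"
    and value_over_zero: "\<And>c l. (c, \<lambda>_. 0, l) \<in> nabla_iter p X f (p + 2) \<Longrightarrow> l = 0" and "m \<in> X"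
  shows "\<exists>U F. open U \<and> m \<in> U \<and> Ck_on p U F \<and> (\<forall>x\<in>X \<inter> U. F x = f x)"
proof -
  obtain U W and \<phi> h :: "real^'n \<Rightarrow> real^'n" where U: "open U" "m \<in> U" "open W"
    and smooth: "\<And>j. Ck_on p U (\<lambda>x. \<phi> x $ j)" "\<And>j. Ck_on p W (\<lambda>y. h y $ j)"
    and chart: "\<And>x. x \<in> M \<inter> U \<Longrightarrow> \<phi> x \<in> W \<and> h (\<phi> x) = x" "\<And>y. y \<in> W \<Longrightarrow> h y \<in> M \<inter> U"
      "\<And>x y. x \<in> M \<inter> U \<Longrightarrow> y \<in> W \<Longrightarrow> \<exists>z\<in>W. h z = x \<and> dist z y = dist (\<phi> x) (\<phi> (h y))"
    by (rule Cp_submanifold_parametrization[OF assms(3) subsetD[OF assms(2,6)]])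
      (rule that, assumption+)
  have cont: "continuous_on U \<phi>" "continuous_on W h"
    using smooth by (auto intro: continuous_on_vec_components Ck_on_imp_continuous_on)
  interpret nabla_parametrization p W h X f
    by unfold_locales (use U smooth value_over_zero
      preimage_subset_closure_interior[OF assms(4) U(1) cont(1) U(3) cont(2) chart(2,3)] in auto)
  have "\<phi> m \<in> W" using chart(1) assms(2,6) U(2) by blast
  then obtain r where r: "r > 0" "cball (\<phi> m) r \<subseteq> W" using U(3) open_contains_cball by blast
  obtain F where F: "Ck_on p UNIV F" "\<And>y. y \<in> cball (\<phi> m) r \<Longrightarrow> h y \<in> X \<Longrightarrow> F y = f (h y)"
    using extension_on_compact_convex[OF compact_cball convex_cball r(2) assms(1)] by blast
  let ?U = "U \<inter> \<phi> -` ball (\<phi> m) r"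
  have "open ?U" by (rule continuous_open_preimage[OF cont(1) U(1) open_ball])
  moreover have "Ck_on p ?U (\<lambda>x. F (\<phi> x))"
    by (rule Ck_on_compose[OF \<open>open ?U\<close> open_UNIV _ F(1)]) (auto intro: Ck_on_subset[OF smooth(1)])
  moreover have "F (\<phi> x) = f x" if "x \<in> X \<inter> ?U" for x
    using that chart(1)[of x] assms(2) F(2)[of "\<phi> x"] by auto
  ultimately show ?thesis using U(2) r(1) by (intro exI[of _ ?U] exI[of _ "\<lambda>x. F (\<phi> x)"]) auto
qed

lemma zero_mem_fibre_tau:
  assumes "a \<in> X"
  shows "(\<lambda>_. 0) \<in> fibre (tau p X) a"
proof -
  have "(\<lambda>_. 0) \<in> lspan S" for S :: "(('a \<Rightarrow> nat) \<Rightarrow> real) set"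
    unfolding lspan_def by (auto intro!: exI[of _ "{}"])
  then have "(a, \<lambda>_. 0) \<in> (rhoE p X ^^ i) (E0 p X)" for i
    using assms by (cases i) (auto simp: E0_def rhoE_def intro!: exI[of _ 0])
  then show ?thesis by (simp add: fibre_def tau_def)
qed

lemma card_mindex_gt: "p < card (mindex p :: ('n::finite \<Rightarrow> nat) set)"
proof -
  obtain i :: 'n where True by simp
  let ?g = "\<lambda>k. (\<lambda>_. 0)(i := k) :: 'n \<Rightarrow> nat"
  have "?g ` {..p} \<subseteq> mindex p" by (auto simp: mem_mindex mdeg_single)
  moreover have "inj_on ?g {..p}" by (auto simp: inj_on_def fun_eq_iff split: if_splits)
  ultimately have "card {..p} \<le> card (mindex p :: ('n \<Rightarrow> nat) set)" by (intro card_inj_on_le) auto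
  then show ?thesis by simp
qed

lemma nabla_iter_value_over_zero:
  fixes X :: "(real^'n::finite) set"
  assumes "\<forall>a\<in>X. \<forall>\<xi>\<in>fibre (tau p X) a. \<exists>!l. (a, \<xi>, l) \<in> nabla p X f"
    and l: "(c, \<lambda>_. 0, l) \<in> nabla_iter p X f (p + 2)"
  shows "l = 0"
proof -
  have "p + 2 \<le> 2 * (card (mindex p :: ('n \<Rightarrow> nat) set) + 1)"
    using card_mindex_gt[of p, where 'n = 'n] by simp
  then have "(c, \<lambda>_. 0, l) \<in> nabla p X f"
    unfolding nabla_eq_nabla_iter using nabla_iter_mono l by blast
  moreover have "c \<in> X" using l by (rule nabla_iter_base)
  moreover have "(c, \<lambda>_. 0, 0) \<in> nabla p X f"
    unfolding nabla_eq_nabla_iter by (rule nabla_iter_zero[OF \<open>c \<in> X\<close>])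
  ultimately show ?thesis using assms(1) zero_mem_fibre_tau by blast
qed

theorem theorem1p2:
  fixes X M :: "(real^'n::finite) set" and p :: nat and f :: "real^'n \<Rightarrow> real"
  assumes "closed X"
    and "X \<subseteq> M"
    and "Cp_submanifold p M"
    and "X = (top_of_set M) closure_of ((top_of_set M) interior_of X)"
  shows "(\<exists>F. Cp_on p UNIV F \<and> (\<forall>x\<in>X. F x = f x)) \<longleftrightarrow>
         (\<forall>a\<in>X. \<forall>\<xi>\<in>fibre (tau p X) a. \<exists>!l. (a, \<xi>, l) \<in> nabla p X f)"
proof
  assume "\<exists>F. Cp_on p UNIV F \<and> (\<forall>x\<in>X. F x = f x)"
  then show "\<forall>a\<in>X. \<forall>\<xi>\<in>fibre (tau p X) a. \<exists>!l. (a, \<xi>, l) \<in> nabla p X f"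
    using nabla_function_of_extension by blast
next
  assume "\<forall>a\<in>X. \<forall>\<xi>\<in>fibre (tau p X) a. \<exists>!l. (a, \<xi>, l) \<in> nabla p X f"
  note value_over_zero = nabla_iter_value_over_zero[OF this]
  have "\<exists>U F. open U \<and> m \<in> U \<and> Ck_on p U F \<and> (\<forall>x\<in>X \<inter> U. F x = f x)" if "m \<in> X" for m
    using Ck_on_extension_near[OF assms value_over_zero that] .
  then obtain F where "Ck_on p UNIV F" "\<And>x. x \<in> X \<Longrightarrow> F x = f x"
    using Ck_on_extension_of_local[OF assms(1)] by metis
  then show "\<exists>F. Cp_on p UNIV F \<and> (\<forall>x\<in>X. F x = f x)" using Cp_on_iff_Ck_on[OF open_UNIV] by blast
qed

end
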